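(* Let $\alpha\in\Theta$ be the true parameter value, let $\mu,\mu'\in\mathcal P(E)$ be initial distributions and let $u\in\mathcal P(\Theta)$ be a prior distribution. Assume: (i) There exist a sequence $\epsilon_n\downarrow 0$ and a function $p:\mathbb N\to[1,\infty)$ such that $\frac{p(n)}{n}\to 0$ as $n\to\infty$ and $$\sup_{n}\ \mathbb E_{\mu,\alpha}\left[\left(\frac{\sup_{\theta\in\mathcal N_{\epsilon_n}(\alpha)}\frac{dQ^n_{\mu,\alpha}}{dQ^n_{\mu',\theta}}(Y_n,\dots,Y_1)}{u(\mathcal N_{\epsilon_n}(\alpha))}\right)^{\frac1{p(n)}}\right]<+\infty .$$ (ii) For each $\eta>0$ there exist $\epsilon>0$ and $I_\eta>0$ such that $$\limsup_{n\to\infty}\frac1n\log\int_{\mathcal N_\eta(\alpha)^c}\mathbb P_{\mu',\theta}\big(L_n(Y)\in\mathcal B_\epsilon(\nu_\alpha)\big)\,u(d\theta)\le -I_\eta<0 .$$ Then for every $\eta>0$, $$\lim_{n\to\infty}\mathbb E_{\mu,\alpha}\,\tilde{\mathbb P}_{\mu',u}\big(\theta\in\mathcal N_\eta(\alpha)^c\,\big|\,Y_n,\dots,Y_1\big)=0 .$$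
   Context: Setting. $E$ is a Polish space with Borel $\sigma$-field $\mathcal B(E)$; $\Theta$ is a Polish space with metric $d_\Theta$. For each $\theta\in\Theta$, $K_\theta$ is a Feller transition probability kernel on $E$ that is mixing: there are $0<\epsilon_\theta\le1$ and a finite nonnegative measure $\lambda_\theta$ on $E$ with $\epsilon_\theta\lambda_\theta(A)\le K_\theta(x,A)\le\frac1{\epsilon_\theta}\lambda_\theta(A)$ for all $x\in E$, $A\in\mathcal B(E)$. Under $\mathbb P_{\mu,\theta}$ (expectation $\mathbb E_{\mu,\theta}$), $(X_n)_{n\ge0}$ is a Markov chain with initial law $\mu$ and kernel $K_\theta$, and $Y_n=h(X_n)+V_n$ for $n\ge1$, where $h:E\to\mathbb R^p$ is bounded and continuous and $(V_n)$ are i.i.d. Gaussian$(0,\sigma^2)$ $\mathbb R^p$-valued variables, independent of $X$, with density $g$. $Q^n_{\mu,\theta}$ is the law of $(Y_1,\dots,Y_n)$ under $\mathbb P_{\mu,\theta}$. $\tilde{\mathbb P}_{\mu',u}$ is the joint law of $(X,Y,\theta)$ when $\theta\sim u$ and, given $\theta$, $(X,Y)$ has law $\mathbb P_{\mu',\theta}$. Thus the posterior is $$\tilde{\mathbb P}_{\mu',u}(\theta\in A|Y_n,\dots,Y_1)=\frac{\int_A\int_{E^n}\prod_{k=1}^n g(Y_k-h(x_k))P_{\mu',\theta}(dx_1,\dots,dx_n)u(d\theta)}{\int_\Theta\int_{E^n}\prod_{k=1}^n g(Y_k-h(x_k))P_{\mu',\theta}(dx_1,\dots,dx_n)u(d\theta)},$$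 where $P_{\mu',\theta}$ is the law of $X$ under $\mathbb P_{\mu',\theta}$. $\mu_\theta$ is the unique limiting (invariant) distribution of the chain with kernel $K_\theta$, and $\nu_\theta=(\mu_\theta\circ h^{-1})\ast g$ is the limiting distribution of the observations. Standing identifiability assumption: $\alpha\ne\beta$ implies $\nu_\alpha\neq\nu_\beta$. $L_n(Y)=\frac1n\sum_{k=1}^n\delta_{Y_k}$ is the empirical measure. $\mathcal N_\rho(\alpha)$ is the ball of radius $\rho$ and center $\alpha$ in $(\Theta,d_\Theta)$; $\mathcal B_\epsilon(\nu_\alpha)$ is the ball of radius $\epsilon$ and center $\nu_\alpha$ in $\mathcal P(\mathbb R^p)$ for the Lévy–Prohorov metric; $A^c$ denotes the complement of $A$. *)

theory Defs
  imports "HOL-Probability.Probability"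
begin

section \<open>Kernels and Markov chains\<close>

definition feller_kernel :: "('e::topological_space \<Rightarrow> 'e measure) \<Rightarrow> bool" where
  "feller_kernel \<kappa> \<longleftrightarrow> \<kappa> \<in> borel \<rightarrow>\<^sub>M prob_algebra borel \<and>
     (\<forall>f::'e \<Rightarrow> real. continuous_on UNIV f \<longrightarrow> bounded (range f) \<longrightarrow>
        continuous_on UNIV (\<lambda>x. \<integral>y. f y \<partial>\<kappa> x))"

definition mixing_kernel :: "('e::topological_space \<Rightarrow> 'e measure) \<Rightarrow> bool" where
  "mixing_kernel \<kappa> \<longleftrightarrow> (\<exists>\<epsilon>::real. \<exists>m. 0 < \<epsilon> \<and> \<epsilon> \<le> 1 \<and> finite_measure m \<and> sets m = sets borel \<and>
     (\<forall>x. \<forall>A\<in>sets borel. \<epsilon> * measure m A \<le> measure (\<kappa> x) A \<and> measure (\<kappa> x) A \<le> 1 / \<epsilon> * measure m A))"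

text \<open>
  The law on path space of the Markov chain started from \<open>\<mu>\<close> with kernel \<open>\<kappa>\<close>, given by the
  Ionescu-Tulcea theorem; the conditional law of the next state depends on the last state only.
\<close>

definition chain_law ::
  "'e::topological_space measure \<Rightarrow> ('e \<Rightarrow> 'e measure) \<Rightarrow> (nat \<Rightarrow> 'e) measure" where
  "chain_law \<mu> \<kappa> = projective_family.lim UNIV
     (Ionescu_Tulcea.CI (\<lambda>n x. if n = 0 then \<mu> else \<kappa> (x (n - 1))) (\<lambda>_. borel)) (\<lambda>_. borel)"

definition invariant_law :: "('e::topological_space \<Rightarrow> 'e measure) \<Rightarrow> 'e measure" where
  "invariant_law \<kappa> = (THE m. m \<in> space (prob_algebra borel) \<and> (m \<bind> \<kappa>) = m)"

section \<open>Observations\<close>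

text \<open>The centred Gaussian density with covariance \<open>\<sigma>\<^sup>2\<close> times the identity.\<close>

definition gauss :: "real \<Rightarrow> real ^ 'p \<Rightarrow> real" where
  "gauss \<sigma> v = (\<Prod>i\<in>UNIV. normal_density 0 \<sigma> (v $ i))"

definition gauss_law :: "real \<Rightarrow> (real ^ 'p) measure" where
  "gauss_law \<sigma> = density lborel (\<lambda>v. ennreal (gauss \<sigma> v))"

text \<open>
  The canonical space carries pairs of a state path and a noise path, which are independent.
\<close>

definition hmm_law :: "real \<Rightarrow> 'e::topological_space measure \<Rightarrow> ('e \<Rightarrow> 'e measure) \<Rightarrow>
    ((nat \<Rightarrow> 'e) \<times> (nat \<Rightarrow> real ^ 'p)) measure" where
  "hmm_law \<sigma> \<mu> \<kappa> = chain_law \<mu> \<kappa> \<Otimes>\<^sub>M (\<Pi>\<^sub>M k\<in>UNIV. gauss_law \<sigma>)"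

definition obs :: "('e \<Rightarrow> real ^ 'p) \<Rightarrow> nat \<Rightarrow> (nat \<Rightarrow> 'e) \<times> (nat \<Rightarrow> real ^ 'p) \<Rightarrow> nat \<Rightarrow> real ^ 'p" where
  "obs h n \<omega> = (\<lambda>k\<in>{1..n}. h (fst \<omega> k) + snd \<omega> k)"

definition obs_law :: "('e::topological_space \<Rightarrow> real ^ 'p) \<Rightarrow> real \<Rightarrow> 'e measure \<Rightarrow>
    ('e \<Rightarrow> 'e measure) \<Rightarrow> nat \<Rightarrow> (nat \<Rightarrow> real ^ 'p) measure" where
  "obs_law h \<sigma> \<mu> \<kappa> n = distr (hmm_law \<sigma> \<mu> \<kappa>) (\<Pi>\<^sub>M k\<in>{1..n}. borel) (obs h n)"

definition limit_obs_law :: "('e::topological_space \<Rightarrow> real ^ 'p) \<Rightarrow> real \<Rightarrow>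
    ('e \<Rightarrow> 'e measure) \<Rightarrow> (real ^ 'p) measure" where
  "limit_obs_law h \<sigma> \<kappa> = (distr (invariant_law \<kappa>) borel h \<star> gauss_law \<sigma>)"

text \<open>
  The Radon-Nikodym derivative of \<open>N\<close> with respect to \<open>M\<close> (argument order as in \<^const>\<open>RN_deriv\<close>)
  in its continuous version. A supremum of derivatives over an uncountable family depends on the
  chosen versions. The laws of \<open>(Y\<^sub>1, \<dots>, Y\<^sub>n)\<close> have strictly positive continuous Lebesgue
  densities, so between them the continuous version exists and is unique on the space of \<open>M\<close>,
  namely the quotient of these densities.
\<close>

definition cont_RN_deriv :: "'a::topological_space measure \<Rightarrow> 'a measure \<Rightarrow> 'a \<Rightarrow> real" where
  "cont_RN_deriv M N = (SOME f. f \<in> borel_measurable M \<and> (\<forall>y\<in>space M. 0 \<le> f y) \<and>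
     continuous_on (space M) f \<and> density M (\<lambda>y. ennreal (f y)) = N)"

text \<open>The empirical measure of \<open>y\<^sub>1, \<dots>, y\<^sub>n\<close>, as the image of the uniform law on the indices.\<close>

definition empirical :: "nat \<Rightarrow> (nat \<Rightarrow> 'a::topological_space) \<Rightarrow> 'a measure" where
  "empirical n y = distr (uniform_count_measure {1..n}) borel y"

definition levy_prokhorov :: "'a::metric_space measure \<Rightarrow> 'a measure \<Rightarrow> real" where
  "levy_prokhorov M N = Inf {e. 0 < e \<and> (\<forall>A\<in>sets borel.
     measure M A \<le> measure N (\<Union>a\<in>A. ball a e) + e \<and>
     measure N A \<le> measure M (\<Union>a\<in>A. ball a e) + e)}"

section \<open>Posterior\<close>

definition likelihood :: "('e::topological_space \<Rightarrow> real ^ 'p) \<Rightarrow> real \<Rightarrow> 'e measure \<Rightarrow>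
    ('e \<Rightarrow> 'e measure) \<Rightarrow> nat \<Rightarrow> (nat \<Rightarrow> real ^ 'p) \<Rightarrow> real" where
  "likelihood h \<sigma> \<mu> \<kappa> n y = (\<integral>x. (\<Prod>k=1..n. gauss \<sigma> (y k - h (x k))) \<partial>chain_law \<mu> \<kappa>)"

text \<open>Bayes' formula: the conditional probability of \<open>A\<close> given that \<open>Y\<^sub>k = y k\<close> for \<open>1 \<le> k \<le> n\<close>.\<close>

definition posterior :: "('e::topological_space \<Rightarrow> real ^ 'p) \<Rightarrow> real \<Rightarrow> 'e measure \<Rightarrow>
    ('t \<Rightarrow> 'e \<Rightarrow> 'e measure) \<Rightarrow> 't measure \<Rightarrow> nat \<Rightarrow> (nat \<Rightarrow> real ^ 'p) \<Rightarrow> 't set \<Rightarrow> real" where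
  "posterior h \<sigma> \<mu> K u n y A =
     (LINT \<theta>:A|u. likelihood h \<sigma> \<mu> (K \<theta>) n y) / (LINT \<theta>|u. likelihood h \<sigma> \<mu> (K \<theta>) n y)"

section \<open>Extended-valued powers and logarithms\<close>

text \<open>Only used for exponents \<open>r > 0\<close>, so that \<open>\<infinity>\<close> is mapped to \<open>\<infinity>\<close> and \<open>0\<close> to \<open>0\<close>.\<close>

definition epowr :: "ennreal \<Rightarrow> real \<Rightarrow> ennreal" where
  "epowr x r = (if x = \<infinity> then \<infinity> else ennreal (enn2real x powr r))"

text \<open>Only used for arguments \<open>x \<ge> 0\<close>.\<close>

definition elog :: "real \<Rightarrow> ereal" where
  "elog x = (if x = 0 then - \<infinity> else ereal (ln x))"

end

theory Submission
  imports Defs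
begin

text \<open>
  Let \<open>W\<close> be the supremum of likelihood ratios in condition (i), divided by the prior mass of the
  small ball, and let \<open>t\<^sub>n = exp (n I / 4)\<close> with \<open>I\<close> from condition (ii). Where \<open>W \<le> t\<^sub>n\<close>, the
  evidence is at least \<open>1 / t\<^sub>n\<close> times the likelihood of the truth, so the posterior mass of the
  complement of the ball is at most \<open>t\<^sub>n\<close> times the integrated likelihood ratio over that
  complement. By Fubini, the expectation of this bound over the event that the empirical measure is
  close to \<open>\<nu>\<^sub>\<alpha>\<close> is \<open>t\<^sub>n\<close> times the integral in (ii), hence eventually at most \<open>exp (- n I / 4)\<close>.
  Markov's inequality applied to \<open>W\<close> raised to the power \<open>1 / p n\<close> shows that \<open>W > t\<^sub>n\<close> has
  probability at most \<open>C exp (- n I / (4 p n))\<close>.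

  It remains to see that the empirical measure is close to \<open>\<nu>\<^sub>\<alpha>\<close> with probability tending to one.
  The lower mixing bound makes the transition operator contract oscillations geometrically, so the
  indicators that \<open>Y\<^sub>k\<close> lies in a given Borel set have geometrically decaying covariances and obey a
  law of large numbers; finitely many sets of small diameter control the Levy-Prokhorov metric.
\<close>

section \<open>Doeblin kernels\<close>

text \<open>Three indirectly defined objects shape the work. \<open>invariant_law\<close> is a
  definite description, so existence and uniqueness of the invariant law must be proved before the
  limiting observation law can be computed. Existence rests on the upper mixing bound: the limits of
  \<open>(P ^^ n) (indicator A)\<close> are finitely additive in \<open>A\<close> and dominated by a
  multiple of the finite measure \<open>m\<close>, hence countably additive.
  \<open>cont_RN_deriv\<close> is a choice; positivity and continuity of the likelihoods pin it down
  as their quotient at every point, and only then is the supremum over an uncountable ball a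
  definite and measurable function. \<open>levy_prokhorov\<close> is an infimum over a condition on
  all Borel sets; for empirical measures its sublevel sets are open in the sample, hence events. The
  covariances are centred at the invariant mean, not at the mean at time \<open>k\<close>, and the
  contraction is uniform in the starting point; this is how an arbitrary initial law \<mu> is
  handled.\<close>

locale doeblin_kernel =
  fixes M :: "'a measure" and \<kappa> :: "'a \<Rightarrow> 'a measure" and m :: "'a measure" and \<epsilon> :: real
  assumes kernel[measurable]: "\<kappa> \<in> M \<rightarrow>\<^sub>M prob_algebra M"
    and nonempty: "space M \<noteq> {}"
    and finite_m: "finite_measure m"
    and sets_m[measurable_cong]: "sets m = sets M"
    and eps_pos: "0 < \<epsilon>"
    and lower: "\<And>x A. x \<in> space M \<Longrightarrow> A \<in> sets M \<Longrightarrow> \<epsilon> * measure m A \<le> measure (\<kappa> x) A"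
    and upper: "\<And>x A. x \<in> space M \<Longrightarrow> A \<in> sets M \<Longrightarrow> measure (\<kappa> x) A \<le> 1 / \<epsilon> * measure m A"
begin

section \<open>Minorisation and contraction of oscillations\<close>

definition P :: "('a \<Rightarrow> real) \<Rightarrow> 'a \<Rightarrow> real" where
  "P f x = (\<integral>y. f y \<partial>\<kappa> x)"

text \<open>The contraction factor: every \<open>\<kappa> x\<close> contains the common part
  \<open>\<epsilon> * m\<close>, so only mass \<open>r\<close> can depend on
  \<open>x\<close>.\<close>

definition r :: real where
  "r = 1 - \<epsilon> * measure m (space M)"

lemma kernel_at:
  assumes "x \<in> space M"
  shows "prob_space (\<kappa> x)" "sets (\<kappa> x) = sets M" "space (\<kappa> x) = space M"
proof -
  have "\<kappa> x \<in> space (prob_algebra M)"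
    using kernel assms by (rule measurable_space)
  then show "prob_space (\<kappa> x)" "sets (\<kappa> x) = sets M" by (auto simp: space_prob_algebra)
  then show "space (\<kappa> x) = space M" by (intro sets_eq_imp_space_eq)
qed

lemma space_m: "space m = space M"
  by (rule sets_eq_imp_space_eq[OF sets_m])

lemma measurable_P[measurable]: "f \<in> borel_measurable M \<Longrightarrow> P f \<in> borel_measurable M"
  unfolding P_def[abs_def]
  by (rule measurable_compose[OF measurable_prob_algebraD[OF kernel] integral_measurable_subprob_algebra])

lemma measurable_kernel_at: "x \<in> space M \<Longrightarrow> f \<in> M \<rightarrow>\<^sub>M N \<Longrightarrow> f \<in> \<kappa> x \<rightarrow>\<^sub>M N"
  using measurable_cong_sets[OF kernel_at(2) refl] by auto

lemma measurable_m: "f \<in> M \<rightarrow>\<^sub>M N \<Longrightarrow> f \<in> m \<rightarrow>\<^sub>M N"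
  using measurable_cong_sets[OF sets_m refl] by auto

lemma integrable_kernel:
  fixes f :: "'a \<Rightarrow> real"
  assumes "f \<in> borel_measurable M" "\<And>y. y \<in> space M \<Longrightarrow> \<bar>f y\<bar> \<le> B" "x \<in> space M"
  shows "integrable (\<kappa> x) f"
proof -
  interpret prob_space "\<kappa> x" by (rule kernel_at) fact
  show ?thesis
    using assms
    by (intro integrable_const_bound[where B=B] AE_I2 measurable_kernel_at)
      (auto simp: kernel_at(3)[OF assms(3)])
qed

lemma integrable_m:
  fixes f :: "'a \<Rightarrow> real"
  assumes "f \<in> borel_measurable M" "\<And>y. y \<in> space M \<Longrightarrow> \<bar>f y\<bar> \<le> B"
  shows "integrable m f"
proof -
  interpret finite_measure m by (rule finite_m)
  show ?thesis
    using assms by (intro integrable_const_bound[where B=B] AE_I2 measurable_m) (auto simp: space_m)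
qed

text \<open>The setwise minorisation says that \<open>scale_measure \<epsilon> m\<close> lies below
  \<open>\<kappa> x\<close> in the order of measures, and nonnegative integrals are monotone in the
  measure. Boundedness of \<open>f\<close> allows the return to real integrals.\<close>

lemma lower_integral:
  assumes f: "f \<in> borel_measurable M" "\<And>y. y \<in> space M \<Longrightarrow> 0 \<le> f y" "\<And>y. y \<in> space M \<Longrightarrow> f y \<le> B"
    and x: "x \<in> space M"
  shows "\<epsilon> * (\<integral>y. f y \<partial>m) \<le> P f x"
proof -
  interpret K: prob_space "\<kappa> x" by (rule kernel_at) fact
  interpret m: finite_measure m by (rule finite_m)
  have fm: "f \<in> borel_measurable m"
    using f(1) by (rule measurable_m)
  have B: "\<bar>f y\<bar> \<le> B" if "y \<in> space M" for y
    using f(2,3)[OF that] by simp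
  have int: "integrable (\<kappa> x) f" "integrable m f"
    by (rule integrable_kernel[OF f(1) B x] integrable_m[OF f(1) B]; assumption)+
  have "scale_measure (ennreal \<epsilon>) m \<le> \<kappa> x"
  proof (subst le_measure)
    show "sets (scale_measure (ennreal \<epsilon>) m) = sets (\<kappa> x)"
      by (simp add: sets_m kernel_at(2)[OF x])
    show "\<forall>A\<in>sets (scale_measure (ennreal \<epsilon>) m). emeasure (scale_measure (ennreal \<epsilon>) m) A \<le> emeasure (\<kappa> x) A"
      using lower[OF x] eps_pos
      by (auto simp: sets_m m.emeasure_eq_measure K.emeasure_eq_measure ennreal_mult[symmetric]
          intro!: ennreal_leI)
  qed
  then have "(\<integral>\<^sup>+y. ennreal (f y) \<partial>scale_measure (ennreal \<epsilon>) m) \<le> (\<integral>\<^sup>+y. ennreal (f y) \<partial>\<kappa> x)"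
    by (intro nn_integral_mono_measure) (simp_all add: sets_m kernel_at(2)[OF x])
  then have "ennreal \<epsilon> * (\<integral>\<^sup>+y. ennreal (f y) \<partial>m) \<le> (\<integral>\<^sup>+y. ennreal (f y) \<partial>\<kappa> x)"
    using fm by (subst (asm) nn_integral_scale_measure) auto
  moreover have "(\<integral>\<^sup>+y. ennreal (f y) \<partial>m) = ennreal (\<integral>y. f y \<partial>m)"
    using f(2) int by (intro nn_integral_eq_integral AE_I2) (auto simp: space_m)
  moreover have "(\<integral>\<^sup>+y. ennreal (f y) \<partial>\<kappa> x) = ennreal (\<integral>y. f y \<partial>\<kappa> x)"
    using f(2) int by (intro nn_integral_eq_integral AE_I2) (auto simp: kernel_at[OF x])
  moreover have "0 \<le> (\<integral>y. f y \<partial>m)"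
    using f(2) by (intro Bochner_Integration.integral_nonneg) (auto simp: space_m)
  moreover have P: "0 \<le> (\<integral>y. f y \<partial>\<kappa> x)"
    using f(2) by (intro Bochner_Integration.integral_nonneg) (auto simp: kernel_at[OF x])
  ultimately have "ennreal (\<epsilon> * (\<integral>y. f y \<partial>m)) \<le> ennreal (\<integral>y. f y \<partial>\<kappa> x)"
    using eps_pos by (simp add: ennreal_mult)
  then show ?thesis
    using P by (simp add: P_def)
qed

lemma P_bounds:
  assumes "f \<in> borel_measurable M" "\<And>y. y \<in> space M \<Longrightarrow> l \<le> f y \<and> f y \<le> b" "x \<in> space M"
  shows "l \<le> P f x \<and> P f x \<le> b"
proof -
  interpret prob_space "\<kappa> x" by (rule kernel_at) fact
  have "\<bar>f y\<bar> \<le> \<bar>l\<bar> + \<bar>b\<bar>" if "y \<in> space M" for y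
    using assms(2)[OF that] by linarith
  then have i: "integrable (\<kappa> x) f"
    using assms(1,3) by (intro integrable_kernel)
  have "(\<integral>y. l \<partial>\<kappa> x) \<le> P f x" unfolding P_def
    using assms(2) i by (intro integral_mono) (auto simp: kernel_at(3)[OF assms(3)])
  moreover have "P f x \<le> (\<integral>y. b \<partial>\<kappa> x)" unfolding P_def
    using assms(2) i by (intro integral_mono) (auto simp: kernel_at(3)[OF assms(3)])
  ultimately show ?thesis unfolding lebesgue_integral_const prob_space by simp
qed

text \<open>With \<open>A = space M\<close> in the upper bound, the unit mass of
  \<open>\<kappa> x\<close> forces mass at least \<open>\<epsilon>\<close> on \<open>m\<close>. This
  is what makes \<open>r\<close> strictly less than 1.\<close>

lemma measure_m_pos: "0 < measure m (space M)"
proof -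
  obtain x where x: "x \<in> space M" using nonempty by auto
  have "measure (\<kappa> x) (space M) = 1"
    using prob_space.prob_space[OF kernel_at(1)[OF x]] unfolding kernel_at(3)[OF x] .
  then have "1 \<le> 1 / \<epsilon> * measure m (space M)"
    using upper[OF x sets.top] by linarith
  then have "\<epsilon> \<le> measure m (space M)" using eps_pos by (simp add: field_simps)
  then show ?thesis using eps_pos by simp
qed

lemma r_bounds: "0 \<le> r" "r < 1"
proof -
  obtain x where x: "x \<in> space M" using nonempty by auto
  have "measure (\<kappa> x) (space M) = 1"
    using prob_space.prob_space[OF kernel_at(1)[OF x]] unfolding kernel_at(3)[OF x] .
  then show "0 \<le> r"
    using lower[OF x sets.top] unfolding r_def by linarith
  show "r < 1" using measure_m_pos eps_pos by (simp add: r_def)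
qed

text \<open>Both \<open>f - l\<close> and \<open>l + d - f\<close> are nonnegative; the minorisation
  applied to the first bounds \<open>P f\<close> from below, applied to the second from above. The
  new left end is \<open>l + \<epsilon> * (\<integral>y. f y - l \<partial>m)\<close>, which does
  not depend on \<open>x\<close>, and what remains of the length is
  \<open>d - \<epsilon> * d * measure m (space M) = r * d\<close>.\<close>

lemma P_contraction:
  assumes f[measurable]: "f \<in> borel_measurable M"
    and b: "\<And>y. y \<in> space M \<Longrightarrow> l \<le> f y \<and> f y \<le> l + d"
  obtains l' where "\<And>x. x \<in> space M \<Longrightarrow> l' \<le> P f x \<and> P f x \<le> l' + r * d"
proof
  interpret m: finite_measure m by (rule finite_m)
  fix x assume x: "x \<in> space M"
  interpret K: prob_space "\<kappa> x" by (rule kernel_at) fact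
  have B: "\<bar>f y\<bar> \<le> max \<bar>l\<bar> \<bar>l + d\<bar>" if "y \<in> space M" for y
    using b[OF that] by linarith
  have i: "integrable (\<kappa> x) f" "integrable m f"
    by (rule integrable_kernel[OF f B x] integrable_m[OF f B]; assumption)+
  have "\<epsilon> * (\<integral>y. f y - l \<partial>m) \<le> P (\<lambda>y. f y - l) x"
    using b x by (intro lower_integral[where B="d"]) (auto simp: algebra_simps)
  moreover have "P (\<lambda>y. f y - l) x = P f x - l"
    using i by (simp add: P_def K.prob_space)
  moreover have "\<epsilon> * (\<integral>y. l + d - f y \<partial>m) \<le> P (\<lambda>y. l + d - f y) x"
    using b x by (intro lower_integral[where B="d"]) (auto simp: algebra_simps)
  moreover have "P (\<lambda>y. l + d - f y) x = l + d - P f x"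
    using i by (simp add: P_def K.prob_space)
  moreover have "(\<integral>y. l + d - f y \<partial>m) = d * measure m (space M) - (\<integral>y. f y - l \<partial>m)"
    using i by (simp add: space_m algebra_simps)
  then have "\<epsilon> * (\<integral>y. l + d - f y \<partial>m) = \<epsilon> * (d * measure m (space M)) - \<epsilon> * (\<integral>y. f y - l \<partial>m)"
    by (simp only: right_diff_distrib)
  moreover have "r * d = d - \<epsilon> * (d * measure m (space M))"
    by (simp add: r_def algebra_simps)
  ultimately show "l + \<epsilon> * (\<integral>y. f y - l \<partial>m) \<le> P f x \<and>
      P f x \<le> l + \<epsilon> * (\<integral>y. f y - l \<partial>m) + r * d"
    by linarith
qed

lemma measurable_P_pow[measurable]: "f \<in> borel_measurable M \<Longrightarrow> (P ^^ n) f \<in> borel_measurable M"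
  by (induction n) auto

lemma P_pow_bounds:
  assumes "f \<in> borel_measurable M" "\<And>y. y \<in> space M \<Longrightarrow> l \<le> f y \<and> f y \<le> b" "x \<in> space M"
  shows "l \<le> (P ^^ n) f x \<and> (P ^^ n) f x \<le> b"
  using assms(3)
proof (induction n arbitrary: x)
  case (Suc n)
  then show ?case
    using P_bounds[OF measurable_P_pow[OF assms(1)] Suc.IH Suc.prems] by simp
qed (use assms in auto)

lemma P_pow_contraction:
  assumes f[measurable]: "f \<in> borel_measurable M"
    and b: "\<And>y. y \<in> space M \<Longrightarrow> 0 \<le> f y \<and> f y \<le> 1"
  shows "\<exists>l. \<forall>x\<in>space M. l \<le> (P ^^ n) f x \<and> (P ^^ n) f x \<le> l + r ^ n"
proof (induction n)
  case 0
  then show ?case using b by (intro exI[of _ 0]) auto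
next
  case (Suc n)
  then obtain l where l: "\<And>x. x \<in> space M \<Longrightarrow> l \<le> (P ^^ n) f x \<and> (P ^^ n) f x \<le> l + r ^ n"
    by auto
  obtain l' where "\<And>x. x \<in> space M \<Longrightarrow> l' \<le> P ((P ^^ n) f) x \<and> P ((P ^^ n) f) x \<le> l' + r * r ^ n"
    using P_contraction[OF measurable_P_pow[OF f] l] by blast
  then show ?case by (intro exI[of _ l']) simp
qed

lemma P_add:
  assumes "f \<in> borel_measurable M" "\<And>y. y \<in> space M \<Longrightarrow> \<bar>f y\<bar> \<le> B"
    and "g \<in> borel_measurable M" "\<And>y. y \<in> space M \<Longrightarrow> \<bar>g y\<bar> \<le> B'" and "x \<in> space M"
  shows "P (\<lambda>y. f y + g y) x = P f x + P g x"
  unfolding P_def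
  by (rule Bochner_Integration.integral_add[OF integrable_kernel[OF assms(1,2,5)]
        integrable_kernel[OF assms(3,4,5)]])

lemma P_cong: "(\<And>y. y \<in> space M \<Longrightarrow> f y = g y) \<Longrightarrow> x \<in> space M \<Longrightarrow> P f x = P g x"
  unfolding P_def using kernel_at[of x] by (intro Bochner_Integration.integral_cong) auto

lemma P_pow_abs_le:
  assumes "f \<in> borel_measurable M" "\<And>y. y \<in> space M \<Longrightarrow> \<bar>f y\<bar> \<le> B" "x \<in> space M"
  shows "\<bar>(P ^^ n) f x\<bar> \<le> B"
proof -
  have "- B \<le> f y \<and> f y \<le> B" if "y \<in> space M" for y using assms(2)[OF that] by linarith
  from P_pow_bounds[OF assms(1) this assms(3), of n] show ?thesis by (simp add: abs_le_iff)
qed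

lemma P_pow_add:
  assumes "f \<in> borel_measurable M" "\<And>y. y \<in> space M \<Longrightarrow> \<bar>f y\<bar> \<le> B"
    and "g \<in> borel_measurable M" "\<And>y. y \<in> space M \<Longrightarrow> \<bar>g y\<bar> \<le> B'" and "x \<in> space M"
  shows "(P ^^ n) (\<lambda>y. f y + g y) x = (P ^^ n) f x + (P ^^ n) g x"
  using assms(5)
proof (induction n arbitrary: x)
  case (Suc n)
  have "(P ^^ Suc n) (\<lambda>y. f y + g y) x = P (\<lambda>y. (P ^^ n) f y + (P ^^ n) g y) x"
    using P_cong[OF Suc.IH Suc.prems] by simp
  also have "\<dots> = P ((P ^^ n) f) x + P ((P ^^ n) g) x"
    by (rule P_add[OF measurable_P_pow[OF assms(1)] P_pow_abs_le[OF assms(1,2)]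
          measurable_P_pow[OF assms(3)] P_pow_abs_le[OF assms(3,4)] Suc.prems])
  finally show ?case by simp
qed simp

lemma P_pow_cmult: "x \<in> space M \<Longrightarrow> (P ^^ n) (\<lambda>y. c * f y) x = c * (P ^^ n) f x"
proof (induction n arbitrary: x)
  case (Suc n)
  have "(P ^^ Suc n) (\<lambda>y. c * f y) x = P (\<lambda>y. c * (P ^^ n) f y) x"
    using P_cong[OF Suc.IH Suc.prems] by simp
  also have "\<dots> = c * P ((P ^^ n) f) x" by (simp add: P_def[of _ x])
  finally show ?case by simp
qed simp

section \<open>Invariant laws: rate of convergence and uniqueness\<close>

definition invariant :: "'a measure \<Rightarrow> bool" where
  "invariant q \<longleftrightarrow> q \<in> space (prob_algebra M) \<and> (q \<bind> \<kappa>) = q"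

lemma invariant_P_pow:
  assumes q: "invariant q"
    and f: "f \<in> borel_measurable M" "\<And>y. y \<in> space M \<Longrightarrow> \<bar>f y\<bar> \<le> B"
  shows "(\<integral>x. (P ^^ n) f x \<partial>q) = (\<integral>x. f x \<partial>q)"
proof (induction n)
  case (Suc n)
  have q': "prob_space q" "sets q = sets M" using q by (auto simp: invariant_def space_prob_algebra)
  then interpret prob_space q by simp
  have [simp]: "space q = space M" by (rule sets_eq_imp_space_eq[OF q'(2)])
  have "(\<integral>x. f x \<partial>q) = (\<integral>x. (P ^^ n) f x \<partial>(q \<bind> \<kappa>))"
    using q by (simp add: Suc invariant_def)
  also have "\<dots> = (\<integral>x. (\<integral>y. (P ^^ n) f y \<partial>\<kappa> x) \<partial>q)"
  proof (rule integral_bind[where K=M and B'=1])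
    show "(P ^^ n) f \<in> borel_measurable M" using f by simp
    show "\<bar>(P ^^ n) f x\<bar> \<le> B" if "x \<in> space M" for x using f that by (rule P_pow_abs_le)
    show "\<kappa> \<in> q \<rightarrow>\<^sub>M subprob_algebra M"
      using measurable_prob_algebraD[OF kernel] q' by (simp cong: measurable_cong_sets)
    show "AE x in q. emeasure (\<kappa> x) (space (\<kappa> x)) \<le> ennreal 1"
      by (rule AE_I2) (simp add: prob_space.emeasure_space_1[OF kernel_at(1)])
  qed unfold_locales
  finally show ?case by (simp add: P_def[of "(P ^^ n) f"])
qed simp

text \<open>All values of \<open>(P ^^ n) f\<close> lie in one interval of length
  \<open>r ^ n\<close>. By invariance their \<open>q\<close>-mean is still that of \<open>f\<close>,
  and a mean lies in the same interval as the values.\<close>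

lemma P_pow_tendsto_invariant:
  assumes q: "invariant q"
    and f: "f \<in> borel_measurable M" "\<And>y. y \<in> space M \<Longrightarrow> 0 \<le> f y \<and> f y \<le> 1" and x: "x \<in> space M"
  shows "\<bar>(P ^^ n) f x - (\<integral>y. f y \<partial>q)\<bar> \<le> r ^ n"
proof -
  have q': "prob_space q" "sets q = sets M" using q by (auto simp: invariant_def space_prob_algebra)
  then interpret prob_space q by simp
  have [simp]: "space q = space M" by (rule sets_eq_imp_space_eq[OF q'(2)])
  have B: "\<bar>f y\<bar> \<le> 1" if "y \<in> space M" for y using f(2)[OF that] by simp
  obtain l where l: "\<And>x. x \<in> space M \<Longrightarrow> l \<le> (P ^^ n) f x \<and> (P ^^ n) f x \<le> l + r ^ n"
    using P_pow_contraction[OF f] by blast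
  have i: "integrable q ((P ^^ n) f)"
  proof (rule integrable_const_bound[where B=1])
    show "AE x in q. norm ((P ^^ n) f x) \<le> 1"
      by (rule AE_I2) (simp add: P_pow_abs_le[OF f(1) B])
    show "(P ^^ n) f \<in> borel_measurable q"
      using measurable_P_pow[OF f(1)] q'(2) by (simp cong: measurable_cong_sets)
  qed
  have "(\<integral>y. l \<partial>q) \<le> (\<integral>y. (P ^^ n) f y \<partial>q)"
    using l i by (intro integral_mono) auto
  moreover have "(\<integral>y. (P ^^ n) f y \<partial>q) \<le> (\<integral>y. l + r ^ n \<partial>q)"
    using l i by (intro integral_mono) auto
  ultimately show ?thesis
    using l[OF x] invariant_P_pow[OF q f(1) B, of n] unfolding lebesgue_integral_const prob_space
    by (simp add: abs_le_iff)
qed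

text \<open>The iterates of an indicator at one fixed point do not involve the invariant law, yet
  converge to the mass that each invariant law gives to the set.\<close>

lemma invariant_unique:
  assumes "invariant p" "invariant q"
  shows "p = q"
proof (rule measure_eqI)
  show s: "sets p = sets q" using assms by (auto simp: invariant_def space_prob_algebra)
  fix A assume A: "A \<in> sets p"
  interpret p: prob_space p using assms by (auto simp: invariant_def space_prob_algebra)
  interpret q: prob_space q using assms by (auto simp: invariant_def space_prob_algebra)
  obtain x where x: "x \<in> space M" using nonempty by auto
  have pM: "sets p = sets M" using assms by (auto simp: invariant_def space_prob_algebra)
  have m: "indicator A \<in> borel_measurable M" using A pM by auto
  have b: "0 \<le> (indicator A y :: real) \<and> indicator A y \<le> (1::real)" for y
    by (auto simp: indicator_def)
  have r0: "(\<lambda>n. r ^ n) \<longlonglongrightarrow> 0" using r_bounds by (intro LIMSEQ_realpow_zero) auto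
  have lim: "(\<lambda>n. (P ^^ n) (indicator A) x) \<longlonglongrightarrow> (\<integral>y. indicator A y \<partial>q)" if "invariant q" for q
  proof (rule LIM_zero_cancel, rule Lim_null_comparison[OF _ r0], rule always_eventually, rule allI)
    show "norm ((P ^^ n) (indicator A) x - (\<integral>y. indicator A y \<partial>q)) \<le> r ^ n" for n
      using P_pow_tendsto_invariant[OF that m b x] by (simp only: real_norm_def)
  qed
  have "measure p A = measure q A"
    using LIMSEQ_unique[OF lim[OF assms(1)] lim[OF assms(2)]] A s pM
    by simp
  then show "emeasure p A = emeasure q A"
    by (simp add: p.emeasure_eq_measure q.emeasure_eq_measure)
qed

section \<open>Existence: the invariant law as the limit of the iterates\<close>

definition limP :: "('a \<Rightarrow> real) \<Rightarrow> real" where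
  "limP f = lim (\<lambda>n. (P ^^ n) f (SOME x. x \<in> space M))"

text \<open>The function \<open>(P ^^ (n + k)) f\<close> averages \<open>(P ^^ n) f\<close>, so it
  stays in the interval of length \<open>r ^ n\<close> that holds all values of the latter. This
  gives the Cauchy property, and also shows that the point chosen in \<open>limP\<close> is
  immaterial, since iterates at two points differ by at most \<open>r ^ n\<close>.\<close>

lemma P_pow_limP:
  assumes f: "f \<in> borel_measurable M" "\<And>y. y \<in> space M \<Longrightarrow> 0 \<le> f y \<and> f y \<le> 1" and x: "x \<in> space M"
  shows "(\<lambda>n. (P ^^ n) f x) \<longlonglongrightarrow> limP f"
proof -
  have diff: "\<bar>(P ^^ (n + k)) f x - (P ^^ n) f y\<bar> \<le> r ^ n" if x: "x \<in> space M" "y \<in> space M" for n k x y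
  proof -
    obtain l where l: "\<And>x. x \<in> space M \<Longrightarrow> l \<le> (P ^^ n) f x \<and> (P ^^ n) f x \<le> l + r ^ n"
      using P_pow_contraction[OF f] by blast
    have "(P ^^ (n + k)) f x = (P ^^ k) ((P ^^ n) f) x"
      by (simp add: add.commute[of n] funpow_add)
    then show ?thesis
      using P_pow_bounds[OF measurable_P_pow[OF f(1)] l x(1), of k] l[OF x(2)] by (simp add: abs_le_iff)
  qed
  have r0: "(\<lambda>n. r ^ n) \<longlonglongrightarrow> 0"
    using r_bounds by (intro LIMSEQ_realpow_zero) auto
  define z where "z = (SOME x. x \<in> space M)"
  have z: "z \<in> space M" unfolding z_def using nonempty by (simp add: some_in_eq)
  have "Cauchy (\<lambda>n. (P ^^ n) f z)"
  proof (rule metric_CauchyI)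
    fix e :: real assume "0 < e"
    then obtain N where N: "r ^ N < e"
      using order_tendstoD(2)[OF r0, of e] by (auto simp: eventually_sequentially)
    have "dist ((P ^^ i) f z) ((P ^^ j) f z) < e" if ij: "N \<le> i" "i \<le> j" for i j
    proof -
      have "dist ((P ^^ i) f z) ((P ^^ j) f z) \<le> r ^ i"
        using diff[OF z z, of i "j - i"] ij by (simp add: dist_real_def abs_minus_commute)
      also have "\<dots> \<le> r ^ N" using r_bounds ij by (intro power_decreasing) auto
      finally show ?thesis using N by simp
    qed
    then show "\<exists>N. \<forall>i\<ge>N. \<forall>j\<ge>N. dist ((P ^^ i) f z) ((P ^^ j) f z) < e"
      by (metis dist_commute nle_le)
  qed
  then have "(\<lambda>n. (P ^^ n) f z) \<longlonglongrightarrow> limP f"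
    unfolding limP_def z_def[symmetric] by (simp add: Cauchy_convergent convergent_LIMSEQ_iff[symmetric])
  moreover have "(\<lambda>n. (P ^^ n) f x - (P ^^ n) f z) \<longlonglongrightarrow> 0"
  proof (rule Lim_null_comparison[OF _ r0], rule always_eventually, rule allI)
    show "norm ((P ^^ n) f x - (P ^^ n) f z) \<le> r ^ n" for n
      using diff[OF x z, of n 0] by simp
  qed
  ultimately show ?thesis
    using tendsto_add by fastforce
qed

lemma limP_bounds:
  assumes f: "f \<in> borel_measurable M" "\<And>y. y \<in> space M \<Longrightarrow> 0 \<le> f y \<and> f y \<le> 1"
    and b: "\<And>y. y \<in> space M \<Longrightarrow> l \<le> f y \<and> f y \<le> b"
  shows "l \<le> limP f" "limP f \<le> b"
proof -
  obtain x where x: "x \<in> space M" using nonempty by auto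
  show "l \<le> limP f" "limP f \<le> b"
    using P_pow_bounds[OF f(1) b x]
    by (auto intro!: LIMSEQ_le_const[OF P_pow_limP[OF f x]] LIMSEQ_le_const2[OF P_pow_limP[OF f x]])
qed

lemma limP_P:
  assumes f: "f \<in> borel_measurable M" "\<And>y. y \<in> space M \<Longrightarrow> 0 \<le> f y \<and> f y \<le> 1"
  shows "limP (P f) = limP f"
proof -
  obtain x where x: "x \<in> space M" using nonempty by auto
  have "(\<lambda>n. (P ^^ Suc n) f x) \<longlonglongrightarrow> limP f"
    using LIMSEQ_Suc[OF P_pow_limP[OF f x]] .
  then have "(\<lambda>n. (P ^^ n) (P f) x) \<longlonglongrightarrow> limP f"
    by (simp add: funpow_swap1)
  moreover have "(\<lambda>n. (P ^^ n) (P f) x) \<longlonglongrightarrow> limP (P f)"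
    using P_bounds[OF f] by (intro P_pow_limP measurable_P f x)
  ultimately show ?thesis by (rule LIMSEQ_unique[symmetric])
qed

text \<open>The bound on the sum keeps all three functions between 0 and 1, the range for which
  convergence of the iterates has been established.\<close>

lemma limP_add:
  assumes f: "f \<in> borel_measurable M" "\<And>y. y \<in> space M \<Longrightarrow> 0 \<le> f y"
    and g: "g \<in> borel_measurable M" "\<And>y. y \<in> space M \<Longrightarrow> 0 \<le> g y"
    and le: "\<And>y. y \<in> space M \<Longrightarrow> f y + g y \<le> 1"
  shows "limP (\<lambda>y. f y + g y) = limP f + limP g"
proof -
  obtain x where x: "x \<in> space M" using nonempty by auto
  have b: "0 \<le> f y \<and> f y \<le> 1" "0 \<le> g y \<and> g y \<le> 1" if "y \<in> space M" for y
    using f(2)[OF that] g(2)[OF that] le[OF that] by auto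
  then have B: "\<bar>f y\<bar> \<le> 1" "\<bar>g y\<bar> \<le> 1" if "y \<in> space M" for y using that by force+
  have "(\<lambda>n. (P ^^ n) f x + (P ^^ n) g x) \<longlonglongrightarrow> limP f + limP g"
    by (intro tendsto_add P_pow_limP f(1) g(1) b x)
  then have "(\<lambda>n. (P ^^ n) (\<lambda>y. f y + g y) x) \<longlonglongrightarrow> limP f + limP g"
    by (simp add: P_pow_add[OF f(1) B(1) g(1) B(2) x])
  moreover have "(\<lambda>n. (P ^^ n) (\<lambda>y. f y + g y) x) \<longlonglongrightarrow> limP (\<lambda>y. f y + g y)"
    using f g le x by (intro P_pow_limP) (auto intro: add_nonneg_nonneg)
  ultimately show ?thesis by (rule LIMSEQ_unique[symmetric])
qed

lemma limP_cmult:
  assumes f: "f \<in> borel_measurable M" "\<And>y. y \<in> space M \<Longrightarrow> 0 \<le> f y \<and> f y \<le> 1" and c: "0 \<le> c" "c \<le> 1"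
  shows "limP (\<lambda>y. c * f y) = c * limP f"
proof -
  obtain x where x: "x \<in> space M" using nonempty by auto
  have "(\<lambda>n. (P ^^ n) (\<lambda>y. c * f y) x) \<longlonglongrightarrow> c * limP f"
    unfolding P_pow_cmult[OF x] by (intro tendsto_mult tendsto_const P_pow_limP f x)
  moreover have "(\<lambda>n. (P ^^ n) (\<lambda>y. c * f y) x) \<longlonglongrightarrow> limP (\<lambda>y. c * f y)"
    using f c x by (intro P_pow_limP) (auto intro: mult_le_one)
  ultimately show ?thesis by (rule LIMSEQ_unique[symmetric])
qed

lemma limP_indicator_Un:
  assumes "A \<in> sets M" "B \<in> sets M" "A \<inter> B = {}"
  shows "limP (indicator (A \<union> B)) = limP (indicator A) + limP (indicator B)"
proof -
  have "limP (\<lambda>y. indicator A y + indicator B y) = limP (indicator A) + limP (indicator B)"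
    using assms by (intro limP_add) (auto simp: indicator_def)
  moreover have "(\<lambda>y. indicator A y + indicator B y) = (indicator (A \<union> B) :: 'a \<Rightarrow> real)"
    using assms(3) by (auto simp: indicator_def fun_eq_iff)
  ultimately show ?thesis by simp
qed

lemma P_indicator:
  assumes "x \<in> space M" "A \<in> sets M"
  shows "P (indicator A) x = measure (\<kappa> x) A"
  using assms by (simp add: P_def kernel_at)

text \<open>One application of \<open>P\<close> leaves the limit unchanged, and
  \<open>P (indicator A) x\<close> is \<open>measure (\<kappa> x) A\<close>, to which the upper
  mixing bound applies. The domination by a finite measure is what yields countable additivity
  below.\<close>

lemma limP_indicator_bounds:
  assumes A: "A \<in> sets M"
  shows "0 \<le> limP (indicator A)" "limP (indicator A) \<le> 1 / \<epsilon> * measure m A"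
proof -
  have f: "indicator A \<in> borel_measurable M" "0 \<le> (indicator A y :: real) \<and> indicator A y \<le> (1::real)" for y
    using A by (auto simp: indicator_def)
  show "0 \<le> limP (indicator A)" using limP_bounds[OF f f(2)] by simp
  have "limP (P (indicator A)) \<le> 1 / \<epsilon> * measure m A"
    using P_bounds[OF f] P_indicator[OF _ A] upper[OF _ A] A
    by (intro limP_bounds(2)[where l=0] measurable_P f(1)) auto
  then show "limP (indicator A) \<le> 1 / \<epsilon> * measure m A"
    by (simp add: limP_P[OF f])
qed

definition stationary :: "'a measure" where
  "stationary = measure_of (space M) (sets M) (\<lambda>A. ennreal (limP (indicator A)))"

lemma sets_stationary[measurable_cong, simp]: "sets stationary = sets M"
  by (simp add: stationary_def sets.sigma_sets_eq)

lemma space_stationary[simp]: "space stationary = space M"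
  by (rule sets_eq_imp_space_eq) simp

text \<open>A definition by \<open>measure_of\<close> has this value only if the set function is
  countably additive. Finite additivity is that of the limits; continuity at the empty set is
  inherited from \<open>m\<close>, which dominates up to the factor
  \<open>1 / \<epsilon>\<close>.\<close>

lemma emeasure_stationary:
  assumes "A \<in> sets M"
  shows "emeasure stationary A = ennreal (limP (indicator A))"
proof (rule emeasure_measure_of_sigma[of "space M" "sets M" "\<lambda>A. ennreal (limP (indicator A))" A,
      folded stationary_def])
  interpret m: finite_measure m by (rule finite_m)
  let ?q = "\<lambda>A. ennreal (limP (indicator A))"
  show "sigma_algebra (space M) (sets M)" by (rule sets.sigma_algebra_axioms)
  show pos: "positive (sets M) ?q"
  proof -
    have "limP (indicator {}) \<le> 0"
      using limP_indicator_bounds(2)[of "{}"] by simp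
    then show ?thesis by (simp add: positive_def ennreal_neg)
  qed
  show "countably_additive (sets M) ?q"
  proof (rule sets.empty_continuous_imp_countably_additive)
    show "additive (sets M) ?q"
      by (simp add: additive_def limP_indicator_Un limP_indicator_bounds(1) flip: ennreal_plus)
    fix A :: "nat \<Rightarrow> 'a set" assume A: "range A \<subseteq> sets M" "decseq A" "(\<Inter>i. A i) = {}"
    have "(\<lambda>i. measure m (A i)) \<longlonglongrightarrow> measure m (\<Inter>i. A i)"
      using A by (intro m.finite_Lim_measure_decseq) (auto simp: sets_m)
    then have "(\<lambda>i. 1 / \<epsilon> * measure m (A i)) \<longlonglongrightarrow> 1 / \<epsilon> * 0"
      using A by (intro tendsto_mult tendsto_const) simp
    then have up: "(\<lambda>i. 1 / \<epsilon> * measure m (A i)) \<longlonglongrightarrow> 0" by simp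
    have "A i \<in> sets M" for i using A(1) by auto
    then have "(\<lambda>i. limP (indicator (A i))) \<longlonglongrightarrow> 0"
      by (intro tendsto_sandwich[OF _ _ tendsto_const up] always_eventually allI limP_indicator_bounds)
    from tendsto_ennrealI[OF this] show "(\<lambda>i. ?q (A i)) \<longlonglongrightarrow> 0" by simp
  qed (use pos in auto)
qed (fact assms)

lemma prob_space_stationary: "prob_space stationary"
proof
  have "limP (indicator (space M)) = 1"
    by (intro antisym limP_bounds) auto
  then show "emeasure stationary (space stationary) = 1"
    by (simp add: emeasure_stationary)
qed

lemma measure_stationary: "A \<in> sets M \<Longrightarrow> measure stationary A = limP (indicator A)"
  by (simp add: measure_def emeasure_stationary limP_indicator_bounds(1))

text \<open>The sum counts the grid points \<open>i / j\<close> up to \<open>t\<close> and so equals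
  \<open>k / j\<close> with \<open>k\<close> the floor of \<open>j * t\<close>. With
  \<open>t = f y\<close> it approximates \<open>f\<close> from below, up to \<open>1 / j\<close>, by
  a combination of indicators of level sets.\<close>

lemma level_approx:
  fixes t :: real and j :: nat
  assumes "0 \<le> t" "t \<le> 1" "0 < j"
  shows "(\<Sum>i\<in>{1..j}. 1 / j * of_bool (i / j \<le> t)) \<le> t"
    "t \<le> (\<Sum>i\<in>{1..j}. 1 / j * of_bool (i / j \<le> t)) + 1 / j"
proof -
  define k where "k = nat \<lfloor>j * t\<rfloor>"
  have jt: "0 \<le> j * t" "j * t \<le> j" using assms by (auto intro: mult_left_le)
  have k: "real k \<le> j * t" "j * t < real k + 1"
    using jt by (auto simp: k_def)
  have "k \<le> j" using k(1) jt by simp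
  have "real i / j \<le> t \<longleftrightarrow> i \<le> k" for i :: nat
  proof -
    have "real i / j \<le> t \<longleftrightarrow> real i \<le> j * t" using assms(3) by (simp add: field_simps)
    also have "\<dots> \<longleftrightarrow> i \<le> k" using k by linarith
    finally show ?thesis .
  qed
  then have "{1..j} \<inter> {i. real i / j \<le> t} = {1..k}"
    using \<open>k \<le> j\<close> by (intro set_eqI) (simp only: Int_iff mem_Collect_eq atLeastAtMost_iff, linarith)
  moreover have "(\<Sum>i\<in>{1..j}. 1 / j * of_bool (i / j \<le> t))
      = 1 / j * real (card ({1..j} \<inter> {i. real i / j \<le> t}))"
    unfolding sum_distrib_left[symmetric] by (subst sum_of_bool_eq) simp_all
  ultimately have "(\<Sum>i\<in>{1..j}. 1 / j * of_bool (i / j \<le> t)) = k / j"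
    by simp
  moreover have "k / j \<le> t" "t \<le> k / j + 1 / j"
    using k assms by (simp_all add: field_simps)
  ultimately show "(\<Sum>i\<in>{1..j}. 1 / j * of_bool (i / j \<le> t)) \<le> t"
    "t \<le> (\<Sum>i\<in>{1..j}. 1 / j * of_bool (i / j \<le> t)) + 1 / j"
    by (simp_all only:)
qed

text \<open>The condition \<open>c * card I \<le> 1\<close> keeps every partial sum between 0 and 1,
  where \<open>limP\<close> is additive.\<close>

lemma limP_sum_indicator:
  fixes c :: real
  assumes "\<And>i. i \<in> I \<Longrightarrow> A i \<in> sets M" "0 \<le> c" "finite I" "c * card I \<le> 1"
  shows "limP (\<lambda>y. \<Sum>i\<in>I. c * indicator (A i) y) = (\<Sum>i\<in>I. c * measure stationary (A i))"
  using assms(3,1,4)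
proof (induction I)
  case empty
  have "limP (\<lambda>y. 0) = 0" using limP_bounds[of "\<lambda>y. 0" 0 0] by (intro antisym) auto
  then show ?case by simp
next
  case (insert i I)
  have c: "c \<le> 1" "c * card I \<le> 1"
  proof -
    have "c * card (insert i I) = c + c * card I"
      using insert.hyps by (simp add: algebra_simps)
    moreover have "0 \<le> c * card I" using assms(2) by simp
    ultimately show "c \<le> 1" "c * card I \<le> 1" using insert.prems(2) assms(2) by linarith+
  qed
  have b: "(\<Sum>i\<in>I. c * indicator (A i) y) \<le> c * card I" for y
  proof -
    have "(\<Sum>i\<in>I. c * indicator (A i) y) \<le> (\<Sum>i\<in>I. c)"
      using assms(2) by (intro sum_mono) (auto simp: indicator_def)
    then show ?thesis by (simp add: mult.commute)
  qed
  have b': "c * indicator (A i) y + (\<Sum>i\<in>I. c * indicator (A i) y) \<le> 1" for y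
  proof -
    have "c * indicator (A i) y \<le> c" using assms(2) by (auto simp: indicator_def)
    moreover have "c * card (insert i I) = c + c * card I"
      using insert.hyps by (simp add: algebra_simps)
    ultimately show ?thesis using b[of y] insert.prems(2) by linarith
  qed
  have "limP (\<lambda>y. c * indicator (A i) y + (\<Sum>i\<in>I. c * indicator (A i) y))
      = limP (\<lambda>y. c * indicator (A i) y) + limP (\<lambda>y. \<Sum>i\<in>I. c * indicator (A i) y)"
    using insert.prems(1) b' assms(2)
    by (intro limP_add borel_measurable_sum borel_measurable_times borel_measurable_const
          borel_measurable_indicator sum_nonneg) auto
  also have "limP (\<lambda>y. c * indicator (A i) y) = c * limP (indicator (A i))"
    using insert.prems(1) c assms(2) by (intro limP_cmult) (auto simp: indicator_def)
  also have "limP (\<lambda>y. \<Sum>i\<in>I. c * indicator (A i) y) = (\<Sum>i\<in>I. c * measure stationary (A i))"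
    using insert.prems(1) c(2) by (intro insert.IH) auto
  also have "limP (indicator (A i)) = measure stationary (A i)"
    using insert.prems(1) by (simp add: measure_stationary)
  finally show ?case
    unfolding sum.insert[OF insert.hyps] .
qed

text \<open>For the staircase function \<open>g\<close> of level sets both sides agree by the
  construction of \<open>stationary\<close>. Since \<open>f - g\<close> has values between 0 and
  \<open>1 / j\<close>, neither side changes by more than \<open>1 / j\<close> when \<open>g\<close>
  is replaced by \<open>f\<close>; then \<open>j\<close> tends to infinity.\<close>

lemma integral_stationary:
  assumes f: "f \<in> borel_measurable M" "\<And>y. y \<in> space M \<Longrightarrow> 0 \<le> f y \<and> f y \<le> 1"
  shows "(\<integral>x. f x \<partial>stationary) = limP f"
proof -
  interpret q: prob_space stationary by (rule prob_space_stationary)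
  have "\<bar>(\<integral>x. f x \<partial>stationary) - limP f\<bar> \<le> 1 / j" if j: "0 < j" for j :: nat
  proof -
    let ?A = "\<lambda>i::nat. {x \<in> space M. i / j \<le> f x}"
    define g where "g = (\<lambda>y. \<Sum>i\<in>{1..j}. 1 / j * indicator (?A i) y :: real)"
    have A[measurable]: "?A i \<in> sets M" for i using f(1) by measurable
    have g[measurable]: "g \<in> borel_measurable M" unfolding g_def by measurable
    have g_eq: "g y = (\<Sum>i\<in>{1..j}. 1 / j * of_bool (i / j \<le> f y))" if "y \<in> space M" for y
      using that by (auto simp: g_def indicator_def of_bool_def intro!: sum.cong)
    have gf: "g y \<le> f y" "f y \<le> g y + 1 / j" if "y \<in> space M" for y
      using level_approx[of "f y" j] f(2)[OF that] j by (auto simp: g_eq[OF that])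
    have g0: "0 \<le> g y" for y
      by (auto simp: g_def intro!: sum_nonneg)
    have g1: "g y \<le> 1" if "y \<in> space M" for y using gf(1)[OF that] f(2)[OF that] by simp
    have int: "integrable stationary f" "integrable stationary g"
      using f g g1 g0
      by (auto intro!: q.integrable_const_bound[where B=1] AE_I2 simp: measurable_cong_sets[OF sets_stationary refl])
    have lg: "limP g = (\<integral>x. g x \<partial>stationary)"
    proof -
      have "(\<integral>x. g x \<partial>stationary) = (\<Sum>i\<in>{1..j}. 1 / j * measure stationary (?A i))"
        unfolding g_def
        by (subst Bochner_Integration.integral_sum) (auto simp: q.emeasure_eq_measure)
      also have "\<dots> = limP g"
        unfolding g_def using A j by (intro limP_sum_indicator[symmetric]) auto
      finally show ?thesis by simp
    qed
    have "limP (\<lambda>y. g y + (f y - g y)) = limP g + limP (\<lambda>y. f y - g y)"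
      using f gf g0 by (intro limP_add borel_measurable_diff g f(1)) auto
    moreover have "0 \<le> limP (\<lambda>y. f y - g y)" "limP (\<lambda>y. f y - g y) \<le> 1 / j"
    proof -
      have b: "0 \<le> f y - g y \<and> f y - g y \<le> 1 / j" if "y \<in> space M" for y
        using gf[OF that] by auto
      moreover have "1 / real j \<le> 1" using j by auto
      ultimately have b1: "0 \<le> f y - g y \<and> f y - g y \<le> 1" if "y \<in> space M" for y
        using that by fastforce
      show "0 \<le> limP (\<lambda>y. f y - g y)" "limP (\<lambda>y. f y - g y) \<le> 1 / j"
        by (rule limP_bounds[OF borel_measurable_diff[OF f(1) g] b1 b]; assumption)+
    qed
    moreover have "(\<integral>x. g x \<partial>stationary) \<le> (\<integral>x. f x \<partial>stationary)"
      using int gf by (intro integral_mono) auto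
    moreover have "(\<integral>x. f x \<partial>stationary) \<le> (\<integral>x. g x + 1 / j \<partial>stationary)"
      using int gf by (intro integral_mono) auto
    moreover have "(\<integral>x. g x + 1 / j \<partial>stationary) = (\<integral>x. g x \<partial>stationary) + 1 / j"
      using int(2) q.prob_space by simp
    ultimately show ?thesis using lg by simp
  qed
  note bound = this
  have "\<bar>(\<integral>x. f x \<partial>stationary) - limP f\<bar> \<le> 0"
  proof (rule LIMSEQ_le_const)
    show "(\<lambda>j. 1 / real (Suc j)) \<longlonglongrightarrow> 0" by (rule LIMSEQ_Suc[OF lim_1_over_n])
    show "\<exists>N. \<forall>n\<ge>N. \<bar>(\<integral>x. f x \<partial>stationary) - limP f\<bar> \<le> 1 / real (Suc n)"
      using bound by (metis zero_less_Suc)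
  qed
  then show ?thesis by simp
qed

text \<open>One more kernel step turns the mass of \<open>A\<close> into the integral of
  \<open>P (indicator A)\<close>, which is \<open>limP (P (indicator A))\<close>, and the limit of
  the iterates does not see the shift by one step.\<close>

lemma invariant_stationary: "invariant stationary"
proof -
  interpret q: prob_space stationary by (rule prob_space_stationary)
  have q: "stationary \<in> space (prob_algebra M)"
    using prob_space_stationary by (simp add: space_prob_algebra)
  have k: "\<kappa> \<in> stationary \<rightarrow>\<^sub>M subprob_algebra M"
    using measurable_prob_algebraD[OF kernel] measurable_cong_sets[OF sets_stationary refl] by auto
  have s: "sets (stationary \<bind> \<kappa>) = sets M"
    by (rule sets_bind'[OF q kernel])
  interpret b: prob_space "stationary \<bind> \<kappa>" by (rule prob_space_bind'[OF q kernel])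
  have "stationary \<bind> \<kappa> = stationary"
  proof (rule measure_eqI)
    fix A assume "A \<in> sets (stationary \<bind> \<kappa>)"
    then have A: "A \<in> sets M" by (simp add: s)
    have f: "indicator A \<in> borel_measurable M" "0 \<le> (indicator A y :: real) \<and> indicator A y \<le> (1::real)" for y
      using A by (auto simp: indicator_def)
    have "measure (stationary \<bind> \<kappa>) A = (\<integral>x. measure (\<kappa> x) A \<partial>stationary)"
      using k A by (rule q.measure_bind)
    also have "\<dots> = (\<integral>x. P (indicator A) x \<partial>stationary)"
      by (intro Bochner_Integration.integral_cong) (auto simp: P_indicator A)
    also have "\<dots> = limP (P (indicator A))"
      using P_bounds[OF f] by (intro integral_stationary measurable_P f) auto
    also have "\<dots> = measure stationary A"
      using A by (simp add: limP_P[OF f] measure_stationary)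
    finally show "emeasure (stationary \<bind> \<kappa>) A = emeasure stationary A"
      by (simp add: b.emeasure_eq_measure q.emeasure_eq_measure)
  qed (simp add: s)
  then show ?thesis using q by (simp add: invariant_def)
qed

end

section \<open>The law of a Markov chain\<close>

lemma kernel_Ionescu_Tulcea:
  fixes \<kappa> :: "'e::topological_space \<Rightarrow> 'e measure"
  assumes \<kappa>: "\<kappa> \<in> borel \<rightarrow>\<^sub>M prob_algebra borel" and \<mu>: "\<mu> \<in> space (prob_algebra borel)"
  shows "Ionescu_Tulcea (\<lambda>n x. if n = 0 then \<mu> else \<kappa> (x (n - 1))) (\<lambda>_. borel)"
proof (rule Ionescu_Tulcea.intro)
  have \<kappa>': "\<kappa> x \<in> space (prob_algebra borel)" for x
    using \<kappa> by (rule measurable_space) simp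
  show "(\<lambda>x. if i = 0 then \<mu> else \<kappa> (x (i - 1))) \<in> Pi\<^sub>M {0..<i} (\<lambda>_. borel) \<rightarrow>\<^sub>M subprob_algebra borel" for i :: nat
  proof (cases "i = 0")
    case True
    have "\<mu> \<in> space (subprob_algebra borel)"
      using \<mu> by (auto simp: space_prob_algebra space_subprob_algebra prob_space_imp_subprob_space)
    then show ?thesis using True by simp
  next
    case False
    then have "(\<lambda>x. x (i - 1)) \<in> Pi\<^sub>M {0..<i} (\<lambda>_. borel) \<rightarrow>\<^sub>M borel"
      by (intro measurable_component_singleton) auto
    from measurable_compose[OF this measurable_prob_algebraD[OF \<kappa>]] show ?thesis
      using False by simp
  qed
  show "prob_space (if i = 0 then \<mu> else \<kappa> (x (i - 1)))"
    for i :: nat and x :: "nat \<Rightarrow> 'e"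
    using \<mu> \<kappa>' by (auto simp: space_prob_algebra)
qed

context
  fixes \<kappa> :: "'e::topological_space \<Rightarrow> 'e measure" and \<mu> :: "'e measure"
  assumes \<kappa>: "\<kappa> \<in> borel \<rightarrow>\<^sub>M prob_algebra borel" and \<mu>: "\<mu> \<in> space (prob_algebra borel)"
begin

interpretation Ionescu_Tulcea "\<lambda>n x. if n = 0 then \<mu> else \<kappa> (x (n - 1))" "\<lambda>_. borel"
  by (rule kernel_Ionescu_Tulcea[OF \<kappa> \<mu>])

lemma chain_law_lim: "chain_law \<mu> \<kappa> = PF.lim"
  by (simp add: chain_law_def)

lemma sets_chain_law: "sets (chain_law \<mu> \<kappa>) = sets (\<Pi>\<^sub>M n\<in>UNIV. borel)"
  unfolding chain_law_lim by (rule PF.sets_lim)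

lemma distr_chain_law:
  "distr (chain_law \<mu> \<kappa>) (\<Pi>\<^sub>M i\<in>{0..<n}. borel) (\<lambda>x. restrict x {0..<n}) = C 0 n (\<lambda>_. undefined)"
proof -
  \<comment> \<open>The projective family obtains its marginal on an index set \<open>J\<close> from
    the first \<open>up_to J\<close> steps, so this least bound has to be computed.\<close>
  have "up_to {0..<n} = n"
  proof (rule antisym)
    show "up_to {0..<n} \<le> n" by (subst up_to_iff) auto
    show "n \<le> up_to {0..<n}" using up_to_less[of "{0..<n}" "n - 1"] by (cases n) auto
  qed
  moreover have "distr (C 0 n (\<lambda>x. undefined)) (\<Pi>\<^sub>M i\<in>{0..<n}. borel) (\<lambda>f. restrict f {0..<n}) = C 0 n (\<lambda>x. undefined)"
    using distr_C[of n n "\<lambda>_. undefined" 0] by simp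
  ultimately show ?thesis
    unfolding chain_law_lim by (subst distr_lim) (auto simp: CI_def)
qed

text \<open>Total mass is preserved by image measures, and already the marginal on the empty index
  set is a probability measure.\<close>

lemma prob_space_chain_law: "prob_space (chain_law \<mu> \<kappa>)"
proof (rule prob_space_distrD)
  show "(\<lambda>x. restrict x {0..<0}) \<in> chain_law \<mu> \<kappa> \<rightarrow>\<^sub>M (\<Pi>\<^sub>M i\<in>{0..<0}. borel)"
    unfolding measurable_cong_sets[OF sets_chain_law refl] by (intro measurable_restrict_subset) simp
  show "prob_space (distr (chain_law \<mu> \<kappa>) (\<Pi>\<^sub>M i\<in>{0..<0::nat}. borel) (\<lambda>x. restrict x {0..<0}))"
    unfolding distr_chain_law by (rule prob_space_C) simp
qed

lemma chain_law_component:
  "(\<lambda>x. x k) \<in> chain_law \<mu> \<kappa> \<rightarrow>\<^sub>M borel"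
  unfolding measurable_cong_sets[OF sets_chain_law refl] by (intro measurable_component_singleton) simp

text \<open>The Markov property, tested on a function of one past state. The law of the coordinates
  up to \<open>n + 1\<close> is the law of those up to \<open>n\<close> bound to the kernel
  \<open>eP (Suc n)\<close>, which appends a state drawn from \<open>\<kappa> (\<omega> n)\<close>;
  as \<open>j \<le> n\<close>, the factor \<open>g (x j)\<close> is not affected by the appended
  state.\<close>

lemma integral_chain_law_step:
  fixes f g :: "'e \<Rightarrow> real"
  assumes f: "f \<in> borel_measurable borel" "\<And>x. \<bar>f x\<bar> \<le> Bf"
    and g: "g \<in> borel_measurable borel" "\<And>x. \<bar>g x\<bar> \<le> Bg" and j: "j \<le> n"
  shows "(\<integral>x. g (x j) * f (x (Suc n)) \<partial>chain_law \<mu> \<kappa>)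
    = (\<integral>x. g (x j) * (\<integral>y. f y \<partial>\<kappa> (x n)) \<partial>chain_law \<mu> \<kappa>)"
proof -
  note [measurable] = f(1) g(1)
  have res: "(\<lambda>x. restrict x {0..<N}) \<in> chain_law \<mu> \<kappa> \<rightarrow>\<^sub>M (\<Pi>\<^sub>M i\<in>{0..<N}. borel)" for N :: nat
    unfolding measurable_cong_sets[OF sets_chain_law refl] by (intro measurable_restrict_subset) simp
  have tr: "(\<integral>x. F (restrict x {0..<N}) \<partial>chain_law \<mu> \<kappa>) = (\<integral>x. F x \<partial>C 0 N (\<lambda>_. undefined))"
    if "F \<in> borel_measurable (\<Pi>\<^sub>M i\<in>{0..<N}. borel)" for F :: "(nat \<Rightarrow> 'e) \<Rightarrow> real" and N
    unfolding distr_chain_law[symmetric] by (rule integral_distr[OF res that, symmetric])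
  have B: "0 \<le> Bf" "0 \<le> Bg" using f(2)[of undefined] g(2)[of undefined] by auto
  let ?F = "\<lambda>x. g (x j) * f (x (Suc n))"
  let ?G = "\<lambda>x. g (x j) * (\<integral>y. f y \<partial>\<kappa> (x n))"
  have comp: "(\<lambda>x. x i) \<in> Pi\<^sub>M {0..<N} (\<lambda>_. borel :: 'e measure) \<rightarrow>\<^sub>M borel" if "i < N" for i N :: nat
    using that by (intro measurable_component_singleton) simp
  have Fm: "?F \<in> borel_measurable (\<Pi>\<^sub>M i\<in>{0..<Suc (Suc n)}. borel)"
    using j by (intro borel_measurable_times measurable_compose[OF comp f(1)]
        measurable_compose[OF comp g(1)]) auto
  have If: "(\<lambda>x. \<integral>y. f y \<partial>\<kappa> x) \<in> borel_measurable borel"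
    by (rule measurable_compose[OF measurable_prob_algebraD[OF \<kappa>] integral_measurable_subprob_algebra]) fact
  have Gm: "?G \<in> borel_measurable (\<Pi>\<^sub>M i\<in>{0..<Suc n}. borel)"
    using j by (intro borel_measurable_times measurable_compose[OF comp If]
        measurable_compose[OF comp g(1)]) auto
  have u: "(\<lambda>_. undefined) \<in> space (Pi\<^sub>M {0..<0::nat} (\<lambda>_. borel :: 'e measure))" by simp
  have "(\<integral>x. ?F x \<partial>chain_law \<mu> \<kappa>) = (\<integral>x. ?F (restrict x {0..<Suc (Suc n)}) \<partial>chain_law \<mu> \<kappa>)"
    using j by (intro Bochner_Integration.integral_cong) auto
  also have "\<dots> = (\<integral>x. ?F x \<partial>C 0 (Suc (Suc n)) (\<lambda>_. undefined))"
    by (rule tr[OF Fm])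
  also have "\<dots> = (\<integral>\<omega>. (\<integral>x. ?F x \<partial>eP (Suc n) \<omega>) \<partial>C 0 (Suc n) (\<lambda>_. undefined))"
    unfolding C.simps(2)[of 0 "Suc n"] add_0
  proof (rule integral_bind[OF Fm])
    show "\<bar>?F x\<bar> \<le> Bg * Bf" for x
      unfolding abs_mult using f(2) g(2) B by (intro mult_mono) auto
    show "eP (Suc n) \<in> C 0 (Suc n) (\<lambda>_. undefined) \<rightarrow>\<^sub>M subprob_algebra (\<Pi>\<^sub>M i\<in>{0..<Suc (Suc n)}. borel)"
      unfolding measurable_cong_sets[OF sets_C[OF u] refl] add_0 by (rule measurable_eP)
    show "finite_measure (C 0 (Suc n) (\<lambda>_. undefined))"
      using prob_space_C[OF u] by (rule prob_space.finite_measure)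
    show "AE x in C 0 (Suc n) (\<lambda>_. undefined). emeasure (eP (Suc n) x) (space (eP (Suc n) x)) \<le> ennreal 1"
    proof (rule AE_I2)
      fix x assume "x \<in> space (C 0 (Suc n) (\<lambda>_. undefined))"
      then have "x \<in> space (Pi\<^sub>M {0..<Suc n} (\<lambda>_. borel))" using space_C[OF u, of "Suc n"] by (simp del: C.simps)
      from prob_space.emeasure_space_1[OF prob_space_eP[OF this]]
      show "emeasure (eP (Suc n) x) (space (eP (Suc n) x)) \<le> ennreal 1" by simp
    qed
  qed
  also have "\<dots> = (\<integral>\<omega>. ?G \<omega> \<partial>C 0 (Suc n) (\<lambda>_. undefined))"
  proof (rule Bochner_Integration.integral_cong[OF refl])
    fix \<omega> assume "\<omega> \<in> space (C 0 (Suc n) (\<lambda>_. undefined))"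
    then have \<omega>: "\<omega> \<in> space (Pi\<^sub>M {0..<Suc n} (\<lambda>_. borel))" using space_C[OF u, of "Suc n"] by (simp del: C.simps)
    have "sets (\<kappa> (\<omega> n)) = sets borel"
      using measurable_space[OF \<kappa>, of "\<omega> n"] by (simp add: space_prob_algebra)
    note s = measurable_cong_sets[OF this refl]
    have "fun_upd \<omega> (Suc n) \<in> borel \<rightarrow>\<^sub>M Pi\<^sub>M {0..<Suc (Suc n)} (\<lambda>_. borel)"
      using \<omega> by (intro measurable_fun_upd[where J="{0..<Suc n}"]) auto
    then have "(\<integral>x. ?F x \<partial>eP (Suc n) \<omega>) = (\<integral>y. ?F (fun_upd \<omega> (Suc n) y) \<partial>\<kappa> (\<omega> n))"
      unfolding eP_def using Fm by (subst integral_distr) (auto simp: s)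
    also have "\<dots> = ?G \<omega>" using j by simp
    finally show "(\<integral>x. ?F x \<partial>eP (Suc n) \<omega>) = ?G \<omega>" .
  qed
  also have "\<dots> = (\<integral>x. ?G (restrict x {0..<Suc n}) \<partial>chain_law \<mu> \<kappa>)"
    by (rule tr[OF Gm, symmetric])
  also have "\<dots> = (\<integral>x. ?G x \<partial>chain_law \<mu> \<kappa>)"
    using j by (intro Bochner_Integration.integral_cong) auto
  finally show ?thesis .
qed

end

section \<open>Gaussian noise\<close>

lemma gauss_pos: "0 < \<sigma> \<Longrightarrow> 0 < gauss \<sigma> v"
  unfolding gauss_def by (intro prod_pos normal_density_pos)

lemma gauss_le:
  fixes v :: "real ^ 'p"
  assumes "0 < \<sigma>"
  shows "gauss \<sigma> v \<le> (1 / sqrt (2 * pi * \<sigma>\<^sup>2)) ^ CARD('p)"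
proof -
  have "gauss \<sigma> v \<le> (\<Prod>i\<in>(UNIV::'p set). 1 / sqrt (2 * pi * \<sigma>\<^sup>2))"
    unfolding gauss_def by (intro prod_mono) (auto simp: normal_density_def divide_right_mono)
  then show ?thesis by simp
qed

lemma continuous_on_gauss: "0 < \<sigma> \<Longrightarrow> continuous_on UNIV (gauss \<sigma>)"
  unfolding gauss_def[abs_def] normal_density_def by (intro continuous_intros) auto

lemma measurable_gauss[measurable]: "gauss \<sigma> \<in> borel_measurable borel"
  unfolding gauss_def[abs_def] normal_density_def by measurable

lemma sets_gauss_law[measurable_cong, simp]: "sets (gauss_law \<sigma>) = sets borel"
  by (simp add: gauss_law_def)

lemma space_gauss_law[simp]: "space (gauss_law \<sigma>) = UNIV"
  by (simp add: gauss_law_def)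

text \<open>Lebesgue integrals of products factor over \<open>Basis\<close>; the coordinate
  \<open>i\<close> corresponds to the basis vector \<open>axis i 1\<close>, so the integral is a
  product of integrals of one-dimensional normal densities.\<close>

lemma prob_space_gauss_law:
  assumes "0 < \<sigma>"
  shows "prob_space (gauss_law \<sigma> :: (real ^ 'p) measure)"
proof
  have N: "(\<integral>\<^sup>+x. ennreal (normal_density 0 \<sigma> x) \<partial>lborel) = 1"
    using prob_space.emeasure_space_1[OF prob_space_normal_density[OF assms, of 0]]
    by (simp add: emeasure_density)
  have "emeasure (gauss_law \<sigma>) (space (gauss_law \<sigma> :: (real ^ 'p) measure))
      = (\<integral>\<^sup>+v. ennreal (gauss \<sigma> v) \<partial>(lborel :: (real ^ 'p) measure))"
    by (simp add: gauss_law_def emeasure_density)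
  also have "\<dots> = (\<integral>\<^sup>+v. (\<Prod>b\<in>Basis. ennreal (normal_density 0 \<sigma> (v \<bullet> b))) \<partial>(lborel :: (real ^ 'p) measure))"
  proof (intro nn_integral_cong)
    fix v :: "real ^ 'p"
    have inj: "inj (\<lambda>i::'p. axis i (1::real))" by (auto simp: inj_on_def axis_eq_axis)
    have "(Basis :: (real ^ 'p) set) = (\<lambda>i. axis i 1) ` UNIV" by (auto simp: Basis_vec_def)
    then have "(\<Prod>b\<in>Basis. ennreal (normal_density 0 \<sigma> (v \<bullet> b))) = (\<Prod>i\<in>UNIV. ennreal (normal_density 0 \<sigma> (v $ i)))"
      using prod.reindex[OF inj, of "\<lambda>b. ennreal (normal_density 0 \<sigma> (v \<bullet> b))"]
      by (simp add: inner_axis)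
    then show "ennreal (gauss \<sigma> v) = (\<Prod>b\<in>Basis. ennreal (normal_density 0 \<sigma> (v \<bullet> b)))"
      by (simp add: gauss_def prod_ennreal)
  qed
  also have "\<dots> = 1"
    by (subst nn_integral_lborel_prod) (auto simp: N)
  finally show "emeasure (gauss_law \<sigma>) (space (gauss_law \<sigma> :: (real ^ 'p) measure)) = 1" .
qed

lemma distr_gauss_law_translate:
  fixes c :: "real ^ 'p"
  shows "distr (gauss_law \<sigma>) borel (\<lambda>v. c + v) = density lborel (\<lambda>y. ennreal (gauss \<sigma> (y - c)))"
proof (rule measure_eqI)
  fix A :: "(real ^ 'p) set" assume "A \<in> sets (distr (gauss_law \<sigma>) borel ((+) c))"
  then have A[measurable]: "A \<in> sets borel" by simp
  have "emeasure (density lborel (\<lambda>y. ennreal (gauss \<sigma> (y - c)))) A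
      = (\<integral>\<^sup>+y. ennreal (gauss \<sigma> (y - c)) * indicator A y \<partial>lborel)"
    by (subst emeasure_density) auto
  also have "\<dots> = (\<integral>\<^sup>+y. ennreal (gauss \<sigma> (y - c)) * indicator A y \<partial>distr lborel borel ((+) c))"
    by (simp only: lborel_distr_plus)
  also have "\<dots> = (\<integral>\<^sup>+v. ennreal (gauss \<sigma> v) * indicator A (c + v) \<partial>lborel)"
    by (subst nn_integral_distr) auto
  also have "\<dots> = (\<integral>\<^sup>+v. ennreal (gauss \<sigma> v) * indicator ((\<lambda>v. c + v) -` A) v \<partial>lborel)"
    by (intro nn_integral_cong) (auto simp: indicator_def)
  also have "\<dots> = emeasure (distr (gauss_law \<sigma>) borel (\<lambda>v. c + v)) A"
    using measurable_sets[of "\<lambda>v. c + v" borel borel A]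
    by (subst emeasure_distr) (auto simp: gauss_law_def emeasure_density)
  finally show "emeasure (distr (gauss_law \<sigma>) borel (\<lambda>v. c + v)) A
    = emeasure (density lborel (\<lambda>y. ennreal (gauss \<sigma> (y - c)))) A" by simp
qed simp

text \<open>Both measures equal the product of the translated Gaussian laws, because they agree with
  it on boxes. With \<open>c k = h (x k)\<close> this is the conditional law of the observations
  given the state path.\<close>

lemma distr_gauss_noise:
  fixes c :: "nat \<Rightarrow> real ^ 'p"
  assumes \<sigma>: "0 < \<sigma>" and I: "finite I"
  shows "distr (\<Pi>\<^sub>M k\<in>UNIV. gauss_law \<sigma>) (\<Pi>\<^sub>M k\<in>I. borel) (\<lambda>v. \<lambda>k\<in>I. c k + v k)
    = density (\<Pi>\<^sub>M k\<in>I. lborel) (\<lambda>y. \<Prod>k\<in>I. ennreal (gauss \<sigma> (y k - c k)))"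
proof -
  interpret G: prob_space "gauss_law \<sigma> :: (real ^ 'p) measure" by (rule prob_space_gauss_law[OF \<sigma>])
  interpret G: product_prob_space "\<lambda>_::nat. gauss_law \<sigma> :: (real ^ 'p) measure" UNIV by unfold_locales
  interpret L: product_sigma_finite "\<lambda>_::nat. lborel :: (real ^ 'p) measure" by unfold_locales
  let ?N = "\<lambda>k. density lborel (\<lambda>y. ennreal (gauss \<sigma> (y - c k)))"
  have "prob_space (?N k)" for k
    unfolding distr_gauss_law_translate[symmetric]
    by (intro prob_space.prob_space_distr[OF prob_space_gauss_law[OF \<sigma>]]) simp
  then interpret N: product_prob_space ?N I
    by (rule product_prob_spaceI)
  have "distr (\<Pi>\<^sub>M k\<in>UNIV. gauss_law \<sigma>) (\<Pi>\<^sub>M k\<in>I. borel) (\<lambda>v. \<lambda>k\<in>I. c k + v k) = PiM I ?N"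
  proof (rule N.PiM_eqI[OF I])
    fix A assume A: "\<And>i. i \<in> I \<Longrightarrow> A i \<in> sets (?N i)"
    have m: "(\<lambda>v. \<lambda>k\<in>I. c k + v k) \<in> (\<Pi>\<^sub>M k\<in>UNIV. gauss_law \<sigma>) \<rightarrow>\<^sub>M (\<Pi>\<^sub>M k\<in>I. borel)"
      by (intro measurable_restrict borel_measurable_add borel_measurable_const)
        (simp add: measurable_component_singleton[of _ UNIV "\<lambda>_. gauss_law \<sigma>", unfolded measurable_cong_sets[OF refl sets_gauss_law]])
    have B: "(+) (c i) -` A i \<in> sets borel" if "i \<in> I" for i
      using measurable_sets[of "\<lambda>v. c i + v" borel borel "A i"] A[OF that] by simp
    have "emeasure (distr (\<Pi>\<^sub>M k\<in>UNIV. gauss_law \<sigma>) (\<Pi>\<^sub>M k\<in>I. borel) (\<lambda>v. \<lambda>k\<in>I. c k + v k)) (Pi\<^sub>E I A)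
      = emeasure (\<Pi>\<^sub>M k\<in>UNIV. gauss_law \<sigma>) {v \<in> space (\<Pi>\<^sub>M k\<in>UNIV. gauss_law \<sigma>). \<forall>k\<in>I. v k \<in> (+) (c k) -` A k}"
      using m A I
      by (subst emeasure_distr) (auto intro!: arg_cong2[where f=emeasure] sets_PiM_I_finite simp: PiE_iff)
    also have "\<dots> = (\<Prod>k\<in>I. emeasure (gauss_law \<sigma>) ((+) (c k) -` A k))"
      using B by (intro G.emeasure_PiM_Collect I) auto
    also have "\<dots> = (\<Prod>k\<in>I. emeasure (?N k) (A k))"
    proof (intro prod.cong refl)
      fix k assume "k \<in> I"
      show "emeasure (gauss_law \<sigma>) ((+) (c k) -` A k) = emeasure (?N k) (A k)"
        unfolding distr_gauss_law_translate[symmetric]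
        using A[OF \<open>k \<in> I\<close>] by (subst emeasure_distr) auto
    qed
    finally show "emeasure (distr (\<Pi>\<^sub>M k\<in>UNIV. gauss_law \<sigma>) (\<Pi>\<^sub>M k\<in>I. borel) (\<lambda>v. \<lambda>k\<in>I. c k + v k)) (Pi\<^sub>E I A)
      = (\<Prod>k\<in>I. emeasure (?N k) (A k))" .
  qed (auto intro!: sets_PiM_cong)
  also have "\<dots> = density (\<Pi>\<^sub>M k\<in>I. lborel) (\<lambda>y. \<Prod>k\<in>I. ennreal (gauss \<sigma> (y k - c k)))"
  proof (rule N.PiM_eqI[OF I, symmetric])
    fix A assume A: "\<And>i. i \<in> I \<Longrightarrow> A i \<in> sets (?N i)"
    have A': "A i \<in> sets borel" if "i \<in> I" for i using A[OF that] by simp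
    have m: "(\<lambda>y. \<Prod>k\<in>I. ennreal (gauss \<sigma> (y k - c k))) \<in> borel_measurable (\<Pi>\<^sub>M k\<in>I. lborel)"
      by measurable
    have s: "Pi\<^sub>E I A \<in> sets (\<Pi>\<^sub>M k\<in>I. lborel)"
      using A' I by (intro sets_PiM_I_finite) auto
    have "emeasure (density (\<Pi>\<^sub>M k\<in>I. lborel) (\<lambda>y. \<Prod>k\<in>I. ennreal (gauss \<sigma> (y k - c k)))) (Pi\<^sub>E I A)
      = (\<integral>\<^sup>+y. (\<Prod>k\<in>I. ennreal (gauss \<sigma> (y k - c k))) * indicator (Pi\<^sub>E I A) y \<partial>(\<Pi>\<^sub>M k\<in>I. lborel))"
      by (rule emeasure_density[OF m s])
    also have "\<dots> = (\<integral>\<^sup>+y. (\<Prod>k\<in>I. ennreal (gauss \<sigma> (y k - c k)) * indicator (A k) (y k)) \<partial>(\<Pi>\<^sub>M k\<in>I. lborel))"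
    proof (intro nn_integral_cong)
      fix y :: "nat \<Rightarrow> real ^ 'p" assume "y \<in> space (\<Pi>\<^sub>M k\<in>I. lborel)"
      then have "indicator (Pi\<^sub>E I A) y = (\<Prod>k\<in>I. indicator (A k) (y k) :: ennreal)"
        using I by (auto simp: space_PiM PiE_iff indicator_def prod_zero_iff)
      then show "(\<Prod>k\<in>I. ennreal (gauss \<sigma> (y k - c k))) * indicator (Pi\<^sub>E I A) y
        = (\<Prod>k\<in>I. ennreal (gauss \<sigma> (y k - c k)) * indicator (A k) (y k))"
        by (simp add: prod.distrib)
    qed
    also have "\<dots> = (\<Prod>k\<in>I. \<integral>\<^sup>+y. ennreal (gauss \<sigma> (y - c k)) * indicator (A k) y \<partial>lborel)"
      using A' by (intro L.product_nn_integral_prod I) auto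
    also have "\<dots> = (\<Prod>k\<in>I. emeasure (?N k) (A k))"
      using A' by (intro prod.cong refl emeasure_density[symmetric]) auto
    finally show "emeasure (density (\<Pi>\<^sub>M k\<in>I. lborel) (\<lambda>y. \<Prod>k\<in>I. ennreal (gauss \<sigma> (y k - c k)))) (Pi\<^sub>E I A)
      = (\<Prod>k\<in>I. emeasure (?N k) (A k))" .
  qed (auto intro!: sets_PiM_cong)
  finally show ?thesis .
qed

section \<open>Likelihoods of hidden Markov models\<close>

locale hidden_markov =
  fixes h :: "'e::topological_space \<Rightarrow> real ^ 'p" and \<sigma> :: real
    and \<mu> :: "'e measure" and \<kappa> :: "'e \<Rightarrow> 'e measure"
  assumes h[measurable]: "h \<in> borel_measurable borel"
    and \<sigma>: "0 < \<sigma>"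
    and \<mu>: "\<mu> \<in> space (prob_algebra borel)"
    and \<kappa>: "\<kappa> \<in> borel \<rightarrow>\<^sub>M prob_algebra borel"
begin

abbreviation noise :: "(nat \<Rightarrow> real ^ 'p) measure" where
  "noise \<equiv> \<Pi>\<^sub>M k\<in>UNIV. gauss_law \<sigma>"

abbreviation lik :: "nat \<Rightarrow> (nat \<Rightarrow> real ^ 'p) \<Rightarrow> real" where
  "lik \<equiv> likelihood h \<sigma> \<mu> \<kappa>"

abbreviation leb :: "nat \<Rightarrow> (nat \<Rightarrow> real ^ 'p) measure" where
  "leb n \<equiv> \<Pi>\<^sub>M k\<in>{1..n}. lborel"

sublocale C: prob_space "chain_law \<mu> \<kappa>"
  by (rule prob_space_chain_law[OF \<kappa> \<mu>])

sublocale N: prob_space noise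
  by (rule prob_space_PiM) (rule prob_space_gauss_law[OF \<sigma>])

sublocale H: prob_space "hmm_law \<sigma> \<mu> \<kappa> :: ((nat \<Rightarrow> 'e) \<times> (nat \<Rightarrow> real ^ 'p)) measure"
  unfolding hmm_law_def by (rule prob_space_pair) unfold_locales

lemma sigma_finite_leb: "sigma_finite_measure (leb n)"
proof -
  interpret product_sigma_finite "\<lambda>_::nat. lborel :: (real ^ 'p) measure" by unfold_locales
  show ?thesis by (rule sigma_finite) simp
qed

lemma sets_leb: "sets (leb n) = sets (\<Pi>\<^sub>M k\<in>{1..n}. borel)"
  by (intro sets_PiM_cong) auto

lemma sets_noise: "sets noise = sets (\<Pi>\<^sub>M k\<in>UNIV. borel)"
  by (intro sets_PiM_cong) auto

lemma measurable_state[measurable]: "(\<lambda>x. x k) \<in> chain_law \<mu> \<kappa> \<rightarrow>\<^sub>M borel"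
  by (rule chain_law_component[OF \<kappa> \<mu>])

lemma measurable_noise[measurable]: "(\<lambda>v. v k) \<in> noise \<rightarrow>\<^sub>M borel"
  unfolding measurable_cong_sets[OF sets_noise refl] by (rule measurable_component_singleton) simp

lemma measurable_obs[measurable]: "obs h n \<in> hmm_law \<sigma> \<mu> \<kappa> \<rightarrow>\<^sub>M (\<Pi>\<^sub>M k\<in>{1..n}. borel)"
  unfolding obs_def[abs_def] hmm_law_def by measurable

lemma lik_integrand_bounds:
  "0 < (\<Prod>k=1..n. gauss \<sigma> (y k - h (x k)))"
  "(\<Prod>k=1..n. gauss \<sigma> (y k - h (x k))) \<le> ((1 / sqrt (2 * pi * \<sigma>\<^sup>2)) ^ CARD('p)) ^ n"
proof -
  show "0 < (\<Prod>k=1..n. gauss \<sigma> (y k - h (x k)))"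
    by (intro prod_pos gauss_pos \<sigma>)
  have "(\<Prod>k=1..n. gauss \<sigma> (y k - h (x k))) \<le> (\<Prod>k=1..n. (1 / sqrt (2 * pi * \<sigma>\<^sup>2)) ^ CARD('p))"
    by (intro prod_mono conjI gauss_le \<sigma> less_imp_le[OF gauss_pos])
  then show "(\<Prod>k=1..n. gauss \<sigma> (y k - h (x k))) \<le> ((1 / sqrt (2 * pi * \<sigma>\<^sup>2)) ^ CARD('p)) ^ n"
    by simp
qed

lemma lik_integrand_integrable:
  "integrable (chain_law \<mu> \<kappa>) (\<lambda>x. \<Prod>k=1..n. gauss \<sigma> (y k - h (x k)))"
proof (rule C.integrable_const_bound)
  show "AE x in chain_law \<mu> \<kappa>. norm (\<Prod>k=1..n. gauss \<sigma> (y k - h (x k))) \<le> ((1 / sqrt (2 * pi * \<sigma>\<^sup>2)) ^ CARD('p)) ^ n"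
    using lik_integrand_bounds[of y _ n] by (intro AE_I2) (simp add: abs_of_pos)
  show "(\<lambda>x. \<Prod>k=1..n. gauss \<sigma> (y k - h (x k))) \<in> borel_measurable (chain_law \<mu> \<kappa>)"
    by measurable
qed

lemma lik_pos: "0 < lik n y"
proof -
  have "(\<integral>x. 0 \<partial>chain_law \<mu> \<kappa>) < lik n y"
    unfolding likelihood_def
    using lik_integrand_integrable lik_integrand_bounds(1)
    by (intro C.integral_less_AE_space AE_I2) (auto simp: C.emeasure_space_1)
  then show ?thesis by simp
qed

lemma lik_le: "lik n y \<le> ((1 / sqrt (2 * pi * \<sigma>\<^sup>2)) ^ CARD('p)) ^ n"
  unfolding likelihood_def
  using lik_integrand_bounds(2) by (intro C.integral_le_const lik_integrand_integrable AE_I2)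

lemma nn_integral_lik:
  "(\<integral>\<^sup>+x. (\<Prod>k=1..n. ennreal (gauss \<sigma> (y k - h (x k)))) \<partial>chain_law \<mu> \<kappa>) = ennreal (lik n y)"
proof -
  have "(\<integral>\<^sup>+x. (\<Prod>k=1..n. ennreal (gauss \<sigma> (y k - h (x k)))) \<partial>chain_law \<mu> \<kappa>)
      = (\<integral>\<^sup>+x. ennreal (\<Prod>k=1..n. gauss \<sigma> (y k - h (x k))) \<partial>chain_law \<mu> \<kappa>)"
    by (intro nn_integral_cong prod_ennreal less_imp_le[OF gauss_pos] \<sigma>)
  also have "\<dots> = ennreal (lik n y)"
    unfolding likelihood_def using less_imp_le[OF lik_integrand_bounds(1)]
    by (intro nn_integral_eq_integral lik_integrand_integrable AE_I2)
  finally show ?thesis .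
qed

text \<open>Dominated convergence: the Gaussian density is bounded, so a constant dominates the
  integrand for all observations at once. Sequences suffice in the product topology on functions of
  \<open>nat\<close>.\<close>

lemma continuous_on_lik: "continuous_on S (lik n)"
proof (rule continuous_on_subset[OF _ subset_UNIV], unfold continuous_on_sequentially, intro ballI allI impI)
  fix Y :: "nat \<Rightarrow> nat \<Rightarrow> real ^ 'p" and y
  assume "(\<forall>m. Y m \<in> UNIV) \<and> Y \<longlonglongrightarrow> y"
  then have Y: "Y \<longlonglongrightarrow> y" by simp
  have c: "(\<lambda>m. Y m k) \<longlonglongrightarrow> y k" for k
    using continuous_on_tendsto_compose[OF continuous_on_product_coordinates[of k] Y] by simp
  show "(lik n \<circ> Y) \<longlonglongrightarrow> lik n y"
    unfolding comp_def likelihood_def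
  proof (rule integral_dominated_convergence)
    show "AE x in chain_law \<mu> \<kappa>. (\<lambda>m. \<Prod>k=1..n. gauss \<sigma> (Y m k - h (x k)))
        \<longlonglongrightarrow> (\<Prod>k=1..n. gauss \<sigma> (y k - h (x k)))"
    proof (intro AE_I2 tendsto_prod)
      fix x and k
      have "(\<lambda>m. Y m k - h (x k)) \<longlonglongrightarrow> y k - h (x k)"
        by (intro tendsto_diff c tendsto_const)
      then show "(\<lambda>m. gauss \<sigma> (Y m k - h (x k))) \<longlonglongrightarrow> gauss \<sigma> (y k - h (x k))"
        by (rule continuous_on_tendsto_compose[OF continuous_on_gauss[OF \<sigma>]]) auto
    qed
    show "AE x in chain_law \<mu> \<kappa>. norm (\<Prod>k=1..n. gauss \<sigma> (Y m k - h (x k))) \<le> ((1 / sqrt (2 * pi * \<sigma>\<^sup>2)) ^ CARD('p)) ^ n" for m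
      using lik_integrand_bounds[of "Y m" _ n] by (intro AE_I2) (simp add: abs_of_pos)
    show "integrable (chain_law \<mu> \<kappa>) (\<lambda>x. ((1 / sqrt (2 * pi * \<sigma>\<^sup>2)) ^ CARD('p)) ^ n)"
      by (rule C.integrable_const)
  qed (use lik_integrand_integrable in \<open>auto dest: borel_measurable_integrable\<close>)
qed

text \<open>Given the state path, the observations are translated noise with an explicit product
  density. Fubini exchanges the integral over state paths with Lebesgue measure, and the inner
  integral over the paths is the likelihood.\<close>

lemma obs_law_density: "obs_law h \<sigma> \<mu> \<kappa> n = density (leb n) (\<lambda>y. ennreal (lik n y))"
proof (rule measure_eqI)
  show "sets (obs_law h \<sigma> \<mu> \<kappa> n) = sets (density (leb n) (\<lambda>y. ennreal (lik n y)))"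
    by (simp add: obs_law_def sets_leb del: One_nat_def)
  fix A assume "A \<in> sets (obs_law h \<sigma> \<mu> \<kappa> n)"
  then have A[measurable]: "A \<in> sets (\<Pi>\<^sub>M k\<in>{1..n}. borel)"
    by (simp add: obs_law_def)
  then have A'[measurable]: "A \<in> sets (leb n)" by (simp add: sets_leb)
  interpret L: sigma_finite_measure "leb n" by (rule sigma_finite_leb)
  interpret P: pair_sigma_finite "chain_law \<mu> \<kappa>" "leb n" by unfold_locales
  let ?obs = "\<lambda>x v. \<lambda>k\<in>{1..n}. h (x k) + v k"
  have obs2: "?obs x \<in> noise \<rightarrow>\<^sub>M (\<Pi>\<^sub>M k\<in>{1..n}. borel)" for x
    by (intro measurable_restrict) measurable
  have obs1: "(\<lambda>(x, v). ?obs x v) \<in> chain_law \<mu> \<kappa> \<Otimes>\<^sub>M noise \<rightarrow>\<^sub>M (\<Pi>\<^sub>M k\<in>{1..n}. borel)"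
    using measurable_obs[of n] by (simp add: obs_def[abs_def] hmm_law_def split_beta')
  have dm: "(\<lambda>y. \<Prod>k=1..n. ennreal (gauss \<sigma> (y k - c k))) \<in> borel_measurable (leb n)"
    for c :: "nat \<Rightarrow> real ^ 'p"
  proof (intro borel_measurable_prod_ennreal)
    fix k assume "k \<in> {1..n}"
    then have "(\<lambda>y. y k) \<in> leb n \<rightarrow>\<^sub>M borel"
      using measurable_component_singleton[of k "{1..n}" "\<lambda>_. lborel :: (real ^ 'p) measure"] by simp
    then have "(\<lambda>y. y k - c k) \<in> leb n \<rightarrow>\<^sub>M borel"
      by (intro borel_measurable_diff borel_measurable_const)
    from measurable_compose[OF measurable_compose[OF this measurable_gauss] measurable_ennreal]
    show "(\<lambda>y. ennreal (gauss \<sigma> (y k - c k))) \<in> borel_measurable (leb n)" .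
  qed
  have dens: "(\<lambda>(x, y). (\<Prod>k=1..n. ennreal (gauss \<sigma> (y k - h (x k)))) * indicator A y)
      \<in> borel_measurable (chain_law \<mu> \<kappa> \<Otimes>\<^sub>M leb n)"
    by measurable
  have "emeasure (obs_law h \<sigma> \<mu> \<kappa> n) A = (\<integral>\<^sup>+\<omega>. indicator A (obs h n \<omega>) \<partial>hmm_law \<sigma> \<mu> \<kappa>)"
    unfolding obs_law_def using A nn_integral_distr[OF measurable_obs, of "indicator A" n]
    by simp
  also have "\<dots> = (\<integral>\<^sup>+\<omega>. (case \<omega> of (x, v) \<Rightarrow> indicator A (?obs x v)) \<partial>(chain_law \<mu> \<kappa> \<Otimes>\<^sub>M noise))"
    unfolding hmm_law_def obs_def by (intro nn_integral_cong) (auto simp: split_beta')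
  also have "\<dots> = (\<integral>\<^sup>+x. \<integral>\<^sup>+v. indicator A (?obs x v) \<partial>noise \<partial>chain_law \<mu> \<kappa>)"
    using measurable_compose[OF obs1 borel_measurable_indicator[OF A]]
    by (subst N.nn_integral_fst[symmetric]) (auto simp: split_beta')
  also have "\<dots> = (\<integral>\<^sup>+x. emeasure (distr noise (\<Pi>\<^sub>M k\<in>{1..n}. borel) (?obs x)) A \<partial>chain_law \<mu> \<kappa>)"
    using A nn_integral_distr[OF obs2, of "indicator A"] by (intro nn_integral_cong) simp
  also have "\<dots> = (\<integral>\<^sup>+x. \<integral>\<^sup>+y. (\<Prod>k=1..n. ennreal (gauss \<sigma> (y k - h (x k)))) * indicator A y \<partial>leb n \<partial>chain_law \<mu> \<kappa>)"
    unfolding distr_gauss_noise[OF \<sigma> finite_atLeastAtMost]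
    by (rule nn_integral_cong, rule emeasure_density[OF dm A'])
  also have "\<dots> = (\<integral>\<^sup>+y. \<integral>\<^sup>+x. (\<Prod>k=1..n. ennreal (gauss \<sigma> (y k - h (x k)))) * indicator A y \<partial>chain_law \<mu> \<kappa> \<partial>leb n)"
    by (rule P.Fubini'[OF dens, symmetric])
  also have "\<dots> = (\<integral>\<^sup>+y. ennreal (lik n y) * indicator A y \<partial>leb n)"
    by (intro nn_integral_cong, subst nn_integral_multc) (auto simp: nn_integral_lik simp del: One_nat_def)
  also have "\<dots> = emeasure (density (leb n) (\<lambda>y. ennreal (lik n y))) A"
  proof (rule emeasure_density[symmetric, OF _ A'])
    have "(\<lambda>y. \<integral>\<^sup>+x. (\<Prod>k=1..n. ennreal (gauss \<sigma> (y k - h (x k)))) \<partial>chain_law \<mu> \<kappa>) \<in> borel_measurable (leb n)"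
      by measurable
    then show "(\<lambda>y. ennreal (lik n y)) \<in> borel_measurable (leb n)"
      by (simp only: nn_integral_lik)
  qed
  finally show "emeasure (obs_law h \<sigma> \<mu> \<kappa> n) A = emeasure (density (leb n) (\<lambda>y. ennreal (lik n y))) A" .
qed

lemma measurable_lik: "lik n \<in> borel_measurable (\<Pi>\<^sub>M k\<in>{1..n}. borel)"
proof -
  have "(\<lambda>y. enn2real (\<integral>\<^sup>+x. (\<Prod>k=1..n. ennreal (gauss \<sigma> (y k - h (x k)))) \<partial>chain_law \<mu> \<kappa>))
      \<in> borel_measurable (\<Pi>\<^sub>M k\<in>{1..n}. borel)"
    by measurable
  then show ?thesis
    by (simp add: nn_integral_lik less_imp_le[OF lik_pos] del: One_nat_def)
qed

end

text \<open>The likelihood is the integral of a jointly measurable function against the kernel that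
  maps \<theta> to the law of the chain; measurability of this kernel is assumption
  \<open>K\<close>. Joint measurability is what Fubini over the prior requires.\<close>

lemma measurable_likelihood_pair:
  fixes h :: "'e::topological_space \<Rightarrow> real ^ 'p" and K :: "'t \<Rightarrow> 'e \<Rightarrow> 'e measure"
  assumes hm: "\<And>\<theta>. hidden_markov h \<sigma> \<mu> (K \<theta>)"
    and K: "(\<lambda>\<theta>. chain_law \<mu> (K \<theta>)) \<in> M \<rightarrow>\<^sub>M prob_algebra (\<Pi>\<^sub>M n\<in>UNIV. borel)"
  shows "(\<lambda>(\<theta>, y). likelihood h \<sigma> \<mu> (K \<theta>) n y) \<in> borel_measurable (M \<Otimes>\<^sub>M (\<Pi>\<^sub>M k\<in>{1..n}. borel))"
proof -
  have [measurable]: "h \<in> borel_measurable borel" using hm by (auto simp: hidden_markov_def)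
  have "(\<lambda>p. \<integral>\<^sup>+x. (\<Prod>k=1..n. ennreal (gauss \<sigma> (snd p k - h (x k)))) \<partial>chain_law \<mu> (K (fst p)))
      \<in> borel_measurable (M \<Otimes>\<^sub>M (\<Pi>\<^sub>M k\<in>{1..n}. borel))"
  proof (rule nn_integral_measurable_subprob_algebra2)
    show "(\<lambda>(p, x). \<Prod>k=1..n. ennreal (gauss \<sigma> (snd p k - h (x k))))
      \<in> borel_measurable ((M \<Otimes>\<^sub>M (\<Pi>\<^sub>M k\<in>{1..n}. borel)) \<Otimes>\<^sub>M (\<Pi>\<^sub>M n\<in>UNIV. borel))"
      by measurable
    show "(\<lambda>p. chain_law \<mu> (K (fst p))) \<in> M \<Otimes>\<^sub>M (\<Pi>\<^sub>M k\<in>{1..n}. borel) \<rightarrow>\<^sub>M subprob_algebra (\<Pi>\<^sub>M n\<in>UNIV. borel)"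
      by (rule measurable_compose[OF measurable_fst measurable_prob_algebraD[OF K]])
  qed
  then have "(\<lambda>p. enn2real (ennreal (likelihood h \<sigma> \<mu> (K (fst p)) n (snd p))))
      \<in> borel_measurable (M \<Otimes>\<^sub>M (\<Pi>\<^sub>M k\<in>{1..n}. borel))"
    unfolding hidden_markov.nn_integral_lik[OF hm] by (rule borel_measurable_enn2real)
  then show ?thesis
    by (simp add: less_imp_le[OF hidden_markov.lik_pos[OF hm]] split_beta')
qed

section \<open>Identification of the continuous Radon-Nikodym derivative\<close>

lemma emeasure_lborel_open_pos:
  fixes U :: "'a::euclidean_space set"
  assumes "open U" "x \<in> U"
  shows "0 < emeasure lborel U"
proof -
  obtain e where e: "0 < e" "ball x e \<subseteq> U" using assms by (auto simp: open_contains_ball)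
  have "0 < emeasure lborel (ball x e)"
    using e(1) by (simp add: emeasure_ball unit_ball_vol_pos)
  also have "\<dots> \<le> emeasure lborel U"
    using assms e by (intro emeasure_mono) auto
  finally show ?thesis .
qed

text \<open>If the functions differed at \<open>y\<close>, they would differ on a neighbourhood of
  \<open>y\<close> within the extensional functions. It contains a box whose sides are nonempty open
  sets, and the finite product of Lebesgue measures gives this box positive mass.\<close>

lemma AE_PiM_lborel_continuous_eq:
  fixes f g :: "(nat \<Rightarrow> 'a::euclidean_space) \<Rightarrow> real"
  assumes I: "finite I"
    and f: "continuous_on (\<Pi>\<^sub>E i\<in>I. UNIV) f" and g: "continuous_on (\<Pi>\<^sub>E i\<in>I. UNIV) g"
    and ae: "AE y in (\<Pi>\<^sub>M i\<in>I. lborel). f y = g y"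
    and y: "y \<in> (\<Pi>\<^sub>E i\<in>I. UNIV)"
  shows "f y = g y"
proof (rule ccontr)
  assume neq: "f y \<noteq> g y"
  interpret product_sigma_finite "\<lambda>_::nat. lborel :: 'a measure" by unfold_locales
  have "continuous_on (\<Pi>\<^sub>E i\<in>I. UNIV) (\<lambda>y. f y - g y)"
    using f g by (rule continuous_on_diff)
  from this[unfolded continuous_on_open_invariant, rule_format, OF open_Compl[OF closed_singleton[of 0]]]
  obtain U where U: "open U" "U \<inter> (\<Pi>\<^sub>E i\<in>I. UNIV) = (\<lambda>y. f y - g y) -` (- {0}) \<inter> (\<Pi>\<^sub>E i\<in>I. UNIV)"
    by (elim exE conjE)
  have "y \<in> U" using U(2) y neq by auto
  then obtain X where X: "y \<in> (\<Pi>\<^sub>E i\<in>UNIV. X i)" "\<And>i. open (X i)" "(\<Pi>\<^sub>E i\<in>UNIV. X i) \<subseteq> U"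
    using product_topology_open_contains_basis[of "\<lambda>_. euclidean" UNIV U y] U(1)
    by (auto simp: open_fun_def)
  have y_out: "y i = undefined" if "i \<notin> I" for i using y that by (auto simp: PiE_def extensional_def)
  have sub: "Pi\<^sub>E I X \<subseteq> {z \<in> space (\<Pi>\<^sub>M i\<in>I. lborel). f z \<noteq> g z}"
  proof
    fix z assume z: "z \<in> Pi\<^sub>E I X"
    \<comment> \<open>The open box is taken in the full function space, so coordinates outside
      \<open>I\<close> must be checked too; there \<open>z\<close> and \<open>y\<close> share the
      default value \<open>undefined\<close>.\<close>
    have "z i \<in> X i" for i
    proof (cases "i \<in> I")
      case False
      then have "z i = y i" using z y_out[OF False] by (auto simp: PiE_def extensional_def)
      then show ?thesis using X(1) by auto
    qed (use z in auto)
    then have "z \<in> U" using X(3) by auto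
    moreover have "z \<in> (\<Pi>\<^sub>E i\<in>I. UNIV)" using z by (auto simp: PiE_iff)
    ultimately show "z \<in> {z \<in> space (\<Pi>\<^sub>M i\<in>I. lborel). f z \<noteq> g z}"
      using U(2) by (auto simp: space_PiM)
  qed
  obtain N where N: "{z \<in> space (\<Pi>\<^sub>M i\<in>I. lborel). \<not> f z = g z} \<subseteq> N"
      "emeasure (\<Pi>\<^sub>M i\<in>I. lborel) N = 0" "N \<in> sets (\<Pi>\<^sub>M i\<in>I. lborel :: 'a measure)"
    using ae by (rule AE_E)
  have "emeasure (\<Pi>\<^sub>M i\<in>I. lborel) (Pi\<^sub>E I X) \<le> emeasure (\<Pi>\<^sub>M i\<in>I. lborel) N"
    using sub N by (intro emeasure_mono) auto
  then have "(\<Prod>i\<in>I. emeasure lborel (X i)) = 0"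
    using X(2) I N(2) by (subst (asm) emeasure_PiM) auto
  then obtain i where "i \<in> I" "emeasure lborel (X i) = 0"
    using I by (auto simp: prod_zero_iff)
  moreover have "0 < emeasure lborel (X i)"
    using X(1,2) by (intro emeasure_lborel_open_pos[of _ "y i"]) auto
  ultimately show False by simp
qed

text \<open>The quotient of the positive continuous likelihoods satisfies the defining property, so
  the choice satisfies it as well. Two densities agree almost everywhere, and by continuity
  everywhere on the space of the observation law.\<close>

lemma cont_RN_deriv_obs_law:
  fixes h :: "'e::topological_space \<Rightarrow> real ^ 'p"
  assumes "hidden_markov h \<sigma> \<mu> \<kappa>" "hidden_markov h \<sigma> \<mu>' \<kappa>'"
    and y: "y \<in> (\<Pi>\<^sub>E k\<in>{1..n}. UNIV)"
  shows "cont_RN_deriv (obs_law h \<sigma> \<mu>' \<kappa>' n) (obs_law h \<sigma> \<mu> \<kappa> n) y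
    = likelihood h \<sigma> \<mu> \<kappa> n y / likelihood h \<sigma> \<mu>' \<kappa>' n y"
proof -
  interpret A: hidden_markov h \<sigma> \<mu> \<kappa> by fact
  interpret B: hidden_markov h \<sigma> \<mu>' \<kappa>' by fact
  interpret L: sigma_finite_measure "A.leb n" by (rule A.sigma_finite_leb)
  let ?M = "obs_law h \<sigma> \<mu>' \<kappa>' n" and ?N = "obs_law h \<sigma> \<mu> \<kappa> n"
  define P where "P f \<longleftrightarrow> f \<in> borel_measurable ?M \<and> (\<forall>y\<in>space ?M. 0 \<le> f y) \<and>
     continuous_on (space ?M) f \<and> density ?M (\<lambda>y. ennreal (f y)) = ?N" for f :: "_ \<Rightarrow> real"
  define q where "q = (\<lambda>y. A.lik n y / B.lik n y)"
  have sM: "sets ?M = sets (\<Pi>\<^sub>M k\<in>{1..n}. borel)" by (simp add: obs_law_def)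
  then have spM: "space ?M = (\<Pi>\<^sub>E k\<in>{1..n}. UNIV)"
    using sets_eq_imp_space_eq[OF sM] by (simp add: space_PiM)
  have mM: "f \<in> borel_measurable ?M \<longleftrightarrow> f \<in> borel_measurable (\<Pi>\<^sub>M k\<in>{1..n}. borel)"
    "f \<in> borel_measurable (A.leb n) \<longleftrightarrow> f \<in> borel_measurable (\<Pi>\<^sub>M k\<in>{1..n}. borel)" for f :: "_ \<Rightarrow> real"
    by (simp_all only: measurable_cong_sets[OF sM refl] measurable_cong_sets[OF A.sets_leb refl])
  have qm: "q \<in> borel_measurable (\<Pi>\<^sub>M k\<in>{1..n}. borel)"
    unfolding q_def by (intro borel_measurable_divide A.measurable_lik B.measurable_lik)
  have dens: "density ?M (\<lambda>y. ennreal (f y)) = density (A.leb n) (\<lambda>y. ennreal (B.lik n y) * ennreal (f y))"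
    if "f \<in> borel_measurable (\<Pi>\<^sub>M k\<in>{1..n}. borel)" for f
    unfolding B.obs_law_density using that B.measurable_lik mM(2)
    by (intro density_density_eq measurable_compose[OF _ measurable_ennreal]) auto
  have mul: "ennreal (B.lik n y) * ennreal (q y) = ennreal (A.lik n y)" for y
    using A.lik_pos[of n y] B.lik_pos[of n y] by (simp add: q_def flip: ennreal_mult)
  have qc: "continuous_on S q" for S
    unfolding q_def
    by (intro continuous_on_divide A.continuous_on_lik B.continuous_on_lik ballI
        B.lik_pos[THEN less_imp_neq, THEN not_sym])
  have Pq: "P q"
    unfolding P_def mM dens[OF qm] mul A.obs_law_density
    using qm qc A.lik_pos B.lik_pos by (auto simp: q_def less_imp_le)
  then have Pf: "P (cont_RN_deriv ?M ?N)"
    unfolding cont_RN_deriv_def P_def[symmetric] by (rule someI[of P q])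
  define f where "f = cont_RN_deriv ?M ?N"
  have fP: "f \<in> borel_measurable (\<Pi>\<^sub>M k\<in>{1..n}. borel)" "\<And>y. y \<in> (\<Pi>\<^sub>E k\<in>{1..n}. UNIV) \<Longrightarrow> 0 \<le> f y"
    "continuous_on (\<Pi>\<^sub>E k\<in>{1..n}. UNIV) f" "density ?M (\<lambda>y. ennreal (f y)) = ?N"
    using Pf[unfolded P_def spM mM, folded f_def] by auto
  have "density (A.leb n) (\<lambda>y. ennreal (B.lik n y) * ennreal (f y)) = density (A.leb n) (\<lambda>y. ennreal (B.lik n y) * ennreal (q y))"
    using fP(4) dens[OF fP(1)] Pq dens[OF qm] by (simp add: P_def)
  then have "AE y in A.leb n. ennreal (B.lik n y) * ennreal (f y) = ennreal (B.lik n y) * ennreal (q y)"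
    using fP(1) qm B.measurable_lik mM(2)
    by (subst (asm) L.density_unique_iff)
      (auto intro!: borel_measurable_times_ennreal measurable_compose[OF _ measurable_ennreal])
  then have "AE y in A.leb n. f y = q y"
    using AE_space
  proof eventually_elim
    case (elim y)
    have "0 \<le> f y" using elim(2) by (intro fP(2)) (simp add: space_PiM)
    moreover have "0 \<le> q y" "0 < B.lik n y"
      using A.lik_pos[of n y] B.lik_pos[of n y] by (auto simp: q_def)
    ultimately show "f y = q y"
      using elim(1) by (simp add: ennreal_mult_cancel_left ennreal_mult[symmetric])
  qed
  then have "f y = q y"
    using fP(3) qc y by (intro AE_PiM_lborel_continuous_eq[of "{1..n}" f q]) auto
  then show ?thesis by (simp add: f_def q_def)
qed

section \<open>The law of large numbers\<close>

lemma mixing_kernel_doeblin: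
  fixes \<kappa> :: "'e::topological_space \<Rightarrow> 'e measure"
  assumes "\<kappa> \<in> borel \<rightarrow>\<^sub>M prob_algebra borel" "mixing_kernel \<kappa>"
  obtains m \<epsilon> where "doeblin_kernel borel \<kappa> m \<epsilon>"
proof -
  obtain \<epsilon> m where "0 < \<epsilon>" "finite_measure m" "sets m = sets borel"
    "\<And>x A. A \<in> sets borel \<Longrightarrow> \<epsilon> * measure m A \<le> measure (\<kappa> x) A \<and> measure (\<kappa> x) A \<le> 1 / \<epsilon> * measure m A"
    using assms(2) unfolding mixing_kernel_def by blast
  then have "doeblin_kernel borel \<kappa> m \<epsilon>"
    using assms(1) by (intro doeblin_kernel.intro) simp_all
  then show ?thesis by (rule that)
qed

text \<open>Existence is \<open>stationary\<close> and uniqueness is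
  \<open>invariant_unique\<close>; together they give the definite description its meaning.\<close>

lemma invariant_law_invariant:
  assumes "doeblin_kernel borel \<kappa> m \<epsilon>"
  shows "doeblin_kernel.invariant borel \<kappa> (invariant_law \<kappa>)"
proof -
  interpret doeblin_kernel borel \<kappa> m \<epsilon> by fact
  have "invariant (THE q. invariant q)"
    by (rule theI[of invariant stationary])
      (simp_all add: invariant_stationary invariant_unique[OF _ invariant_stationary])
  then show ?thesis
    by (simp add: invariant_law_def invariant_def)
qed

text \<open>The conditional spells the distance of \<open>j\<close> and \<open>k\<close> without
  negative numbers. On either side of \<open>j\<close> the exponents are distinct, so each half is
  at most the full geometric series.\<close>

lemma sum_power_dist_le:
  fixes r :: real
  assumes "0 \<le> r" "r < 1"
  shows "(\<Sum>k=1..n. r ^ (if j \<le> k then k - j else j - k)) \<le> 2 / (1 - r)"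
proof -
  have geom: "(\<Sum>i\<in>I. r ^ i) \<le> 1 / (1 - r)" if "finite I" for I :: "nat set"
    using assms sum_le_suminf[OF summable_geometric[of r] that] suminf_geometric[of r] by simp
  have "(\<Sum>k=1..n. r ^ (if j \<le> k then k - j else j - k))
    = (\<Sum>k\<in>{1..n} \<inter> {k. j \<le> k}. r ^ (k - j)) + (\<Sum>k\<in>{1..n} \<inter> - {k. j \<le> k}. r ^ (j - k))"
    by (subst sum.If_cases[symmetric]) (auto intro!: sum.cong)
  also have "(\<Sum>k\<in>{1..n} \<inter> {k. j \<le> k}. r ^ (k - j)) = (\<Sum>i\<in>(\<lambda>k. k - j) ` ({1..n} \<inter> {k. j \<le> k}). r ^ i)"
    by (subst sum.reindex) (auto simp: inj_on_def)
  also have "(\<Sum>k\<in>{1..n} \<inter> - {k. j \<le> k}. r ^ (j - k)) = (\<Sum>i\<in>(\<lambda>k. j - k) ` ({1..n} \<inter> - {k. j \<le> k}). r ^ i)"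
    by (subst sum.reindex) (auto simp: inj_on_def)
  finally show ?thesis
    using geom[of "(\<lambda>k. k - j) ` ({1..n} \<inter> {k. j \<le> k})"] geom[of "(\<lambda>k. j - k) ` ({1..n} \<inter> - {k. j \<le> k})"]
    by simp
qed

lemma empirical_props:
  assumes "1 \<le> n"
  shows "prob_space (empirical n y)" "sets (empirical n y) = sets borel"
    "B \<in> sets borel \<Longrightarrow> measure (empirical n y) B = (\<Sum>k=1..n. indicator B (y k)) / n"
proof -
  have m: "y \<in> uniform_count_measure {1..n} \<rightarrow>\<^sub>M borel"
    by (simp add: uniform_count_measure_def point_measure_def)
  show "prob_space (empirical n y)"
    unfolding empirical_def using assms
    by (intro prob_space.prob_space_distr prob_space_uniform_count_measure m) auto
  show "sets (empirical n y) = sets borel" by (simp add: empirical_def)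
  assume B: "B \<in> sets borel"
  have "measure (empirical n y) B = measure (uniform_count_measure {1..n}) ({1..n} \<inter> {k. y k \<in> B})"
    unfolding empirical_def using m B
    by (subst measure_distr) (auto simp: vimage_def space_uniform_count_measure Int_commute)
  also have "\<dots> = card ({1..n} \<inter> {k. y k \<in> B}) / n"
    by (subst measure_uniform_count_measure) auto
  also have "\<dots> = (\<Sum>k=1..n. indicator B (y k)) / n"
    by (simp add: indicator_def of_bool_def[symmetric] sum_of_bool_eq)
  finally show "measure (empirical n y) B = (\<Sum>k=1..n. indicator B (y k)) / n" .
qed

section \<open>Covariances of the events that an observation hits a Borel set\<close>

context hidden_markov
begin

text \<open>The conditional probability, given the state \<open>x\<close>, that an observation falls
  into \<open>B\<close>.\<close>

definition hit_prob :: "(real ^ 'p) set \<Rightarrow> 'e \<Rightarrow> real" where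
  "hit_prob B x = measure (gauss_law \<sigma>) ((+) (h x) -` B)"

lemma hit_prob_bounds: "0 \<le> hit_prob B x \<and> hit_prob B x \<le> 1"
proof -
  interpret prob_space "gauss_law \<sigma> :: (real ^ 'p) measure" by (rule prob_space_gauss_law[OF \<sigma>])
  show ?thesis by (simp add: hit_prob_def)
qed

lemma measurable_hit_prob:
  assumes [measurable]: "B \<in> sets borel"
  shows "hit_prob B \<in> borel_measurable borel"
proof -
  interpret prob_space "gauss_law \<sigma> :: (real ^ 'p) measure" by (rule prob_space_gauss_law[OF \<sigma>])
  have "(\<lambda>x. emeasure (gauss_law \<sigma>) (Pair x -` {z. h (fst z) + snd z \<in> B})) \<in> borel_measurable borel"
  proof (rule measurable_emeasure_Pair)
    have "(\<lambda>z. h (fst z) + snd z) -` B \<inter> space (borel \<Otimes>\<^sub>M gauss_law \<sigma>) \<in> sets (borel \<Otimes>\<^sub>M gauss_law \<sigma>)"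
      by measurable
    then show "{z. h (fst z) + snd z \<in> B} \<in> sets (borel \<Otimes>\<^sub>M gauss_law \<sigma>)"
      by (simp add: vimage_def space_pair_measure)
  qed
  from borel_measurable_enn2real[OF this] show ?thesis
    by (simp add: hit_prob_def[abs_def] measure_def vimage_def)
qed

lemma noise_hit:
  assumes B: "B \<in> sets borel" and I: "finite I"
  shows "N.prob {v \<in> space noise. \<forall>k\<in>I. h (x k) + v k \<in> B} = (\<Prod>k\<in>I. hit_prob B (x k))"
proof -
  interpret G: prob_space "gauss_law \<sigma> :: (real ^ 'p) measure" by (rule prob_space_gauss_law[OF \<sigma>])
  interpret GP: product_prob_space "\<lambda>_::nat. gauss_law \<sigma> :: (real ^ 'p) measure" UNIV by unfold_locales
  have "(+) (h (x k)) -` B \<in> sets borel" for k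
    using measurable_sets[of "\<lambda>v. h (x k) + v" borel borel B] B by simp
  then have "emeasure noise {v \<in> space noise. \<forall>k\<in>I. v k \<in> (+) (h (x k)) -` B} = (\<Prod>k\<in>I. emeasure (gauss_law \<sigma>) ((+) (h (x k)) -` B))"
    by (intro GP.emeasure_PiM_Collect I) auto
  then have "ennreal (N.prob {v \<in> space noise. \<forall>k\<in>I. h (x k) + v k \<in> B}) = ennreal (\<Prod>k\<in>I. hit_prob B (x k))"
    by (simp add: N.emeasure_eq_measure G.emeasure_eq_measure hit_prob_def prod_ennreal)
  then show ?thesis
    by (subst (asm) ennreal_inj) (auto intro!: prod_nonneg simp: hit_prob_def)
qed

text \<open>The constant \<open>b\<close> will be the mass of \<open>B\<close> under the limiting
  observation law rather than the mean at time \<open>k\<close>, so \<open>dev\<close> need not be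
  centred when the chain starts off equilibrium.\<close>

definition dev :: "real \<Rightarrow> (real ^ 'p) set \<Rightarrow> nat \<Rightarrow> (nat \<Rightarrow> 'e) \<times> (nat \<Rightarrow> real ^ 'p) \<Rightarrow> real" where
  "dev b B k \<omega> = indicator B (h (fst \<omega> k) + snd \<omega> k) - b"

lemma measurable_dev:
  assumes [measurable]: "B \<in> sets borel"
  shows "dev b B k \<in> borel_measurable (hmm_law \<sigma> \<mu> \<kappa>)"
  unfolding dev_def[abs_def] hmm_law_def by measurable

lemma dev_bound: "0 \<le> b \<Longrightarrow> b \<le> 1 \<Longrightarrow> \<bar>dev b B k \<omega>\<bar> \<le> 1"
  by (auto simp: dev_def indicator_def)

lemma dev_mult_bound: "0 \<le> b \<Longrightarrow> b \<le> 1 \<Longrightarrow> \<bar>dev b B j \<omega> * dev b B k \<omega>\<bar> \<le> 1"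
  unfolding abs_mult by (intro mult_le_one dev_bound) auto

lemma integrable_dev_mult:
  assumes B: "B \<in> sets borel" and b: "0 \<le> b" "b \<le> 1"
  shows "integrable (hmm_law \<sigma> \<mu> \<kappa>) (\<lambda>\<omega>. dev b B j \<omega> * dev b B k \<omega>)"
  using dev_mult_bound[OF b]
  by (intro H.integrable_const_bound[where B=1] borel_measurable_times measurable_dev B AE_I2) simp

text \<open>Given the state path, distinct times carry independent noise. Expanding the product
  leaves the events that both or one of the observations hit \<open>B\<close>; their conditional
  probabilities factor, and for the joint event this needs \<open>j \<noteq> k\<close>.\<close>

lemma expectation_dev_mult:
  assumes B: "B \<in> sets borel" and b: "0 \<le> b" "b \<le> 1" and jk: "j \<noteq> k"
  shows "H.expectation (\<lambda>\<omega>. dev b B j \<omega> * dev b B k \<omega>)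
    = (\<integral>x. (hit_prob B (x j) - b) * (hit_prob B (x k) - b) \<partial>chain_law \<mu> \<kappa>)"
proof -
  interpret P: pair_sigma_finite "chain_law \<mu> \<kappa>" noise by unfold_locales
  note [measurable] = B
  have "H.expectation (\<lambda>\<omega>. dev b B j \<omega> * dev b B k \<omega>)
    = (\<integral>x. \<integral>v. dev b B j (x, v) * dev b B k (x, v) \<partial>noise \<partial>chain_law \<mu> \<kappa>)"
    using integrable_dev_mult[OF B b, of j k]
    unfolding hmm_law_def by (rule P.integral_fst'[symmetric])
  also have "\<dots> = (\<integral>x. (hit_prob B (x j) - b) * (hit_prob B (x k) - b) \<partial>chain_law \<mu> \<kappa>)"
  proof (rule Bochner_Integration.integral_cong[OF refl])
    fix x :: "nat \<Rightarrow> 'e"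
    define E where "E I = {v \<in> space noise. \<forall>k\<in>I. h (x k) + v k \<in> B}" for I
    have E: "E I \<in> sets noise" if "finite I" for I
      unfolding E_def using that by measurable
    have int: "integrable noise (indicator (E I) :: _ \<Rightarrow> real)" if "finite I" for I
      using E[OF that] by (simp add: N.emeasure_eq_measure)
    have "(\<integral>v. dev b B j (x, v) * dev b B k (x, v) \<partial>noise)
      = (\<integral>v. indicator (E {j, k}) v - b * indicator (E {j}) v - b * indicator (E {k}) v + b * b \<partial>noise)"
      by (intro Bochner_Integration.integral_cong refl)
        (auto simp: dev_def E_def indicator_def algebra_simps)
    also have "\<dots> = N.prob (E {j, k}) - b * N.prob (E {j}) - b * N.prob (E {k}) + b * b"
      using int E by (simp add: N.prob_space sets.Int_space_eq2)
    also have "\<dots> = (hit_prob B (x j) - b) * (hit_prob B (x k) - b)"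
      unfolding E_def using jk by (subst (1 2 3) noise_hit[OF B]) (simp_all add: algebra_simps)
    finally show "(\<integral>v. dev b B j (x, v) * dev b B k (x, v) \<partial>noise) = (hit_prob B (x j) - b) * (hit_prob B (x k) - b)" .
  qed
  finally show ?thesis .
qed

end

locale mixing_hidden_markov = hidden_markov h \<sigma> \<mu> \<kappa> + D: doeblin_kernel borel \<kappa> m \<epsilon>
  for h :: "'e::topological_space \<Rightarrow> real ^ 'p" and \<sigma> \<mu> \<kappa> m \<epsilon>
begin

lemma chain_law_P_pow:
  fixes f g :: "'e \<Rightarrow> real"
  assumes f: "f \<in> borel_measurable borel" "\<And>x. \<bar>f x\<bar> \<le> Bf"
    and g: "g \<in> borel_measurable borel" "\<And>x. \<bar>g x\<bar> \<le> Bg"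
  shows "(\<integral>x. g (x j) * f (x (j + i)) \<partial>chain_law \<mu> \<kappa>) = (\<integral>x. g (x j) * (D.P ^^ i) f (x j) \<partial>chain_law \<mu> \<kappa>)"
  using f
proof (induction i arbitrary: f)
  case (Suc i)
  have "(\<integral>x. g (x j) * f (x (Suc (j + i))) \<partial>chain_law \<mu> \<kappa>) = (\<integral>x. g (x j) * D.P f (x (j + i)) \<partial>chain_law \<mu> \<kappa>)"
    unfolding D.P_def by (rule integral_chain_law_step[OF \<kappa> \<mu> Suc.prems g]) simp
  also have "\<dots> = (\<integral>x. g (x j) * (D.P ^^ i) (D.P f) (x j) \<partial>chain_law \<mu> \<kappa>)"
    using D.P_pow_abs_le[OF Suc.prems, of _ 1] by (intro Suc.IH D.measurable_P Suc.prems) simp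
  finally show ?case by (simp add: funpow_swap1)
qed simp

text \<open>Conditioning on the state at time \<open>j\<close> replaces \<open>F (x k)\<close> by an
  iterate of \<open>P\<close> of order \<open>k - j\<close>, which is within
  \<open>D.r ^ (k - j)\<close> of the invariant mean \<open>b\<close> whatever that state is. The
  other factor is bounded by 1.\<close>

lemma chain_law_cov_le:
  fixes F :: "'e \<Rightarrow> real"
  assumes F: "F \<in> borel_measurable borel" "\<And>x. 0 \<le> F x \<and> F x \<le> 1" and "j \<le> k"
  defines "b \<equiv> (\<integral>x. F x \<partial>invariant_law \<kappa>)"
  shows "\<bar>\<integral>x. (F (x j) - b) * (F (x k) - b) \<partial>chain_law \<mu> \<kappa>\<bar> \<le> D.r ^ (k - j)"
proof -
  note inv = invariant_law_invariant[OF D.doeblin_kernel_axioms]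
  define i where "i = k - j"
  have k: "k = j + i" using assms(3) by (simp add: i_def)
  have b: "0 \<le> b \<and> b \<le> 1"
  proof -
    interpret q: prob_space "invariant_law \<kappa>"
      using inv by (simp add: D.invariant_def space_prob_algebra)
    have "sets (invariant_law \<kappa>) = sets borel"
      using inv by (simp add: D.invariant_def space_prob_algebra)
    then have "F \<in> borel_measurable (invariant_law \<kappa>)"
      using F(1) by (simp cong: measurable_cong_sets)
    then have "integrable (invariant_law \<kappa>) F"
      using F(2) by (intro q.integrable_const_bound[where B=1] AE_I2) auto
    then show ?thesis
      unfolding b_def using F(2) by (auto intro!: q.integral_ge_const q.integral_le_const)
  qed
  have m[measurable]: "(D.P ^^ i) F \<in> borel_measurable borel" for i by (rule D.measurable_P_pow[OF F(1)])
  have Pb: "0 \<le> (D.P ^^ i) F x \<and> (D.P ^^ i) F x \<le> 1" for i x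
    using F(2) by (intro D.P_pow_bounds F(1)) auto
  note [measurable] = F(1)
  have int: "integrable (chain_law \<mu> \<kappa>) (\<lambda>x. G (x l))"
    if "G \<in> borel_measurable borel" "\<And>x. \<bar>G x\<bar> \<le> 1" for G :: "'e \<Rightarrow> real" and l
    using that by (intro C.integrable_const_bound[where B=1] AE_I2 measurable_compose[OF measurable_state]) auto
  have int2: "integrable (chain_law \<mu> \<kappa>) (\<lambda>x. G (x l) * G' (x l'))"
    if "G \<in> borel_measurable borel" "\<And>x. \<bar>G x\<bar> \<le> 1" "G' \<in> borel_measurable borel" "\<And>x. \<bar>G' x\<bar> \<le> 1"
    for G G' :: "'e \<Rightarrow> real" and l l'
  proof (rule C.integrable_const_bound[where B=1])
    show "AE x in chain_law \<mu> \<kappa>. norm (G (x l) * G' (x l')) \<le> 1"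
      using that by (intro AE_I2) (auto simp: abs_mult intro!: mult_le_one)
    show "(\<lambda>x. G (x l) * G' (x l')) \<in> borel_measurable (chain_law \<mu> \<kappa>)"
      by (intro borel_measurable_times measurable_compose[OF measurable_state that(1)]
          measurable_compose[OF measurable_state that(3)])
  qed
  have Fb: "\<bar>F x - b\<bar> \<le> 1" "\<bar>F x\<bar> \<le> 1" "\<bar>(D.P ^^ i) F x\<bar> \<le> 1" for x i
    using F(2)[of x] b Pb[of i x] by (auto simp: abs_le_iff)
  have Fbm: "(\<lambda>x. F x - b) \<in> borel_measurable borel" by measurable
  have "(\<integral>x. (F (x j) - b) * (F (x k) - b) \<partial>chain_law \<mu> \<kappa>)
    = (\<integral>x. (F (x j) - b) * F (x (j + i)) \<partial>chain_law \<mu> \<kappa>) - (\<integral>x. (F (x j) - b) * b \<partial>chain_law \<mu> \<kappa>)"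
    unfolding right_diff_distrib[of _ _ b] k
    using int2[OF Fbm Fb(1) F(1) Fb(2)] int[OF Fbm Fb(1)]
    by (intro Bochner_Integration.integral_diff) auto
  also have "(\<integral>x. (F (x j) - b) * F (x (j + i)) \<partial>chain_law \<mu> \<kappa>)
      = (\<integral>x. (F (x j) - b) * (D.P ^^ i) F (x j) \<partial>chain_law \<mu> \<kappa>)"
    by (rule chain_law_P_pow[OF F(1) Fb(2) Fbm Fb(1)])
  also have "\<dots> - (\<integral>x. (F (x j) - b) * b \<partial>chain_law \<mu> \<kappa>)
      = (\<integral>x. (F (x j) - b) * ((D.P ^^ i) F (x j) - b) \<partial>chain_law \<mu> \<kappa>)"
    unfolding right_diff_distrib[of _ _ b]
    using int2[OF Fbm Fb(1) m Fb(3)] int[OF Fbm Fb(1)]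
    by (intro Bochner_Integration.integral_diff[symmetric]) auto
  finally have eq: "(\<integral>x. (F (x j) - b) * (F (x k) - b) \<partial>chain_law \<mu> \<kappa>)
      = (\<integral>x. (F (x j) - b) * ((D.P ^^ i) F (x j) - b) \<partial>chain_law \<mu> \<kappa>)" .
  have "\<bar>(\<integral>x. (F (x j) - b) * ((D.P ^^ i) F (x j) - b) \<partial>chain_law \<mu> \<kappa>)\<bar>
      \<le> (\<integral>x. \<bar>(F (x j) - b) * ((D.P ^^ i) F (x j) - b)\<bar> \<partial>chain_law \<mu> \<kappa>)"
    by (rule integral_abs_bound)
  also have "\<dots> \<le> D.r ^ i"
  proof (rule C.integral_le_const)
    have Gm: "(\<lambda>x. (D.P ^^ i) F x - b) \<in> borel_measurable borel" by measurable
    have Gb: "\<bar>(D.P ^^ i) F x - b\<bar> \<le> 1" for x using Pb[of i x] b by (auto simp: abs_le_iff)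
    show "integrable (chain_law \<mu> \<kappa>) (\<lambda>x. \<bar>(F (x j) - b) * ((D.P ^^ i) F (x j) - b)\<bar>)"
      by (rule integrable_abs[OF int2[OF Fbm Fb(1) Gm Gb]])
    show "AE x in chain_law \<mu> \<kappa>. \<bar>(F (x j) - b) * ((D.P ^^ i) F (x j) - b)\<bar> \<le> D.r ^ i"
    proof (rule AE_I2)
      fix x :: "nat \<Rightarrow> 'e"
      have "\<bar>(D.P ^^ i) F (x j) - b\<bar> \<le> D.r ^ i"
        unfolding b_def using F(2) by (intro D.P_pow_tendsto_invariant[OF inv F(1)]) auto
      then have "\<bar>F (x j) - b\<bar> * \<bar>(D.P ^^ i) F (x j) - b\<bar> \<le> 1 * D.r ^ i"
        by (intro mult_mono Fb) auto
      then show "\<bar>(F (x j) - b) * ((D.P ^^ i) F (x j) - b)\<bar> \<le> D.r ^ i"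
        by (simp add: abs_mult)
    qed
  qed
  finally show ?thesis unfolding eq i_def .
qed

text \<open>Unfolding the convolution gives the invariant mean of \<open>hit_prob B\<close>. Hence
  centring at the limiting mass of \<open>B\<close> is exactly the centring that the covariance
  bound uses.\<close>

lemma measure_limit_obs_law:
  assumes B: "B \<in> sets borel"
  shows "measure (limit_obs_law h \<sigma> \<kappa>) B = (\<integral>x. hit_prob B x \<partial>invariant_law \<kappa>)"
    "prob_space (limit_obs_law h \<sigma> \<kappa>)" "sets (limit_obs_law h \<sigma> \<kappa>) = sets borel"
proof -
  note inv = invariant_law_invariant[OF D.doeblin_kernel_axioms]
  interpret q: prob_space "invariant_law \<kappa>"
    using inv by (simp add: D.invariant_def space_prob_algebra)
  have s: "sets (invariant_law \<kappa>) = sets borel"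
    using inv by (simp add: D.invariant_def space_prob_algebra)
  have hm: "h \<in> invariant_law \<kappa> \<rightarrow>\<^sub>M borel"
    unfolding measurable_cong_sets[OF s refl] by (rule h)
  interpret G: prob_space "gauss_law \<sigma> :: (real ^ 'p) measure" by (rule prob_space_gauss_law[OF \<sigma>])
  interpret d: prob_space "distr (invariant_law \<kappa>) borel h" by (rule q.prob_space_distr[OF hm])
  interpret dG: pair_prob_space "distr (invariant_law \<kappa>) borel h" "gauss_law \<sigma> :: (real ^ 'p) measure"
    by unfold_locales
  show "sets (limit_obs_law h \<sigma> \<kappa>) = sets borel" by (simp add: limit_obs_law_def)
  show p: "prob_space (limit_obs_law h \<sigma> \<kappa>)"
    unfolding limit_obs_law_def convolution_def by (rule dG.prob_space_distr) measurable
  interpret l: prob_space "limit_obs_law h \<sigma> \<kappa>" by (rule p)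
  have m: "(\<lambda>x. emeasure (gauss_law \<sigma>) {a. a + x \<in> B}) \<in> borel_measurable borel"
  proof -
    have "(\<lambda>x. emeasure (gauss_law \<sigma>) (Pair x -` {z. snd z + fst z \<in> B})) \<in> borel_measurable (borel :: (real ^ 'p) measure)"
    proof (rule G.measurable_emeasure_Pair)
      have "(\<lambda>z. snd z + fst z) -` B \<inter> space (borel \<Otimes>\<^sub>M gauss_law \<sigma>) \<in> sets (borel \<Otimes>\<^sub>M gauss_law \<sigma> :: ((real ^ 'p) \<times> (real ^ 'p)) measure)"
        using B by measurable
      then show "{z. snd z + fst z \<in> B} \<in> sets (borel \<Otimes>\<^sub>M gauss_law \<sigma> :: ((real ^ 'p) \<times> (real ^ 'p)) measure)"
        by (simp add: vimage_def space_pair_measure)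
    qed
    then show ?thesis by (simp add: vimage_def)
  qed
  have "emeasure (limit_obs_law h \<sigma> \<kappa>) B = (\<integral>\<^sup>+x. emeasure (gauss_law \<sigma>) {a. a + x \<in> B} \<partial>distr (invariant_law \<kappa>) borel h)"
    unfolding limit_obs_law_def
    by (intro convolution_emeasure B d.finite_measure_axioms G.finite_measure_axioms) auto
  also have "\<dots> = (\<integral>\<^sup>+x. emeasure (gauss_law \<sigma>) {a. a + h x \<in> B} \<partial>invariant_law \<kappa>)"
    using m by (subst nn_integral_distr[OF hm]) simp_all
  also have "\<dots> = (\<integral>\<^sup>+x. ennreal (hit_prob B x) \<partial>invariant_law \<kappa>)"
    by (intro nn_integral_cong) (simp add: hit_prob_def G.emeasure_eq_measure vimage_def add.commute)
  also have "\<dots> = ennreal (\<integral>x. hit_prob B x \<partial>invariant_law \<kappa>)"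
  proof (rule nn_integral_eq_integral)
    show "integrable (invariant_law \<kappa>) (hit_prob B)"
      using hit_prob_bounds measurable_hit_prob[OF B]
      by (intro q.integrable_const_bound[where B=1] AE_I2) (auto simp: measurable_cong_sets[OF s refl])
  qed (use hit_prob_bounds in auto)
  finally show "measure (limit_obs_law h \<sigma> \<kappa>) B = (\<integral>x. hit_prob B x \<partial>invariant_law \<kappa>)"
    unfolding l.emeasure_eq_measure
    by (subst (asm) ennreal_inj) (auto intro!: Bochner_Integration.integral_nonneg simp: hit_prob_bounds)
qed

text \<open>Each row of the matrix of product expectations is dominated by a two-sided geometric
  series, including the diagonal, where the bound is \<open>D.r ^ 0 = 1\<close>. There are
  \<open>n\<close> rows.\<close>

lemma second_moment_dev_le:
  assumes B: "B \<in> sets borel"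
  defines "b \<equiv> measure (limit_obs_law h \<sigma> \<kappa>) B"
  shows "H.expectation (\<lambda>\<omega>. (\<Sum>k=1..n. dev b B k \<omega>)\<^sup>2) \<le> n * (2 / (1 - D.r))"
proof -
  interpret l: prob_space "limit_obs_law h \<sigma> \<kappa>" by (rule measure_limit_obs_law(2)[OF B])
  have b: "0 \<le> b" "b \<le> 1" by (simp_all add: b_def)
  have b_eq: "b = (\<integral>x. hit_prob B x \<partial>invariant_law \<kappa>)" unfolding b_def by (rule measure_limit_obs_law(1)[OF B])
  have cov: "H.expectation (\<lambda>\<omega>. dev b B j \<omega> * dev b B k \<omega>) \<le> D.r ^ (if j \<le> k then k - j else j - k)" for j k
  proof -
    have lt: "H.expectation (\<lambda>\<omega>. dev b B j \<omega> * dev b B k \<omega>) \<le> D.r ^ (k - j)" if "j < k" for j k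
      using chain_law_cov_le[OF measurable_hit_prob[OF B] hit_prob_bounds, of j k] that
      unfolding b_eq[symmetric] by (subst expectation_dev_mult[OF B b]) auto
    consider "j < k" | "j = k" | "k < j" by linarith
    then show ?thesis
    proof cases
      case 2
      have "H.expectation (\<lambda>\<omega>. dev b B j \<omega> * dev b B k \<omega>) \<le> 1"
        using dev_mult_bound[OF b] integrable_dev_mult[OF B b]
        by (intro H.integral_le_const AE_I2) (auto simp: abs_le_iff)
      then show ?thesis using 2 by simp
    qed (use lt[of j k] lt[of k j] in \<open>auto simp: mult.commute\<close>)
  qed
  have "H.expectation (\<lambda>\<omega>. (\<Sum>k=1..n. dev b B k \<omega>)\<^sup>2)
    = H.expectation (\<lambda>\<omega>. \<Sum>j=1..n. \<Sum>k=1..n. dev b B j \<omega> * dev b B k \<omega>)"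
    by (simp only: power2_eq_square sum_product)
  also have "\<dots> = (\<Sum>j=1..n. \<Sum>k=1..n. H.expectation (\<lambda>\<omega>. dev b B j \<omega> * dev b B k \<omega>))"
    by (simp add: Bochner_Integration.integral_sum integrable_dev_mult[OF B b])
  also have "\<dots> \<le> (\<Sum>j=1..n. \<Sum>k=1..n. D.r ^ (if j \<le> k then k - j else j - k))"
    by (intro sum_mono cov)
  also have "\<dots> \<le> (\<Sum>j=1..n. 2 / (1 - D.r))"
    by (intro sum_mono sum_power_dist_le D.r_bounds)
  finally show ?thesis by simp
qed

text \<open>Chebyshev's inequality: the second moment of the sum of deviations grows only linearly
  in \<open>n\<close>, while the threshold \<open>(n * \<delta>)\<close> enters squared.\<close>

lemma empirical_tendsto:
  assumes B: "B \<in> sets borel" and \<delta>: "0 < \<delta>"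
  shows "(\<lambda>n. H.prob {\<omega> \<in> space (hmm_law \<sigma> \<mu> \<kappa>).
      \<delta> \<le> \<bar>measure (empirical n (obs h n \<omega>)) B - measure (limit_obs_law h \<sigma> \<kappa>) B\<bar>}) \<longlonglongrightarrow> 0"
proof -
  interpret l: prob_space "limit_obs_law h \<sigma> \<kappa>" by (rule measure_limit_obs_law(2)[OF B])
  define b where "b = measure (limit_obs_law h \<sigma> \<kappa>) B"
  have b: "0 \<le> b" "b \<le> 1" by (simp_all add: b_def)
  define A where "A n = {\<omega> \<in> space (hmm_law \<sigma> \<mu> \<kappa>). \<delta> \<le> \<bar>measure (empirical n (obs h n \<omega>)) B - b\<bar>}" for n
  have bound: "H.prob (A n) \<le> (2 / (1 - D.r)) / \<delta>\<^sup>2 * inverse (real n)" if n: "1 \<le> n" for n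
  proof -
    let ?S = "\<lambda>\<omega>. (\<Sum>k=1..n. dev b B k \<omega>)"
    have e: "measure (empirical n (obs h n \<omega>)) B - b = ?S \<omega> / n" for \<omega>
    proof -
      have "(\<Sum>k=1..n. indicator B (obs h n \<omega> k)) = (\<Sum>k=1..n. dev b B k \<omega> + b)"
        by (intro sum.cong) (auto simp: obs_def dev_def)
      also have "\<dots> = ?S \<omega> + n * b" by (simp add: sum.distrib)
      finally show ?thesis using n B by (simp add: empirical_props(3) field_simps)
    qed
    have "\<delta> \<le> \<bar>s / n\<bar> \<longleftrightarrow> (n * \<delta>)\<^sup>2 \<le> s\<^sup>2" for s :: real
    proof -
      have "\<delta> \<le> \<bar>s / n\<bar> \<longleftrightarrow> \<bar>n * \<delta>\<bar> \<le> \<bar>s\<bar>"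
        using n \<delta> by (simp add: abs_mult field_simps)
      then show ?thesis by (simp only: abs_le_square_iff)
    qed
    then have A_eq: "A n = {\<omega> \<in> space (hmm_law \<sigma> \<mu> \<kappa>). (n * \<delta>)\<^sup>2 \<le> (?S \<omega>)\<^sup>2}"
      unfolding A_def e by simp
    have "H.prob (A n) \<le> H.expectation (\<lambda>\<omega>. (?S \<omega>)\<^sup>2) / (n * \<delta>)\<^sup>2"
      unfolding A_eq
    proof (rule integral_Markov_inequality_measure[where A="space (hmm_law \<sigma> \<mu> \<kappa>)"])
      show "integrable (hmm_law \<sigma> \<mu> \<kappa>) (\<lambda>\<omega>. (?S \<omega>)\<^sup>2)"
        unfolding power2_eq_square sum_product
        by (intro Bochner_Integration.integrable_sum integrable_dev_mult B b)
    qed (use n \<delta> in auto)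
    also have "\<dots> \<le> n * (2 / (1 - D.r)) / (n * \<delta>)\<^sup>2"
      unfolding b_def by (intro divide_right_mono second_moment_dev_le B) simp
    also have "real n * C / (n * \<delta>)\<^sup>2 = C / \<delta>\<^sup>2 * inverse (real n)" for C
      using n \<delta> by (simp add: power2_eq_square field_simps)
    finally show ?thesis .
  qed
  have "(\<lambda>n. H.prob (A n)) \<longlonglongrightarrow> 0"
  proof (rule tendsto_sandwich[OF _ _ tendsto_const])
    show "\<forall>\<^sub>F n in sequentially. H.prob (A n) \<le> (2 / (1 - D.r)) / \<delta>\<^sup>2 * inverse (real n)"
      using bound by (auto simp: eventually_sequentially)
    have "(\<lambda>n. (2 / (1 - D.r)) / \<delta>\<^sup>2 * inverse (real n)) \<longlonglongrightarrow> (2 / (1 - D.r)) / \<delta>\<^sup>2 * 0"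
      by (intro tendsto_mult tendsto_const lim_inverse_n)
    then show "(\<lambda>n. (2 / (1 - D.r)) / \<delta>\<^sup>2 * inverse (real n)) \<longlonglongrightarrow> 0" by simp
  qed simp
  then show ?thesis by (simp only: A_def b_def)
qed

end

section \<open>Empirical measures in the Levy-Prokhorov metric\<close>

text \<open>The infimum is over a nonempty set, as \<open>e = 1\<close> is admissible between
  probability measures, and over one bounded below by 0; so it can be replaced by a witness.\<close>

lemma levy_prokhorov_less_iff:
  assumes "prob_space M" "prob_space N"
  shows "levy_prokhorov M N < \<epsilon> \<longleftrightarrow> (\<exists>e<\<epsilon>. 0 < e \<and> (\<forall>A\<in>sets borel.
     measure M A \<le> measure N (\<Union>a\<in>A. ball a e) + e \<and>
     measure N A \<le> measure M (\<Union>a\<in>A. ball a e) + e))"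
proof -
  interpret M: prob_space M by fact
  interpret N: prob_space N by fact
  let ?S = "{e. 0 < e \<and> (\<forall>A\<in>sets borel.
     measure M A \<le> measure N (\<Union>a\<in>A. ball a e) + e \<and>
     measure N A \<le> measure M (\<Union>a\<in>A. ball a e) + e)}"
  have "1 \<in> ?S"
    by (auto intro: order_trans[OF M.prob_le_1] order_trans[OF N.prob_le_1])
  then have "?S \<noteq> {}" by blast
  moreover have "bdd_below ?S" by (rule bdd_belowI[of _ 0]) auto
  ultimately show ?thesis
    unfolding levy_prokhorov_def by (subst cInf_less_iff) auto
qed

text \<open>Balls of radius \<open>\<epsilon> / 2\<close> around a countable dense set cover the
  space and are made disjoint. Continuity from below lets finitely many of them carry almost all
  mass.\<close>

lemma small_partition:
  fixes \<nu> :: "'a::{metric_space, second_countable_topology} measure"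
  assumes "prob_space \<nu>" and s: "sets \<nu> = sets borel" and \<epsilon>: "0 < \<epsilon>"
  obtains B :: "nat \<Rightarrow> 'a set" and N :: nat
  where "\<And>i. B i \<in> sets borel" "disjoint_family B"
    "\<And>i x y. x \<in> B i \<Longrightarrow> y \<in> B i \<Longrightarrow> dist x y < \<epsilon>" "1 - \<epsilon> < measure \<nu> (\<Union>i<N. B i)"
proof -
  interpret prob_space \<nu> by fact
  obtain D :: "'a set" where D: "countable D" "\<And>X. open X \<Longrightarrow> X \<noteq> {} \<Longrightarrow> \<exists>d\<in>D. d \<in> X"
    by (rule countable_dense_setE) blast
  have "D \<noteq> {}" using D(2)[of UNIV] by auto
  define C where "C i = ball (from_nat_into D i) (\<epsilon> / 2)" for i
  define B where "B = disjointed C"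
  have C_UN: "(\<Union>i. C i) = UNIV"
  proof (intro set_eqI iffI UNIV_I)
    fix x :: 'a
    obtain d where d: "d \<in> D" "d \<in> ball x (\<epsilon> / 2)" using D(2)[of "ball x (\<epsilon> / 2)"] \<epsilon> by auto
    then obtain i where "from_nat_into D i = d"
      using from_nat_into_surj[OF D(1)] by blast
    then have "x \<in> C i" using d(2) by (simp add: C_def dist_commute)
    then show "x \<in> (\<Union>i. C i)" by blast
  qed
  have Bs: "B i \<in> sets borel" for i
  proof -
    have "range C \<subseteq> sets borel" by (auto simp: C_def)
    then have "range B \<subseteq> sets borel" unfolding B_def by (rule sets.range_disjointed_sets)
    then show ?thesis by auto
  qed
  have "(\<lambda>n. measure \<nu> (\<Union>i<n. B i)) \<longlonglongrightarrow> measure \<nu> (\<Union>n. \<Union>i<n. B i)"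
  proof (rule finite_Lim_measure_incseq)
    show "range (\<lambda>n. \<Union>i<n. B i) \<subseteq> events" using Bs by (auto simp: s)
    show "incseq (\<lambda>n. \<Union>i<n. B i)" by (intro monoI UN_mono) auto
  qed
  moreover have "(\<Union>n. \<Union>i<n. B i) = space \<nu>"
  proof -
    have "(\<Union>n. \<Union>i<n. B i) = (\<Union>i. B i)" by blast
    also have "\<dots> = UNIV" unfolding B_def UN_disjointed_eq by (rule C_UN)
    also have "\<dots> = space \<nu>" using sets_eq_imp_space_eq[OF s] by simp
    finally show ?thesis .
  qed
  ultimately have "(\<lambda>n. measure \<nu> (\<Union>i<n. B i)) \<longlonglongrightarrow> 1" by (simp add: prob_space)
  then have "\<forall>\<^sub>F n in sequentially. 1 - \<epsilon> < measure \<nu> (\<Union>i<n. B i)"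
    using \<epsilon> by (intro order_tendstoD(1)) auto
  then obtain N where N: "1 - \<epsilon> < measure \<nu> (\<Union>i<N. B i)"
    by (auto simp: eventually_sequentially)
  have dist: "dist x y < \<epsilon>" if "x \<in> B i" "y \<in> B i" for i x y
  proof -
    have "x \<in> C i" "y \<in> C i" using that disjointed_subset[of C i] unfolding B_def by auto
    then show ?thesis unfolding C_def using dist_triangle_half_r[of "from_nat_into D i" x \<epsilon> y] by simp
  qed
  show ?thesis
    using that[of B N] Bs dist N disjoint_family_disjointed[of C] by (simp add: B_def)
qed

text \<open>A Borel set \<open>A\<close> is compared with the union \<open>V\<close> of those of the
  first \<open>N\<close> cells that it meets. Small diameters put \<open>V\<close> inside a
  neighbourhood of \<open>A\<close>; the two masses of \<open>V\<close> differ by at most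
  \<open>\<epsilon>\<close>, and the part of \<open>A\<close> outside these cells has mass at most
  \<open>\<epsilon>\<close> under \<open>\<nu>\<close> and \<open>2 * \<epsilon>\<close> under
  \<open>M\<close>. So \<open>3 * \<epsilon>\<close> is admissible, and 4 makes the inequality
  strict. The denominator \<open>N + 1\<close> stays positive for \<open>N = 0\<close>.\<close>

lemma levy_prokhorov_less_partition:
  fixes M \<nu> :: "'a::{metric_space, second_countable_topology} measure"
  assumes "prob_space M" and sM: "sets M = sets borel"
    and "prob_space \<nu>" and s: "sets \<nu> = sets borel" and \<epsilon>: "0 < \<epsilon>"
    and B: "\<And>i::nat. B i \<in> sets borel" "disjoint_family B"
    and small: "\<And>i x y. x \<in> B i \<Longrightarrow> y \<in> B i \<Longrightarrow> dist x y < \<epsilon>" and big: "1 - \<epsilon> < measure \<nu> (\<Union>i<N. B i)"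
    and near: "\<And>i. i < N \<Longrightarrow> \<bar>measure M (B i) - measure \<nu> (B i)\<bar> \<le> \<epsilon> / (N + 1)"
  shows "levy_prokhorov M \<nu> < 4 * \<epsilon>"
proof -
  interpret M: prob_space M by fact
  interpret n: prob_space \<nu> by fact
  have spM: "space M = UNIV" "space \<nu> = UNIV"
    using sets_eq_imp_space_eq[OF sM] sets_eq_imp_space_eq[OF s] by auto
  have near_UN: "\<bar>measure M (\<Union>i\<in>I. B i) - measure \<nu> (\<Union>i\<in>I. B i)\<bar> \<le> \<epsilon>" if I: "I \<subseteq> {..<N}" for I
  proof -
    have fin: "finite I" using I finite_subset by blast
    have dis: "disjoint_family_on B I" using B(2) by (rule disjoint_family_on_mono[rotated]) simp
    have "measure M (\<Union>i\<in>I. B i) = (\<Sum>i\<in>I. measure M (B i))"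
      using B(1) fin dis by (intro M.finite_measure_finite_Union) (auto simp: sM)
    moreover have "measure \<nu> (\<Union>i\<in>I. B i) = (\<Sum>i\<in>I. measure \<nu> (B i))"
      using B(1) fin dis by (intro n.finite_measure_finite_Union) (auto simp: s)
    ultimately have "\<bar>measure M (\<Union>i\<in>I. B i) - measure \<nu> (\<Union>i\<in>I. B i)\<bar>
        = \<bar>\<Sum>i\<in>I. measure M (B i) - measure \<nu> (B i)\<bar>"
      by (simp add: sum_subtractf)
    also have "\<dots> \<le> (\<Sum>i\<in>I. \<bar>measure M (B i) - measure \<nu> (B i)\<bar>)" by (rule sum_abs)
    also have "\<dots> \<le> (\<Sum>i\<in>I. \<epsilon> / (N + 1))" using I near by (intro sum_mono) auto
    also have "\<dots> = card I * (\<epsilon> / (N + 1))" by simp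
    also have "\<dots> \<le> (N + 1) * (\<epsilon> / (N + 1))"
    proof (intro mult_right_mono)
      have "card I \<le> N" using card_mono[OF _ I] by simp
      then show "real (card I) \<le> real (N + 1)" by simp
    qed (use \<epsilon> in auto)
    also have "\<dots> = \<epsilon>" by simp
    finally show ?thesis .
  qed
  define U where "U = (\<Union>i<N. B i)"
  have Us: "U \<in> sets borel" unfolding U_def using B(1) by auto
  have Uc: "measure \<nu> (- U) \<le> \<epsilon>" "measure M (- U) \<le> 2 * \<epsilon>"
  proof -
    have "measure \<nu> (- U) = 1 - measure \<nu> U" "measure M (- U) = 1 - measure M U"
      using n.prob_compl[of U] M.prob_compl[of U] Us s sM spM by (simp_all add: Compl_eq_Diff_UNIV)
    then show "measure \<nu> (- U) \<le> \<epsilon>" "measure M (- U) \<le> 2 * \<epsilon>"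
      using big near_UN[of "{..<N}"] unfolding U_def by auto
  qed
  have "measure M A \<le> measure \<nu> (\<Union>a\<in>A. ball a (3 * \<epsilon>)) + 3 * \<epsilon> \<and>
     measure \<nu> A \<le> measure M (\<Union>a\<in>A. ball a (3 * \<epsilon>)) + 3 * \<epsilon>" if A: "A \<in> sets borel" for A
  proof -
    define I where "I = {i. i < N \<and> B i \<inter> A \<noteq> {}}"
    define V where "V = (\<Union>i\<in>I. B i)"
    have I: "I \<subseteq> {..<N}" by (auto simp: I_def)
    have Vs: "V \<in> sets borel" unfolding V_def using B(1) I finite_subset[OF I] by auto
    have AV: "A \<subseteq> V \<union> - U" by (auto simp: V_def U_def I_def)
    have VA: "V \<subseteq> (\<Union>a\<in>A. ball a (3 * \<epsilon>))"
    proof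
      fix x assume "x \<in> V"
      then obtain i a where "x \<in> B i" "a \<in> B i" "a \<in> A" by (auto simp: V_def I_def)
      then show "x \<in> (\<Union>a\<in>A. ball a (3 * \<epsilon>))" using small[of a i x] \<epsilon> by force
    qed
    have open_A: "(\<Union>a\<in>A. ball a (3 * \<epsilon>)) \<in> sets borel" by (intro borel_open) auto
    have 1: "measure M A \<le> measure M V + measure M (- U)"
      using M.finite_measure_mono[OF AV] measure_Un_le[of V M "- U"] Vs Us by (simp add: sM)
    have 2: "measure \<nu> A \<le> measure \<nu> V + measure \<nu> (- U)"
      using n.finite_measure_mono[OF AV] measure_Un_le[of V \<nu> "- U"] Vs Us by (simp add: s)
    have 3: "measure M V \<le> measure M (\<Union>a\<in>A. ball a (3 * \<epsilon>))"
      using open_A by (intro M.finite_measure_mono VA) (simp add: sM)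
    have 4: "measure \<nu> V \<le> measure \<nu> (\<Union>a\<in>A. ball a (3 * \<epsilon>))"
      using open_A by (intro n.finite_measure_mono VA) (simp add: s)
    show ?thesis using 1 2 3 4 Uc near_UN[OF I] \<epsilon> unfolding V_def[symmetric] abs_le_iff by linarith
  qed
  then show ?thesis
    unfolding levy_prokhorov_less_iff[OF assms(1,3)] using \<epsilon> by (intro exI[of _ "3 * \<epsilon>"]) auto
qed

text \<open>Open sets of the full function space become events for the observations, which live on
  extensional functions: the coordinates outside \<open>I\<close> are constant there.\<close>

lemma measurable_PiM_to_borel:
  "(\<lambda>y. y) \<in> (\<Pi>\<^sub>M i\<in>I. borel) \<rightarrow>\<^sub>M (borel :: ('i::countable \<Rightarrow> 'a::second_countable_topology) measure)"
proof (rule measurable_coordinatewise_then_product)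
  fix i
  show "(\<lambda>y. y i) \<in> (\<Pi>\<^sub>M i\<in>I. borel) \<rightarrow>\<^sub>M (borel :: 'a measure)"
  proof (cases "i \<in> I")
    case False
    then have "y i = undefined" if "y \<in> space (\<Pi>\<^sub>M i\<in>I. borel :: 'a measure)" for y
      using that by (auto simp: space_PiM PiE_def extensional_def)
    then show ?thesis by (subst measurable_cong[where g="\<lambda>_. undefined"]) auto
  qed (rule measurable_component_singleton)
qed

text \<open>Moving every sample point by less than \<open>\<delta>\<close> shifts empirical masses
  only into \<open>\<delta>\<close>-neighbourhoods, so a witness \<open>e\<close> for
  \<open>y\<close> becomes the witness \<open>e + \<delta>\<close>. Half of the gap between
  \<open>e\<close> and \<open>\<epsilon>\<close> is spent on \<open>\<delta>\<close>, and only
  finitely many coordinates are restricted.\<close>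

lemma open_levy_prokhorov_empirical:
  fixes \<nu> :: "'a::metric_space measure"
  assumes "prob_space \<nu>" and s: "sets \<nu> = sets borel" and n: "1 \<le> n"
  shows "open {y. levy_prokhorov (empirical n y) \<nu> < \<epsilon>}"
proof (subst open_subopen, intro ballI)
  interpret prob_space \<nu> by fact
  note iff = levy_prokhorov_less_iff[OF empirical_props(1)[OF n] \<open>prob_space \<nu>\<close>]
  fix y assume "y \<in> {y. levy_prokhorov (empirical n y) \<nu> < \<epsilon>}"
  then obtain e where e: "e < \<epsilon>" "0 < e" "\<And>A. A \<in> sets borel \<Longrightarrow>
      measure (empirical n y) A \<le> measure \<nu> (\<Union>a\<in>A. ball a e) + e \<and>
      measure \<nu> A \<le> measure (empirical n y) (\<Union>a\<in>A. ball a e) + e"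
    by (auto simp: iff)
  define \<delta> where "\<delta> = (\<epsilon> - e) / 2"
  have \<delta>: "0 < \<delta>" "e + \<delta> < \<epsilon>" using e by (auto simp: \<delta>_def field_simps)
  define W where "W = {z. \<forall>k\<in>{1..n}. dist (y k) (z k) < \<delta>}"
  have W: "open W"
  proof -
    have "W = (\<Inter>k\<in>{1..n}. (\<lambda>z. z k) -` ball (y k) \<delta>)" by (auto simp: W_def)
    also have "open \<dots>"
      by (intro open_INT ballI open_vimage continuous_on_product_coordinates) auto
    finally show ?thesis .
  qed
  have emp_le: "measure (empirical n z) A \<le> measure (empirical n w) B"
    if "\<And>k. k \<in> {1..n} \<Longrightarrow> z k \<in> A \<Longrightarrow> w k \<in> B" "A \<in> sets borel" "B \<in> sets borel" for z w A B
    unfolding empirical_props(3)[OF n that(2)] empirical_props(3)[OF n that(3)]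
    using that(1) by (intro divide_right_mono sum_mono) (auto simp: indicator_def)
  have nb: "(\<Union>a\<in>(\<Union>a\<in>A. ball a s). ball a t) \<subseteq> (\<Union>a\<in>A. ball a (s + t))" for A :: "'a set" and s t
  proof
    fix x assume "x \<in> (\<Union>a\<in>(\<Union>a\<in>A. ball a s). ball a t)"
    then obtain a b where ab: "a \<in> A" "dist a b < s" "dist b x < t" by auto
    then have "dist a x < s + t" using dist_triangle[of a x b] by linarith
    then show "x \<in> (\<Union>a\<in>A. ball a (s + t))" using ab(1) by auto
  qed
  have ob: "(\<Union>a\<in>A. ball a t) \<in> sets borel" for A :: "'a set" and t by (intro borel_open) auto
  have "levy_prokhorov (empirical n z) \<nu> < \<epsilon>" if z: "z \<in> W" for z
    unfolding iff
  proof (intro exI[of _ "e + \<delta>"] conjI ballI)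
    fix A :: "'a set" assume A: "A \<in> sets borel"
    have "measure (empirical n z) A \<le> measure (empirical n y) (\<Union>a\<in>A. ball a \<delta>)"
      using z by (intro emp_le A ob) (force simp: W_def dist_commute)
    also have "\<dots> \<le> measure \<nu> (\<Union>a\<in>(\<Union>a\<in>A. ball a \<delta>). ball a e) + e"
      using e(3)[OF ob] by blast
    also have "measure \<nu> (\<Union>a\<in>(\<Union>a\<in>A. ball a \<delta>). ball a e) \<le> measure \<nu> (\<Union>a\<in>A. ball a (e + \<delta>))"
      unfolding add.commute[of e] by (intro finite_measure_mono nb) (simp only: s ob)
    finally show "measure (empirical n z) A \<le> measure \<nu> (\<Union>a\<in>A. ball a (e + \<delta>)) + (e + \<delta>)"
      using \<delta> by simp
    have "measure \<nu> A \<le> measure (empirical n y) (\<Union>a\<in>A. ball a e) + e"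
      using e(3)[OF A] by blast
    also have "measure (empirical n y) (\<Union>a\<in>A. ball a e) \<le> measure (empirical n z) (\<Union>a\<in>A. ball a (e + \<delta>))"
    proof (intro emp_le ob)
      fix k assume "k \<in> {1..n}" "y k \<in> (\<Union>a\<in>A. ball a e)"
      then have "z k \<in> (\<Union>a\<in>(\<Union>a\<in>A. ball a e). ball a \<delta>)" using z by (force simp: W_def)
      then show "z k \<in> (\<Union>a\<in>A. ball a (e + \<delta>))" by (rule nb[THEN subsetD])
    qed
    finally show "measure \<nu> A \<le> measure (empirical n z) (\<Union>a\<in>A. ball a (e + \<delta>)) + (e + \<delta>)"
      using \<delta> by simp
  qed (use \<delta> e in auto)
  moreover have "y \<in> W" using \<delta> by (simp add: W_def)
  ultimately show "\<exists>T. open T \<and> y \<in> T \<and> T \<subseteq> {y. levy_prokhorov (empirical n y) \<nu> < \<epsilon>}"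
    using W by blast
qed

lemma levy_prokhorov_empirical_measurable:
  fixes \<nu> :: "'a::{metric_space, second_countable_topology} measure"
  assumes "prob_space \<nu>" "sets \<nu> = sets borel" "1 \<le> n"
  shows "{y \<in> space (\<Pi>\<^sub>M k\<in>{1..n}. borel). levy_prokhorov (empirical n y) \<nu> < \<epsilon>} \<in> sets (\<Pi>\<^sub>M k\<in>{1..n}. borel)"
  using measurable_sets[OF measurable_PiM_to_borel borel_open[OF open_levy_prokhorov_empirical[OF assms]]]
  by (simp add: vimage_def Int_def conj_commute)

context mixing_hidden_markov
begin

lemma measurable_empirical:
  assumes B: "B \<in> sets borel" and n: "1 \<le> n"
  shows "(\<lambda>\<omega>. measure (empirical n (obs h n \<omega>)) B) \<in> borel_measurable (hmm_law \<sigma> \<mu> \<kappa>)"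
proof -
  have "(\<lambda>\<omega>. indicator B (obs h n \<omega> k) :: real) \<in> borel_measurable (hmm_law \<sigma> \<mu> \<kappa>)" if "k \<in> {1..n}" for k
  proof -
    have "(\<lambda>y. y k) \<in> (\<Pi>\<^sub>M k\<in>{1..n}. borel) \<rightarrow>\<^sub>M (borel :: (real ^ 'p) measure)"
      using that by (rule measurable_component_singleton)
    from measurable_compose[OF measurable_compose[OF measurable_obs this] borel_measurable_indicator[OF B]]
    show ?thesis .
  qed
  then show ?thesis
    unfolding empirical_props(3)[OF n B] by (intro borel_measurable_divide borel_measurable_sum borel_measurable_const)
qed

text \<open>If the empirical measure is not close, then one of finitely many cells has a frequency
  off by at least \<open>\<delta>\<close>. The union bound reduces this to the law of large numbers
  for each cell, whose number does not grow with \<open>n\<close>.\<close>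

lemma levy_prokhorov_tendsto:
  assumes \<zeta>: "0 < \<zeta>"
  shows "(\<lambda>n. H.prob {\<omega> \<in> space (hmm_law \<sigma> \<mu> \<kappa>).
      \<not> levy_prokhorov (empirical n (obs h n \<omega>)) (limit_obs_law h \<sigma> \<kappa>) < \<zeta>}) \<longlonglongrightarrow> 0"
proof -
  note \<nu> = measure_limit_obs_law(2,3)[OF sets.empty_sets]
  obtain B :: "nat \<Rightarrow> (real ^ 'p) set" and N where B: "\<And>i. B i \<in> sets borel" "disjoint_family B"
    "\<And>i x y. x \<in> B i \<Longrightarrow> y \<in> B i \<Longrightarrow> dist x y < \<zeta> / 4" "1 - \<zeta> / 4 < measure (limit_obs_law h \<sigma> \<kappa>) (\<Union>i<N. B i)"
    using small_partition[OF \<nu>, of "\<zeta> / 4"] \<zeta> by auto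
  \<comment> \<open>The partition lemma loses a factor 4, so it is applied with
    \<open>\<zeta> / 4\<close>; this is its tolerance per cell.\<close>
  define \<delta> where "\<delta> = \<zeta> / 4 / (N + 1)"
  have \<delta>: "0 < \<delta>" using \<zeta> by (simp add: \<delta>_def)
  define E where "E n i = {\<omega> \<in> space (hmm_law \<sigma> \<mu> \<kappa>).
      \<delta> \<le> \<bar>measure (empirical n (obs h n \<omega>)) (B i) - measure (limit_obs_law h \<sigma> \<kappa>) (B i)\<bar>}" for n i
  define F where "F n = {\<omega> \<in> space (hmm_law \<sigma> \<mu> \<kappa>).
      \<not> levy_prokhorov (empirical n (obs h n \<omega>)) (limit_obs_law h \<sigma> \<kappa>) < \<zeta>}" for n
  have E: "E n i \<in> H.events" if "1 \<le> n" for n i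
  proof -
    note [measurable] = measurable_empirical[OF B(1) that]
    show ?thesis unfolding E_def by measurable
  qed
  have bound: "H.prob (F n) \<le> (\<Sum>i<N. H.prob (E n i))" if n: "1 \<le> n" for n
  proof -
    have "F n \<subseteq> (\<Union>i<N. E n i)"
    proof
      fix \<omega> assume \<omega>: "\<omega> \<in> F n"
      show "\<omega> \<in> (\<Union>i<N. E n i)"
      proof (rule ccontr)
        assume "\<omega> \<notin> (\<Union>i<N. E n i)"
        then have near: "\<bar>measure (empirical n (obs h n \<omega>)) (B i) - measure (limit_obs_law h \<sigma> \<kappa>) (B i)\<bar> \<le> \<zeta> / 4 / (N + 1)"
          if "i < N" for i
        proof -
          have "\<omega> \<notin> E n i" "\<omega> \<in> space (hmm_law \<sigma> \<mu> \<kappa>)"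
            using that \<omega> \<open>\<omega> \<notin> (\<Union>i<N. E n i)\<close> by (auto simp: F_def)
          then show ?thesis unfolding E_def \<delta>_def by (simp add: not_le less_imp_le del: of_nat_add)
        qed
        have "levy_prokhorov (empirical n (obs h n \<omega>)) (limit_obs_law h \<sigma> \<kappa>) < 4 * (\<zeta> / 4)"
          using \<zeta> by (intro levy_prokhorov_less_partition[OF empirical_props(1,2)[OF n] \<nu> _ B near]) auto
        then show False using \<omega> by (simp add: F_def)
      qed
    qed
    then have "H.prob (F n) \<le> H.prob (\<Union>i<N. E n i)"
      using E[OF n] by (intro H.finite_measure_mono) auto
    also have "\<dots> \<le> (\<Sum>i<N. H.prob (E n i))"
      using E[OF n] by (intro H.finite_measure_subadditive_finite) auto
    finally show ?thesis .
  qed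
  have "(\<lambda>n. \<Sum>i<N. H.prob (E n i)) \<longlonglongrightarrow> (\<Sum>i<N. 0)"
    unfolding E_def by (intro tendsto_sum empirical_tendsto B(1) \<delta>)
  then have lim: "(\<lambda>n. \<Sum>i<N. H.prob (E n i)) \<longlonglongrightarrow> 0" by simp
  have "(\<lambda>n. H.prob (F n)) \<longlonglongrightarrow> 0"
    using bound by (intro tendsto_sandwich[OF _ _ tendsto_const lim]) (auto simp: eventually_sequentially)
  then show ?thesis by (simp only: F_def)
qed

end

section \<open>Bounding the posterior\<close>

lemma (in hidden_markov) nn_integral_obs:
  assumes [measurable]: "\<phi> \<in> borel_measurable (\<Pi>\<^sub>M k\<in>{1..n}. borel)"
  shows "(\<integral>\<^sup>+\<omega>. \<phi> (obs h n \<omega>) \<partial>hmm_law \<sigma> \<mu> \<kappa>) = (\<integral>\<^sup>+y. ennreal (lik n y) * \<phi> y \<partial>leb n)"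
proof -
  have m: "\<phi> \<in> borel_measurable (leb n)" "(\<lambda>y. ennreal (lik n y)) \<in> borel_measurable (leb n)"
    unfolding measurable_cong_sets[OF sets_leb refl]
    using assms measurable_compose[OF measurable_lik measurable_ennreal] by auto
  have "(\<integral>\<^sup>+\<omega>. \<phi> (obs h n \<omega>) \<partial>hmm_law \<sigma> \<mu> \<kappa>) = (\<integral>\<^sup>+y. \<phi> y \<partial>obs_law h \<sigma> \<mu> \<kappa> n)"
    unfolding obs_law_def by (rule nn_integral_distr[symmetric]) (simp_all del: One_nat_def)
  also have "\<dots> = (\<integral>\<^sup>+y. ennreal (lik n y) * \<phi> y \<partial>leb n)"
    unfolding obs_law_density by (rule nn_integral_density[OF m(2,1)])
  finally show ?thesis .
qed

locale bayes_model =
  fixes h :: "'e::topological_space \<Rightarrow> real ^ 'p" and \<sigma> :: real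
    and K :: "'t::metric_space \<Rightarrow> 'e \<Rightarrow> 'e measure" and \<mu> \<mu>' :: "'e measure"
    and u :: "'t measure" and \<alpha> :: 't
  assumes model: "\<And>\<theta>. hidden_markov h \<sigma> \<mu>' (K \<theta>)"
    and truth: "hidden_markov h \<sigma> \<mu> (K \<alpha>)"
    and prior: "u \<in> space (prob_algebra borel)"
    and law_measurable:
      "(\<lambda>\<theta>. chain_law \<mu>' (K \<theta>)) \<in> borel \<rightarrow>\<^sub>M prob_algebra (\<Pi>\<^sub>M n\<in>UNIV. borel)"
begin

sublocale T: hidden_markov h \<sigma> \<mu> "K \<alpha>" by (rule truth)

lemma sets_prior: "sets u = sets borel"
  using prior by (simp add: space_prob_algebra)

sublocale u: prob_space u
  using prior by (simp add: space_prob_algebra)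

lemma space_prior: "space u = UNIV"
  using sets_eq_imp_space_eq[OF sets_prior] by simp

abbreviation lk :: "nat \<Rightarrow> 't \<Rightarrow> (nat \<Rightarrow> real ^ 'p) \<Rightarrow> real" where
  "lk n \<theta> \<equiv> likelihood h \<sigma> \<mu>' (K \<theta>) n"

lemma measurable_lk_pair: "(\<lambda>(\<theta>, y). lk n \<theta> y) \<in> borel_measurable (u \<Otimes>\<^sub>M (\<Pi>\<^sub>M k\<in>{1..n}. borel))"
  by (rule measurable_likelihood_pair[OF model])
    (simp add: measurable_cong_sets[OF sets_prior refl] law_measurable)

lemma measurable_lk_param:
  assumes "y \<in> space (\<Pi>\<^sub>M k\<in>{1..n}. borel)"
  shows "(\<lambda>\<theta>. lk n \<theta> y) \<in> borel_measurable u"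
  using measurable_compose[OF measurable_Pair2'[OF assms] measurable_lk_pair] by simp

lemma integrable_lk:
  assumes "y \<in> space (\<Pi>\<^sub>M k\<in>{1..n}. borel)"
  shows "integrable u (\<lambda>\<theta>. lk n \<theta> y)"
  using hidden_markov.lik_le[OF model] less_imp_le[OF hidden_markov.lik_pos[OF model]]
  by (intro u.integrable_const_bound[OF _ measurable_lk_param[OF assms]] AE_I2) simp

lemma set_integral_lk_mono:
  assumes y: "y \<in> space (\<Pi>\<^sub>M k\<in>{1..n}. borel)" and A: "A \<in> sets borel"
  shows "0 \<le> (LINT \<theta>:A|u. lk n \<theta> y)" "(LINT \<theta>:A|u. lk n \<theta> y) \<le> (LINT \<theta>|u. lk n \<theta> y)"
proof -
  note pos = less_imp_le[OF hidden_markov.lik_pos[OF model]]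
  show "0 \<le> (LINT \<theta>:A|u. lk n \<theta> y)"
    unfolding set_lebesgue_integral_def
    by (intro Bochner_Integration.integral_nonneg) (simp add: pos)
  have "integrable u (\<lambda>\<theta>. indicator A \<theta> *\<^sub>R lk n \<theta> y)"
    using A by (intro integrable_mult_indicator integrable_lk y) (simp add: sets_prior)
  then show "(LINT \<theta>:A|u. lk n \<theta> y) \<le> (LINT \<theta>|u. lk n \<theta> y)"
    unfolding set_lebesgue_integral_def
    by (intro integral_mono integrable_lk y) (auto simp: indicator_def pos)
qed

lemma evidence_pos:
  assumes "y \<in> space (\<Pi>\<^sub>M k\<in>{1..n}. borel)"
  shows "0 < (LINT \<theta>|u. lk n \<theta> y)"
proof -
  have "(LINT \<theta>|u. 0) < (LINT \<theta>|u. lk n \<theta> y)"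
    using hidden_markov.lik_pos[OF model]
    by (intro u.integral_less_AE_space integrable_lk assms AE_I2) (simp_all add: u.emeasure_space_1)
  then show ?thesis by simp
qed

lemma posterior_bounds:
  assumes y: "y \<in> space (\<Pi>\<^sub>M k\<in>{1..n}. borel)" and A: "A \<in> sets borel"
  shows "0 \<le> posterior h \<sigma> \<mu>' K u n y A" "posterior h \<sigma> \<mu>' K u n y A \<le> 1"
  using set_integral_lk_mono[OF assms] evidence_pos[OF y] by (simp_all add: posterior_def)

text \<open>The quantity raised to the power \<open>1 / p n\<close> in condition (i). Division takes
  place in \<open>ennreal\<close>, so a ball of prior mass zero makes a positive supremum
  infinite.\<close>

definition ratio :: "nat \<Rightarrow> real \<Rightarrow> (nat \<Rightarrow> real ^ 'p) \<Rightarrow> ennreal" where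
  "ratio n \<rho> y = (SUP \<theta>\<in>ball \<alpha> \<rho>.
     ennreal (cont_RN_deriv (obs_law h \<sigma> \<mu>' (K \<theta>) n) (obs_law h \<sigma> \<mu> (K \<alpha>) n) y)) / emeasure u (ball \<alpha> \<rho>)"

lemma ratio_eq:
  assumes "y \<in> space (\<Pi>\<^sub>M k\<in>{1..n}. borel)"
  shows "ratio n \<rho> y = (SUP \<theta>\<in>ball \<alpha> \<rho>. ennreal (T.lik n y / lk n \<theta> y)) / emeasure u (ball \<alpha> \<rho>)"
  using assms unfolding ratio_def
  by (subst cont_RN_deriv_obs_law[OF truth model]) (simp_all add: space_PiM)

text \<open>
  Each quotient of likelihoods is continuous in the observations, so its supremum over the
  uncountable ball is still measurable, being lower semicontinuous.
\<close>

lemma measurable_ratio: "ratio n \<rho> \<in> borel_measurable (\<Pi>\<^sub>M k\<in>{1..n}. borel)"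
proof -
  define S where "S y = (SUP \<theta>\<in>ball \<alpha> \<rho>. ennreal (T.lik n y / lk n \<theta> y))" for y
  have "S \<in> borel_measurable borel"
  proof (rule borel_measurableI_greater)
    fix c
    have "open {y. c < ennreal (T.lik n y / lk n \<theta> y)}" for \<theta>
    proof -
      interpret M: hidden_markov h \<sigma> \<mu>' "K \<theta>" by (rule model)
      have "continuous_on UNIV (\<lambda>y. ennreal (T.lik n y / lk n \<theta> y))"
        by (intro continuous_on_ennreal continuous_on_divide T.continuous_on_lik M.continuous_on_lik
            ballI M.lik_pos[THEN less_imp_neq, THEN not_sym])
      from open_vimage[OF open_greaterThan this, of c] show ?thesis
        by (simp add: vimage_def)
    qed
    then have "open (\<Union>\<theta>\<in>ball \<alpha> \<rho>. {y. c < ennreal (T.lik n y / lk n \<theta> y)})" by auto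
    also have "(\<Union>\<theta>\<in>ball \<alpha> \<rho>. {y. c < ennreal (T.lik n y / lk n \<theta> y)}) = {y \<in> space borel. c < S y}"
      by (auto simp: S_def less_SUP_iff)
    finally show "{y \<in> space borel. c < S y} \<in> sets borel" by simp
  qed
  then have "(\<lambda>y. S y / emeasure u (ball \<alpha> \<rho>)) \<in> borel_measurable (\<Pi>\<^sub>M k\<in>{1..n}. borel)"
    by (intro borel_measurable_divide_ennreal measurable_compose[OF measurable_PiM_to_borel]
        borel_measurable_const)
  then show ?thesis
    by (subst measurable_cong[OF ratio_eq]) (simp_all only: S_def)
qed

text \<open>For each \<theta> in the ball the bound gives
  \<open>T.lik n y \<le> t * u.prob ?B * lk n \<theta> y\<close>. Integrating over the ball puts the
  factor \<open>u.prob ?B\<close> on the left as well, where it cancels; enlarging the domain on the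
  right to the whole parameter space gives the evidence.\<close>

lemma lik_le_evidence:
  assumes y: "y \<in> space (\<Pi>\<^sub>M k\<in>{1..n}. borel)" and le: "ratio n \<rho> y \<le> ennreal t" and \<rho>: "0 < \<rho>" and t: "0 < t"
  shows "T.lik n y \<le> t * (LINT \<theta>|u. lk n \<theta> y)"
proof -
  let ?B = "ball \<alpha> \<rho>" and ?S = "SUP \<theta>\<in>ball \<alpha> \<rho>. ennreal (T.lik n y / lk n \<theta> y)"
  have B: "?B \<in> sets u" by (simp add: sets_prior)
  have pos: "0 < lk n \<theta> y" for \<theta> by (rule hidden_markov.lik_pos[OF model])
  have S: "ennreal (T.lik n y / lk n \<theta> y) \<le> ?S" if "\<theta> \<in> ?B" for \<theta>
    using that by (rule SUP_upper)
  \<comment> \<open>The centre lies in its own ball, so the supremum is positive. A null ball would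
    then make the ratio infinite, contrary to the bound by \<open>t\<close>.\<close>
  have "0 < ennreal (T.lik n y / lk n \<alpha> y)" using pos T.lik_pos[of n y] by simp
  also have "\<dots> \<le> ?S" using \<rho> by (intro S) simp
  finally have S0: "0 < ?S" .
  have U: "emeasure u ?B = ennreal (u.prob ?B)" by (rule u.emeasure_eq_measure)
  have "u.prob ?B \<noteq> 0"
  proof
    assume "u.prob ?B = 0"
    then have "ratio n \<rho> y = \<top>" using S0 by (simp add: ratio_eq[OF y] U)
    then show False using le by (simp add: top_unique)
  qed
  then have U0: "0 < u.prob ?B" by (simp add: zero_less_measure_iff)
  have "?S = ?S / emeasure u ?B * emeasure u ?B"
    using U0 by (simp add: U ennreal_divide_times)
  also have "\<dots> \<le> ennreal t * ennreal (u.prob ?B)"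
    using le unfolding ratio_eq[OF y] by (simp add: U mult_right_mono)
  finally have "?S \<le> ennreal (t * u.prob ?B)" using t by (simp add: ennreal_mult)
  then have le_tU: "ennreal (T.lik n y / lk n \<theta> y) \<le> ennreal (t * u.prob ?B)" if "\<theta> \<in> ?B" for \<theta>
    using S[OF that] by (rule order_trans[rotated])
  have q: "T.lik n y \<le> t * u.prob ?B * lk n \<theta> y" if "\<theta> \<in> ?B" for \<theta>
  proof -
    have "T.lik n y / lk n \<theta> y \<le> t * u.prob ?B"
      using le_tU[OF that] t by (subst (asm) ennreal_le_iff) auto
    then show ?thesis by (simp only: pos_divide_le_eq[OF pos])
  qed
  have "u.prob ?B * T.lik n y = (LINT \<theta>|u. indicator ?B \<theta> *\<^sub>R T.lik n y)"
    using B by (simp add: mult.commute sets.Int_space_eq2)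
  also have "\<dots> \<le> (LINT \<theta>|u. t * u.prob ?B * lk n \<theta> y)"
  proof (rule integral_mono)
    show "integrable u (\<lambda>\<theta>. indicator ?B \<theta> *\<^sub>R T.lik n y)"
      using B by (intro integrable_mult_indicator u.integrable_const)
    show "integrable u (\<lambda>\<theta>. t * u.prob ?B * lk n \<theta> y)"
      by (intro integrable_mult_right integrable_lk y)
    show "indicator ?B \<theta> *\<^sub>R T.lik n y \<le> t * u.prob ?B * lk n \<theta> y" for \<theta>
      using q[of \<theta>] t less_imp_le[OF pos[of \<theta>]] by (auto simp: indicator_def)
  qed
  also have "\<dots> = u.prob ?B * (t * (LINT \<theta>|u. lk n \<theta> y))" by simp
  finally show ?thesis using U0 by (simp add: mult_le_cancel_left_pos)
qed

text \<open>In Bayes' formula the evidence is replaced by its lower bound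
  \<open>T.lik n y / t\<close>. What remains has the true likelihood as denominator, which
  integration under the true law cancels.\<close>

lemma posterior_le:
  assumes y: "y \<in> space (\<Pi>\<^sub>M k\<in>{1..n}. borel)" and "ratio n \<rho> y \<le> ennreal t" "0 < \<rho>" "0 < t" and A: "A \<in> sets borel"
  shows "posterior h \<sigma> \<mu>' K u n y A \<le> t * (LINT \<theta>:A|u. lk n \<theta> y) / T.lik n y"
proof -
  have "posterior h \<sigma> \<mu>' K u n y A * T.lik n y
      \<le> posterior h \<sigma> \<mu>' K u n y A * (t * (LINT \<theta>|u. lk n \<theta> y))"
    by (intro mult_left_mono lik_le_evidence[OF assms(1-4)] posterior_bounds y A)
  also have "\<dots> = t * (LINT \<theta>:A|u. lk n \<theta> y)"
    using evidence_pos[OF y] by (simp add: posterior_def)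
  finally show ?thesis using T.lik_pos[of n y] by (simp add: pos_le_divide_eq)
qed

lemma set_nn_integral_lk:
  assumes y: "y \<in> space (\<Pi>\<^sub>M k\<in>{1..n}. borel)" and A: "A \<in> sets borel"
  shows "(\<integral>\<^sup>+\<theta>. indicator A \<theta> * ennreal (lk n \<theta> y) \<partial>u) = ennreal (LINT \<theta>:A|u. lk n \<theta> y)"
proof -
  note pos = less_imp_le[OF hidden_markov.lik_pos[OF model]]
  have "(\<integral>\<^sup>+\<theta>. indicator A \<theta> * ennreal (lk n \<theta> y) \<partial>u) = (\<integral>\<^sup>+\<theta>. ennreal (indicator A \<theta> *\<^sub>R lk n \<theta> y) \<partial>u)"
    by (intro nn_integral_cong) (auto simp: indicator_def)
  also have "\<dots> = ennreal (LINT \<theta>:A|u. lk n \<theta> y)"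
    unfolding set_lebesgue_integral_def using A pos
    by (intro nn_integral_eq_integral integrable_mult_indicator integrable_lk y AE_I2)
      (simp_all add: sets_prior)
  finally show ?thesis .
qed

lemma measurable_set_integral_lk:
  assumes A: "A \<in> sets borel"
  shows "(\<lambda>y. LINT \<theta>:A|u. lk n \<theta> y) \<in> borel_measurable (\<Pi>\<^sub>M k\<in>{1..n}. borel)"
proof -
  have [measurable]: "A \<in> sets u" using A by (simp only: sets_prior)
  have "(\<lambda>(y, \<theta>). indicator A \<theta> *\<^sub>R lk n \<theta> y) \<in> borel_measurable ((\<Pi>\<^sub>M k\<in>{1..n}. borel) \<Otimes>\<^sub>M u)"
    using measurable_compose[OF measurable_pair_swap' measurable_lk_pair[of n]]
    unfolding split_beta'
    by (intro borel_measurable_scaleR) (simp_all add: split_beta')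
  then show ?thesis
    unfolding set_lebesgue_integral_def by (rule u.borel_measurable_lebesgue_integral)
qed

text \<open>Fubini: under the true law, the likelihood of the truth cancels.\<close>

lemma nn_integral_likelihood_ratio:
  assumes A: "A \<in> sets borel" and B: "B \<in> sets (\<Pi>\<^sub>M k\<in>{1..n}. borel)"
  shows "(\<integral>\<^sup>+\<omega>. indicator B (obs h n \<omega>) * ennreal ((LINT \<theta>:A|u. lk n \<theta> (obs h n \<omega>)) / T.lik n (obs h n \<omega>)) \<partial>hmm_law \<sigma> \<mu> (K \<alpha>))
    = ennreal (LINT \<theta>:A|u. measure (hmm_law \<sigma> \<mu>' (K \<theta>)) {\<omega> \<in> space (hmm_law \<sigma> \<mu>' (K \<theta>)). obs h n \<omega> \<in> B})"
proof -
  note pos = hidden_markov.lik_pos[OF model]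
  interpret L: sigma_finite_measure "T.leb n" by (rule T.sigma_finite_leb)
  interpret P: pair_sigma_finite u "T.leb n" by unfold_locales
  have sL: "space (T.leb n) = space (\<Pi>\<^sub>M k\<in>{1..n}. borel)" by (rule sets_eq_imp_space_eq[OF T.sets_leb])
  have [measurable]: "A \<in> sets u" "B \<in> sets (\<Pi>\<^sub>M k\<in>{1..n}. borel)" "B \<in> sets (T.leb n)"
    using A B by (simp_all only: sets_prior T.sets_leb)
  have sets_pair: "sets (u \<Otimes>\<^sub>M T.leb n) = sets (u \<Otimes>\<^sub>M (\<Pi>\<^sub>M k\<in>{1..n}. borel))"
    by (intro sets_pair_measure_cong refl T.sets_leb)
  have lm: "(\<lambda>p. ennreal (lk n (fst p) (snd p))) \<in> borel_measurable (u \<Otimes>\<^sub>M (\<Pi>\<^sub>M k\<in>{1..n}. borel))"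
    using measurable_compose[OF measurable_lk_pair measurable_ennreal] by (simp add: split_beta')
  have jm: "(\<lambda>(\<theta>, y). indicator A \<theta> * (ennreal (lk n \<theta> y) * indicator B y)) \<in> borel_measurable (u \<Otimes>\<^sub>M T.leb n)"
    unfolding measurable_cong_sets[OF sets_pair refl] split_beta'
    by (intro borel_measurable_times_ennreal lm) measurable
  have "(\<integral>\<^sup>+\<omega>. indicator B (obs h n \<omega>) * ennreal ((LINT \<theta>:A|u. lk n \<theta> (obs h n \<omega>)) / T.lik n (obs h n \<omega>)) \<partial>hmm_law \<sigma> \<mu> (K \<alpha>))
    = (\<integral>\<^sup>+y. ennreal (T.lik n y) * (indicator B y * ennreal ((LINT \<theta>:A|u. lk n \<theta> y) / T.lik n y)) \<partial>T.leb n)"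
    by (rule T.nn_integral_obs[of "\<lambda>y. indicator B y * ennreal ((LINT \<theta>:A|u. lk n \<theta> y) / T.lik n y)"])
      (intro borel_measurable_times_ennreal borel_measurable_indicator B
        measurable_compose[OF borel_measurable_divide[OF measurable_set_integral_lk[OF A] T.measurable_lik] measurable_ennreal])
  also have "\<dots> = (\<integral>\<^sup>+y. (\<integral>\<^sup>+\<theta>. indicator A \<theta> * (ennreal (lk n \<theta> y) * indicator B y) \<partial>u) \<partial>T.leb n)"
  proof (intro nn_integral_cong)
    fix y assume "y \<in> space (T.leb n)"
    then have y: "y \<in> space (\<Pi>\<^sub>M k\<in>{1..n}. borel)" by (simp only: sL)
    have "ennreal (T.lik n y) * ennreal ((LINT \<theta>:A|u. lk n \<theta> y) / T.lik n y) = ennreal (LINT \<theta>:A|u. lk n \<theta> y)"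
      using T.lik_pos[of n y] set_integral_lk_mono(1)[OF y A] by (simp flip: ennreal_mult)
    then have "ennreal (T.lik n y) * (indicator B y * ennreal ((LINT \<theta>:A|u. lk n \<theta> y) / T.lik n y))
        = ennreal (LINT \<theta>:A|u. lk n \<theta> y) * indicator B y"
      by (simp add: ac_simps)
    also have "\<dots> = (\<integral>\<^sup>+\<theta>. indicator A \<theta> * ennreal (lk n \<theta> y) * indicator B y \<partial>u)"
      unfolding set_nn_integral_lk[OF y A, symmetric]
      by (intro nn_integral_multc[symmetric] borel_measurable_times_ennreal
          measurable_compose[OF measurable_lk_param[OF y] measurable_ennreal]) measurable
    finally show "ennreal (T.lik n y) * (indicator B y * ennreal ((LINT \<theta>:A|u. lk n \<theta> y) / T.lik n y))
        = (\<integral>\<^sup>+\<theta>. indicator A \<theta> * (ennreal (lk n \<theta> y) * indicator B y) \<partial>u)"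
      by (simp only: mult.assoc)
  qed
  also have "\<dots> = (\<integral>\<^sup>+\<theta>. (\<integral>\<^sup>+y. indicator A \<theta> * (ennreal (lk n \<theta> y) * indicator B y) \<partial>T.leb n) \<partial>u)"
    by (rule P.Fubini'[OF jm])
  also have "\<dots> = (\<integral>\<^sup>+\<theta>. ennreal (indicator A \<theta> *\<^sub>R measure (hmm_law \<sigma> \<mu>' (K \<theta>)) {\<omega> \<in> space (hmm_law \<sigma> \<mu>' (K \<theta>)). obs h n \<omega> \<in> B}) \<partial>u)"
  proof (intro nn_integral_cong)
    fix \<theta>
    interpret M: hidden_markov h \<sigma> \<mu>' "K \<theta>" by (rule model)
    have "(\<integral>\<^sup>+y. ennreal (lk n \<theta> y) * indicator B y \<partial>T.leb n) = (\<integral>\<^sup>+\<omega>. indicator B (obs h n \<omega>) \<partial>hmm_law \<sigma> \<mu>' (K \<theta>))"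
      using B by (intro M.nn_integral_obs[symmetric] borel_measurable_indicator)
    also have "\<dots> = (\<integral>\<^sup>+\<omega>. indicator {\<omega> \<in> space (hmm_law \<sigma> \<mu>' (K \<theta>)). obs h n \<omega> \<in> B} \<omega> \<partial>hmm_law \<sigma> \<mu>' (K \<theta>))"
      by (intro nn_integral_cong) (auto simp: indicator_def)
    also have "\<dots> = emeasure (hmm_law \<sigma> \<mu>' (K \<theta>)) {\<omega> \<in> space (hmm_law \<sigma> \<mu>' (K \<theta>)). obs h n \<omega> \<in> B}"
      using measurable_sets[OF M.measurable_obs B] by (intro nn_integral_indicator) (simp add: vimage_def Int_def conj_commute)
    finally have e: "(\<integral>\<^sup>+y. ennreal (lk n \<theta> y) * indicator B y \<partial>T.leb n)
      = ennreal (measure (hmm_law \<sigma> \<mu>' (K \<theta>)) {\<omega> \<in> space (hmm_law \<sigma> \<mu>' (K \<theta>)). obs h n \<omega> \<in> B})"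
      by (simp only: M.H.emeasure_eq_measure)
    show "(\<integral>\<^sup>+y. indicator A \<theta> * (ennreal (lk n \<theta> y) * indicator B y) \<partial>T.leb n)
      = ennreal (indicator A \<theta> *\<^sub>R measure (hmm_law \<sigma> \<mu>' (K \<theta>)) {\<omega> \<in> space (hmm_law \<sigma> \<mu>' (K \<theta>)). obs h n \<omega> \<in> B})"
      using e by (cases "\<theta> \<in> A") simp_all
  qed
  also have "\<dots> = ennreal (LINT \<theta>:A|u. measure (hmm_law \<sigma> \<mu>' (K \<theta>)) {\<omega> \<in> space (hmm_law \<sigma> \<mu>' (K \<theta>)). obs h n \<omega> \<in> B})"
    unfolding set_lebesgue_integral_def
  proof (rule nn_integral_eq_integral)
    \<comment> \<open>The noise factor does not depend on \<theta>, so the joint law of states and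
      noise inherits its measurability in \<theta> from that of the chain law.\<close>
    have hm: "(\<lambda>\<theta>. hmm_law \<sigma> \<mu>' (K \<theta>) :: ((nat \<Rightarrow> 'e) \<times> (nat \<Rightarrow> real ^ 'p)) measure) \<in> u \<rightarrow>\<^sub>M prob_algebra ((\<Pi>\<^sub>M n\<in>UNIV. borel) \<Otimes>\<^sub>M T.noise)"
      unfolding hmm_law_def using law_measurable T.N.prob_space_axioms
      by (intro measurable_pair_prob) (simp_all add: measurable_cong_sets[OF sets_prior refl] space_prob_algebra)
    define E where "E = {\<omega> \<in> space ((\<Pi>\<^sub>M n\<in>UNIV. borel :: 'e measure) \<Otimes>\<^sub>M T.noise). obs h n \<omega> \<in> B}"
    have s: "sets (hmm_law \<sigma> \<mu>' (K \<theta>)) = sets ((\<Pi>\<^sub>M n\<in>UNIV. borel :: 'e measure) \<Otimes>\<^sub>M T.noise)" for \<theta>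
      using measurable_space[OF hm, of \<theta>] by (simp add: space_prior space_prob_algebra)
    have sp: "space (hmm_law \<sigma> \<mu>' (K \<theta>)) = space ((\<Pi>\<^sub>M n\<in>UNIV. borel :: 'e measure) \<Otimes>\<^sub>M T.noise)" for \<theta>
      by (rule sets_eq_imp_space_eq[OF s])
    have "E \<in> sets ((\<Pi>\<^sub>M n\<in>UNIV. borel :: 'e measure) \<Otimes>\<^sub>M T.noise)"
      using measurable_sets[OF hidden_markov.measurable_obs[OF model[of \<alpha>]] B]
      unfolding s sp E_def by (simp add: vimage_def Int_def conj_commute)
    from measurable_compose[OF hm measurable_measure_prob_algebra[OF this]]
    have mm: "(\<lambda>\<theta>. measure (hmm_law \<sigma> \<mu>' (K \<theta>)) {\<omega> \<in> space (hmm_law \<sigma> \<mu>' (K \<theta>)). obs h n \<omega> \<in> B}) \<in> borel_measurable u"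
      unfolding sp E_def .
    show "integrable u (\<lambda>\<theta>. indicator A \<theta> *\<^sub>R measure (hmm_law \<sigma> \<mu>' (K \<theta>)) {\<omega> \<in> space (hmm_law \<sigma> \<mu>' (K \<theta>)). obs h n \<omega> \<in> B})"
    proof (intro integrable_mult_indicator)
      show "integrable u (\<lambda>\<theta>. measure (hmm_law \<sigma> \<mu>' (K \<theta>)) {\<omega> \<in> space (hmm_law \<sigma> \<mu>' (K \<theta>)). obs h n \<omega> \<in> B})"
      proof (rule u.integrable_const_bound[OF _ mm])
        have "prob_space (hmm_law \<sigma> \<mu>' (K \<theta>) :: ((nat \<Rightarrow> 'e) \<times> (nat \<Rightarrow> real ^ 'p)) measure)" for \<theta>
          using measurable_space[OF hm, of \<theta>] by (simp add: space_prior space_prob_algebra)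
        then show "AE \<theta> in u. norm (measure (hmm_law \<sigma> \<mu>' (K \<theta>)) {\<omega> \<in> space (hmm_law \<sigma> \<mu>' (K \<theta>)). obs h n \<omega> \<in> B}) \<le> 1"
          by (intro AE_I2) (simp add: prob_space.prob_le_1)
      qed
    qed measurable
  qed simp
  finally show ?thesis .
qed

text \<open>On the two bad events the posterior is bounded by 1, elsewhere by
  \<open>posterior_le\<close>. The comparison is made between nonnegative integrals, where the
  pointwise bound and the Fubini identity apply directly, and is converted to the real integral at
  the end.\<close>

lemma expectation_posterior_le:
  assumes A: "A \<in> sets borel" and B: "B \<in> sets (\<Pi>\<^sub>M k\<in>{1..n}. borel)" and \<rho>: "0 < \<rho>" and t: "0 < t"
  shows "(\<integral>\<omega>. posterior h \<sigma> \<mu>' K u n (obs h n \<omega>) A \<partial>hmm_law \<sigma> \<mu> (K \<alpha>))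
    \<le> T.H.prob {\<omega> \<in> space (hmm_law \<sigma> \<mu> (K \<alpha>)). obs h n \<omega> \<notin> B}
      + T.H.prob {\<omega> \<in> space (hmm_law \<sigma> \<mu> (K \<alpha>)). ennreal t < ratio n \<rho> (obs h n \<omega>)}
      + t * (LINT \<theta>:A|u. measure (hmm_law \<sigma> \<mu>' (K \<theta>)) {\<omega> \<in> space (hmm_law \<sigma> \<mu>' (K \<theta>)). obs h n \<omega> \<in> B})"
proof -
  let ?H = "hmm_law \<sigma> \<mu> (K \<alpha>) :: ((nat \<Rightarrow> 'e) \<times> (nat \<Rightarrow> real ^ 'p)) measure"
  let ?N = "{\<omega> \<in> space ?H. obs h n \<omega> \<notin> B}" and ?W = "{\<omega> \<in> space ?H. ennreal t < ratio n \<rho> (obs h n \<omega>)}"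
  let ?a = "LINT \<theta>:A|u. measure (hmm_law \<sigma> \<mu>' (K \<theta>)) {\<omega> \<in> space (hmm_law \<sigma> \<mu>' (K \<theta>)). obs h n \<omega> \<in> B}"
  let ?g = "\<lambda>\<omega>. indicator B (obs h n \<omega>) * ennreal ((LINT \<theta>:A|u. lk n \<theta> (obs h n \<omega>)) / T.lik n (obs h n \<omega>))"
  have [measurable]: "obs h n \<in> ?H \<rightarrow>\<^sub>M (\<Pi>\<^sub>M k\<in>{1..n}. borel)" by (rule T.measurable_obs)
  have N: "?N \<in> T.H.events" using B by measurable
  have W: "?W \<in> T.H.events"
    using measurable_compose[OF T.measurable_obs measurable_ratio[of n \<rho>]] by measurable
  have a: "0 \<le> ?a"
    unfolding set_lebesgue_integral_def by (intro Bochner_Integration.integral_nonneg) simp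
  have g: "?g \<in> borel_measurable ?H"
    by (intro borel_measurable_times_ennreal measurable_compose[OF T.measurable_obs]
        borel_measurable_indicator B
        measurable_compose[OF borel_measurable_divide[OF measurable_set_integral_lk[OF A] T.measurable_lik] measurable_ennreal])
  have "(\<integral>\<^sup>+\<omega>. ennreal (posterior h \<sigma> \<mu>' K u n (obs h n \<omega>) A) \<partial>?H)
      \<le> (\<integral>\<^sup>+\<omega>. indicator ?N \<omega> + indicator ?W \<omega> + ennreal t * ?g \<omega> \<partial>?H)"
  proof (rule nn_integral_mono)
    fix \<omega> assume \<omega>: "\<omega> \<in> space ?H"
    then have y: "obs h n \<omega> \<in> space (\<Pi>\<^sub>M k\<in>{1..n}. borel)" by (rule measurable_space[OF T.measurable_obs])
    show "ennreal (posterior h \<sigma> \<mu>' K u n (obs h n \<omega>) A) \<le> indicator ?N \<omega> + indicator ?W \<omega> + ennreal t * ?g \<omega>"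
    proof (cases "\<omega> \<in> ?N \<or> \<omega> \<in> ?W")
      case True
      have "ennreal (posterior h \<sigma> \<mu>' K u n (obs h n \<omega>) A) \<le> 1"
        using posterior_bounds[OF y A] by simp
      also have "1 \<le> indicator ?N \<omega> + (indicator ?W \<omega> :: ennreal)"
        using True by (auto simp: indicator_def)
      also have "\<dots> \<le> indicator ?N \<omega> + indicator ?W \<omega> + ennreal t * ?g \<omega>" by simp
      finally show ?thesis .
    next
      case False
      then have B': "obs h n \<omega> \<in> B" and le: "ratio n \<rho> (obs h n \<omega>) \<le> ennreal t"
        using \<omega> by (auto simp: not_less)
      have "ennreal (posterior h \<sigma> \<mu>' K u n (obs h n \<omega>) A)
          \<le> ennreal (t * ((LINT \<theta>:A|u. lk n \<theta> (obs h n \<omega>)) / T.lik n (obs h n \<omega>)))"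
        using posterior_le[OF y le \<rho> t A] by (intro ennreal_leI) simp
      also have "\<dots> = ennreal t * ?g \<omega>"
        using t B' by (simp add: ennreal_mult'[symmetric])
      also have "\<dots> \<le> indicator ?N \<omega> + indicator ?W \<omega> + ennreal t * ?g \<omega>" by simp
      finally show ?thesis .
    qed
  qed
  also have "\<dots> = emeasure ?H ?N + emeasure ?H ?W + ennreal t * (\<integral>\<^sup>+\<omega>. ?g \<omega> \<partial>?H)"
    using N W g by (simp add: nn_integral_add nn_integral_cmult)
  also have "\<dots> = ennreal (T.H.prob ?N + T.H.prob ?W + t * ?a)"
    unfolding nn_integral_likelihood_ratio[OF A B] T.H.emeasure_eq_measure
    using t a by (simp add: ennreal_mult' ennreal_plus)
  finally show ?thesis
    using t a by (intro integral_real_bounded) auto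
qed

end

section \<open>The exponential estimates and their combination\<close>

lemma elog_scaled_less:
  assumes "ereal (1 / real n) * elog a < ereal (- c)" "0 < n" "0 \<le> a"
  shows "a \<le> exp (- (real n * c))"
proof (cases "a = 0")
  case False
  then have "1 / real n * ln a < - c" using assms(1) by (simp add: elog_def)
  then have "ln a \<le> - (real n * c)" using assms(2) by (simp add: field_simps)
  then have "exp (ln a) \<le> exp (- (real n * c))" by simp
  then show ?thesis using False assms(3) by simp
qed simp

text \<open>Markov's inequality for the power \<open>s\<close> of \<open>f\<close>. Where
  \<open>f\<close> is infinite, so is \<open>epowr (f x) s\<close>, and the pointwise bound
  persists.\<close>

lemma prob_gt_le_of_epowr_bound:
  assumes "prob_space M" and m: "f \<in> borel_measurable M"
    and bound: "(\<integral>\<^sup>+x. epowr (f x) s \<partial>M) \<le> ennreal c" and s: "0 < s" and t: "0 < t" and c: "0 \<le> c"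
  shows "measure M {x \<in> space M. ennreal t < f x} \<le> c / t powr s"
proof -
  interpret prob_space M by fact
  let ?A = "{x \<in> space M. ennreal t < f x}"
  have A: "?A \<in> events" using m by measurable
  have le: "ennreal (t powr s) * indicator ?A x \<le> epowr (f x) s" for x
  proof (cases "x \<in> ?A \<and> f x \<noteq> \<infinity>")
    case True
    then obtain r where r: "f x = ennreal r" "0 \<le> r" by (cases "f x") auto
    then have "t < r" using True t by (simp add: ennreal_less_iff)
    then have "t powr s \<le> r powr s" using s t by (intro powr_mono2) auto
    then show ?thesis using True r by (simp add: epowr_def ennreal_leI)
  next
    case False
    then show ?thesis by (auto simp: epowr_def)
  qed
  have "ennreal (t powr s * prob ?A) = (\<integral>\<^sup>+x. ennreal (t powr s) * indicator ?A x \<partial>M)"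
    using A by (simp add: nn_integral_cmult_indicator emeasure_eq_measure ennreal_mult)
  also have "\<dots> \<le> ennreal c"
    by (rule order_trans[OF nn_integral_mono[OF le] bound])
  finally have "t powr s * prob ?A \<le> c" using c by simp
  then show ?thesis using t by (simp add: pos_le_divide_eq mult.commute)
qed

theorem lemma3p1:
  fixes K :: "'t::polish_space \<Rightarrow> 'e::polish_space \<Rightarrow> 'e measure"
    and h :: "'e \<Rightarrow> real ^ 'p"
    and \<sigma> :: real
    and \<alpha> :: 't
    and \<mu> \<mu>' :: "'e measure"
    and u :: "'t measure"
  assumes feller: "\<And>\<theta>. feller_kernel (K \<theta>)"
    and mixing: "\<And>\<theta>. mixing_kernel (K \<theta>)"
    and h_cont: "continuous_on UNIV h"
    and h_bounded: "bounded (range h)"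
    and sigma_pos: "0 < \<sigma>"
    and mu: "\<mu> \<in> space (prob_algebra borel)"
    and mu': "\<mu>' \<in> space (prob_algebra borel)"
    and prior: "u \<in> space (prob_algebra borel)"
    and law_measurable:
      "(\<lambda>\<theta>. chain_law \<mu>' (K \<theta>)) \<in> borel \<rightarrow>\<^sub>M prob_algebra (\<Pi>\<^sub>M n\<in>UNIV. borel)"
    and identifiable:
      "\<And>\<beta> \<gamma>. \<beta> \<noteq> \<gamma> \<Longrightarrow> limit_obs_law h \<sigma> (K \<beta>) \<noteq> limit_obs_law h \<sigma> (K \<gamma>)"
    and cond_i:
      "\<exists>(\<epsilon>::nat \<Rightarrow> real) (p::nat \<Rightarrow> real).
         (\<forall>n. 0 < \<epsilon> n) \<and> decseq \<epsilon> \<and> \<epsilon> \<longlonglongrightarrow> 0 \<and>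
         (\<forall>n. 1 \<le> p n) \<and> (\<lambda>n. p n / real n) \<longlonglongrightarrow> 0 \<and>
         (SUP n\<in>{1..}. \<integral>\<^sup>+\<omega>.
            epowr ((SUP \<theta>\<in>ball \<alpha> (\<epsilon> n).
                      ennreal (cont_RN_deriv (obs_law h \<sigma> \<mu>' (K \<theta>) n) (obs_law h \<sigma> \<mu> (K \<alpha>) n) (obs h n \<omega>)))
                   / emeasure u (ball \<alpha> (\<epsilon> n))) (1 / p n)
            \<partial>hmm_law \<sigma> \<mu> (K \<alpha>)) < \<infinity>"
    and cond_ii:
      "\<forall>\<eta>>0. \<exists>\<epsilon>>0. \<exists>I>0.
         limsup (\<lambda>n. ereal (1 / real n) * elog (LINT \<theta>:- ball \<alpha> \<eta>|u.
            measure (hmm_law \<sigma> \<mu>' (K \<theta>))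
              {\<omega> \<in> space (hmm_law \<sigma> \<mu>' (K \<theta>)).
                 levy_prokhorov (empirical n (obs h n \<omega>)) (limit_obs_law h \<sigma> (K \<alpha>)) < \<epsilon>}))
         \<le> - ereal I"
  shows "\<forall>\<eta>>0. (\<lambda>n. \<integral>\<omega>. posterior h \<sigma> \<mu>' K u n (obs h n \<omega>) (- ball \<alpha> \<eta>) \<partial>hmm_law \<sigma> \<mu> (K \<alpha>))
                 \<longlonglongrightarrow> 0"
proof (intro allI impI)
  fix \<eta> :: real assume \<eta>: "0 < \<eta>"
  have \<kappa>: "K \<theta> \<in> borel \<rightarrow>\<^sub>M prob_algebra borel" for \<theta>
    using feller by (simp add: feller_kernel_def)
  have hm: "h \<in> borel_measurable borel"
    using h_cont by (rule borel_measurable_continuous_onI)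
  obtain m e where "doeblin_kernel borel (K \<alpha>) m e"
    using mixing_kernel_doeblin[OF \<kappa> mixing] .
  moreover have "hidden_markov h \<sigma> \<mu> (K \<alpha>)" "hidden_markov h \<sigma> \<mu>' (K \<theta>)" for \<theta>
    using hm sigma_pos mu mu' \<kappa> by (simp_all add: hidden_markov_def)
  ultimately interpret X: mixing_hidden_markov h \<sigma> \<mu> "K \<alpha>" m e + bayes_model h \<sigma> K \<mu> \<mu>' u \<alpha>
    using prior law_measurable
    by (simp_all add: mixing_hidden_markov_def bayes_model_def)
  let ?\<nu> = "limit_obs_law h \<sigma> (K \<alpha>)"
  let ?H = "hmm_law \<sigma> \<mu> (K \<alpha>) :: ((nat \<Rightarrow> 'e) \<times> (nat \<Rightarrow> real ^ 'p)) measure"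
  define post where "post n = (\<integral>\<omega>. posterior h \<sigma> \<mu>' K u n (obs h n \<omega>) (- ball \<alpha> \<eta>) \<partial>?H)" for n
  obtain \<rho> p :: "nat \<Rightarrow> real" where \<rho>: "\<And>n. 0 < \<rho> n" and p: "\<And>n. 1 \<le> p n" "(\<lambda>n. p n / real n) \<longlonglongrightarrow> 0"
    and fin: "(SUP n\<in>{1..}. \<integral>\<^sup>+\<omega>. epowr (ratio n (\<rho> n) (obs h n \<omega>)) (1 / p n) \<partial>?H) < \<infinity>"
    using cond_i unfolding ratio_def by blast
  obtain \<epsilon> I where \<epsilon>: "0 < \<epsilon>" and I: "0 < I" and lim_ii:
    "limsup (\<lambda>n. ereal (1 / real n) * elog (LINT \<theta>:- ball \<alpha> \<eta>|u.
            measure (hmm_law \<sigma> \<mu>' (K \<theta>))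
              {\<omega> \<in> space (hmm_law \<sigma> \<mu>' (K \<theta>)). levy_prokhorov (empirical n (obs h n \<omega>)) ?\<nu> < \<epsilon>}))
         \<le> - ereal I"
    using cond_ii \<eta> by blast
  define a where "a n = (LINT \<theta>:- ball \<alpha> \<eta>|u. measure (hmm_law \<sigma> \<mu>' (K \<theta>))
      {\<omega> \<in> space (hmm_law \<sigma> \<mu>' (K \<theta>)). levy_prokhorov (empirical n (obs h n \<omega>)) ?\<nu> < \<epsilon>})" for n
  define F where "F n = {\<omega> \<in> space ?H. \<not> levy_prokhorov (empirical n (obs h n \<omega>)) ?\<nu> < \<epsilon>}" for n
  \<comment> \<open>The integral from condition (ii) will be bounded by
    \<open>exp (- (n * I / 2))\<close>. The exponent \<open>n * I / 4\<close> spends half of this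
    decay, while \<open>t n powr (1 / p n)\<close> still tends to infinity because
    \<open>p n / n\<close> tends to 0.\<close>
  define t where "t n = exp (real n * (I / 4))" for n
  obtain C where C: "0 \<le> C" "\<And>n. 1 \<le> n \<Longrightarrow> (\<integral>\<^sup>+\<omega>. epowr (ratio n (\<rho> n) (obs h n \<omega>)) (1 / p n) \<partial>?H) \<le> ennreal C"
  proof -
    define G where "G n = (\<integral>\<^sup>+\<omega>. epowr (ratio n (\<rho> n) (obs h n \<omega>)) (1 / p n) \<partial>?H)" for n
    define S where "S = (SUP n\<in>{1..}. G n)"
    have "S < \<infinity>" using fin by (simp only: S_def G_def)
    then obtain C where C: "0 \<le> C" "S = ennreal C" by (cases S) auto
    have "G n \<le> S" if "1 \<le> n" for n
      unfolding S_def using that by (intro SUP_upper) simp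
    then show ?thesis using that[of C] C by (simp add: G_def)
  qed
  have a0: "0 \<le> a n" for n
    unfolding a_def set_lebesgue_integral_def by (intro Bochner_Integration.integral_nonneg) simp
  have "\<forall>\<^sub>F n in sequentially. ereal (1 / real n) * elog (a n) < ereal (- (I / 2))"
  proof (rule Limsup_lessD)
    \<comment> \<open>Weakening \<open>I\<close> to \<open>I / 2\<close> leaves the strict gap from
      which an eventual inequality can be read off.\<close>
    show "limsup (\<lambda>n. ereal (1 / real n) * elog (a n)) < ereal (- (I / 2))"
      using lim_ii unfolding a_def[symmetric] by (rule le_less_trans) (simp add: I)
  qed
  then have a_le: "\<forall>\<^sub>F n in sequentially. a n \<le> exp (- (real n * (I / 2)))"
    using eventually_gt_at_top[of 0] by eventually_elim (rule elog_scaled_less[OF _ _ a0])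
  \<comment> \<open>The quotient \<open>n / p n\<close> is written as
    \<open>inverse (p n / real n)\<close>, so that its divergence follows from condition (i) by
    inverting a positive null sequence.\<close>
  have bound: "\<forall>\<^sub>F n in sequentially. post n \<le> X.H.prob (F n) + C * exp (- (inverse (p n / real n) * (I / 4))) + exp (- (real n * (I / 4)))"
    using a_le eventually_ge_at_top[of 1]
  proof eventually_elim
    case (elim n)
    define B where "B = {y \<in> space (\<Pi>\<^sub>M k\<in>{1..n}. borel). levy_prokhorov (empirical n y) ?\<nu> < \<epsilon>}"
    have B: "B \<in> sets (\<Pi>\<^sub>M k\<in>{1..n}. borel)"
      unfolding B_def by (rule levy_prokhorov_empirical_measurable[OF X.measure_limit_obs_law(2,3)[OF sets.empty_sets] elim(2)])
    \<comment> \<open>Observations are extensional functions by construction, so membership in the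
      product space is automatic.\<close>
    have inB: "obs h n \<omega> \<in> B \<longleftrightarrow> levy_prokhorov (empirical n (obs h n \<omega>)) ?\<nu> < \<epsilon>" for \<omega> :: "(nat \<Rightarrow> 'e) \<times> (nat \<Rightarrow> real ^ 'p)"
      by (auto simp: B_def obs_def space_PiM)
    have ratio_m: "(\<lambda>\<omega>. ratio n (\<rho> n) (obs h n \<omega>)) \<in> borel_measurable ?H"
      by (rule measurable_compose[OF X.measurable_obs measurable_ratio])
    have t: "0 < t n" by (simp add: t_def)
    have "post n \<le> X.H.prob (F n) + X.H.prob {\<omega> \<in> space ?H. ennreal (t n) < ratio n (\<rho> n) (obs h n \<omega>)} + t n * a n"
      using expectation_posterior_le[OF _ B \<rho> t, of "- ball \<alpha> \<eta>"]
      unfolding post_def F_def a_def inB by simp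
    moreover have "X.H.prob {\<omega> \<in> space ?H. ennreal (t n) < ratio n (\<rho> n) (obs h n \<omega>)} \<le> C / t n powr (1 / p n)"
      using p(1)[of n] by (intro prob_gt_le_of_epowr_bound C elim t X.H.prob_space_axioms ratio_m) auto
    moreover have "C / t n powr (1 / p n) = C * exp (- (inverse (p n / real n) * (I / 4)))"
      by (simp add: t_def powr_def exp_minus field_simps)
    moreover have "t n * a n \<le> t n * exp (- (real n * (I / 2)))"
      using elim(1) t by (intro mult_left_mono) auto
    moreover have "t n * exp (- (real n * (I / 2))) = exp (- (real n * (I / 4)))"
      unfolding t_def by (simp add: field_simps flip: exp_add)
    ultimately show ?case by linarith
  qed
  have exp0: "(\<lambda>n. exp (- (f n * (I / 4)))) \<longlonglongrightarrow> 0" if "filterlim f at_top sequentially" for f :: "nat \<Rightarrow> real"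
    using I by (intro filterlim_compose[OF exp_at_bot] filterlim_compose[OF filterlim_uminus_at_bot_at_top]
        filterlim_at_top_mult_tendsto_pos[OF tendsto_const _ that]) simp
  have "filterlim (\<lambda>n. inverse (p n / real n)) at_top sequentially"
    using p(2)
  proof (rule filterlim_inverse_at_top)
    show "\<forall>\<^sub>F n in sequentially. 0 < p n / real n"
      using eventually_gt_at_top[of 0]
    proof eventually_elim
      case (elim n)
      then show ?case using p(1)[of n] by simp
    qed
  qed
  moreover have "(\<lambda>n. X.H.prob (F n)) \<longlonglongrightarrow> 0"
    using X.levy_prokhorov_tendsto[OF \<epsilon>] by (simp only: F_def)
  ultimately have "(\<lambda>n. X.H.prob (F n) + C * exp (- (inverse (p n / real n) * (I / 4))) + exp (- (real n * (I / 4))))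
      \<longlonglongrightarrow> 0 + C * 0 + 0"
    by (intro tendsto_add tendsto_mult tendsto_const exp0 filterlim_real_sequentially)
  then have lim: "(\<lambda>n. X.H.prob (F n) + C * exp (- (inverse (p n / real n) * (I / 4))) + exp (- (real n * (I / 4)))) \<longlonglongrightarrow> 0"
    by simp
  have "0 \<le> post n" for n
    unfolding post_def
    by (intro Bochner_Integration.integral_nonneg posterior_bounds(1) measurable_space[OF X.measurable_obs]) auto
  then have "post \<longlonglongrightarrow> 0"
    by (intro tendsto_sandwich[OF _ bound tendsto_const lim] always_eventually) simp
  then show "(\<lambda>n. \<integral>\<omega>. posterior h \<sigma> \<mu>' K u n (obs h n \<omega>) (- ball \<alpha> \<eta>) \<partial>?H) \<longlonglongrightarrow> 0"
    unfolding post_def[abs_def] .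
qed

end
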